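(* Fix integers $M\ge3$, $m\ge11$. Let $W_\Gamma$ be a Coxeter group whose underlying graph $\Gamma$ is a complete graph with $m$ vertices and all edge labels in $[3,M]$. Then $$p_\Lambda(W_\Gamma)\ge1+\frac{\log\left(\lfloor\frac{m-5}{3}\rfloor\right)}{\log(2M-1)}.$$
   Context: **Coxeter groups.** For a finite simplicial graph $\Gamma$ with each edge $\{s,t\}$ labelled by an integer $m_{st}\ge2$, $W_\Gamma$ is the group generated by the vertices of $\Gamma$ with relations $s^2=1$ for each vertex $s$ and $(st)^{m_{st}}=1$ for each edge $\{s,t\}$. **Poincaré profiles.** For a finite graph $Y$ with vertex set $V(Y)$, edge set $E(Y)$, and $p\in[1,\infty]$, let $h^p(Y)=\inf\{\|\nabla f\|_p/\|f\|_p : f:V(Y)\to\mathbb R,\ \sum_v f(v)=0,\ f\not\equiv 0\}$, where $|\nabla f|(e)=|f(x)-f(y)|$ for an edge $e$ with endpoints $x,y$, and $\|\cdot\|_p$ are $\ell^p$ norms with respect to counting measure (convention: $h^p=0$ for a one-vertex graph). For an infinite bounded degree graph $X$, $\Lambda^p_X(r)=\sup\{|Y|h^p(Y): Y\le X \text{ a finite subgraph},\ |Y|\le r\}$, with $|Y|=|V(Y)|$. For a finitely generated group use a Cayley graph with respect to a finite generating set. Write $f\lesssim g$ if there is $C>0$ with $f(r)\le Cg(Cr+C)+C$ for all $r$. The critical exponent is $p_\Lambda(X)=\inf\{p\ge 1: \Lambda^p_X(r)\lesssim r^{1-1/p}\}$. *)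

theory Defs
  imports "HOL-Algebra.Generated_Groups" "HOL-Analysis.Analysis"
begin

section \<open>Graphs\<close>

record 'v ugraph =
  verts :: "'v set"
  edges :: "'v set set"

definition all_pairs :: "'v set \<Rightarrow> 'v set set" where
  "all_pairs V = {e. e \<subseteq> V \<and> card e = 2}"

definition simple_graph :: "'v ugraph \<Rightarrow> bool" where
  "simple_graph X \<longleftrightarrow> edges X \<subseteq> all_pairs (verts X)"

definition complete_graph :: "'v ugraph \<Rightarrow> bool" where
  "complete_graph X \<longleftrightarrow> edges X = all_pairs (verts X)"

definition subgraph_of :: "'v ugraph \<Rightarrow> 'v ugraph \<Rightarrow> bool" where
  "subgraph_of Y X \<longleftrightarrow> simple_graph Y \<and> verts Y \<subseteq> verts X \<and> edges Y \<subseteq> edges X"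


section \<open>Group presentations\<close>

text \<open>The letter \<open>(x, True)\<close> stands for the generator \<open>x\<close> and \<open>(x, False)\<close> for its formal
  inverse.\<close>

type_synonym 'a word = "('a \<times> bool) list"

definition words :: "'a set \<Rightarrow> 'a word set" where
  "words A = lists (A \<times> UNIV)"

inductive_set word_cong :: "'a set \<Rightarrow> 'a word set \<Rightarrow> ('a word \<times> 'a word) set"
  for A :: "'a set" and R :: "'a word set"
where
  refl: "w \<in> words A \<Longrightarrow> (w, w) \<in> word_cong A R"
| sym: "(u, v) \<in> word_cong A R \<Longrightarrow> (v, u) \<in> word_cong A R"
| trans: "(u, v) \<in> word_cong A R \<Longrightarrow> (v, w) \<in> word_cong A R \<Longrightarrow> (u, w) \<in> word_cong A R"
| cancel: "u \<in> words A \<Longrightarrow> v \<in> words A \<Longrightarrow> x \<in> A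
    \<Longrightarrow> (u @ [(x, b), (x, \<not> b)] @ v, u @ v) \<in> word_cong A R"
| relator: "u \<in> words A \<Longrightarrow> v \<in> words A \<Longrightarrow> r \<in> R \<Longrightarrow> r \<in> words A
    \<Longrightarrow> (u @ r @ v, u @ v) \<in> word_cong A R"

definition presented_group :: "'a set \<Rightarrow> 'a word set \<Rightarrow> 'a word set monoid" where
  "presented_group A R =
    \<lparr> carrier = words A // word_cong A R,
      monoid.mult = (\<lambda>P Q. \<Union>u\<in>P. \<Union>v\<in>Q. word_cong A R `` {u @ v}),
      one = word_cong A R `` {[]} \<rparr>"

lemma words_append [simp]: "u @ v \<in> words A \<longleftrightarrow> u \<in> words A \<and> v \<in> words A"
  by (simp add: words_def)

lemma words_Nil [simp]: "[] \<in> words A"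
  by (simp add: words_def)

lemma words_Cons [simp]: "a # w \<in> words A \<longleftrightarrow> fst a \<in> A \<and> w \<in> words A"
  by (cases a) (auto simp: words_def)

lemma word_cong_words: "(u, v) \<in> word_cong A R \<Longrightarrow> u \<in> words A \<and> v \<in> words A"
  by (induction rule: word_cong.induct) auto

lemma equiv_word_cong: "equiv (words A) (word_cong A R)"
proof (rule equivI)
  show "word_cong A R \<subseteq> words A \<times> words A"
    using word_cong_words by fast
  show "refl_on (words A) (word_cong A R)"
    by (rule refl_onI) (rule word_cong.refl)
  show "sym (word_cong A R)"
    by (rule symI) (rule word_cong.sym)
  show "trans (word_cong A R)"
    by (rule transI) (rule word_cong.trans)
qed

lemma word_cong_context:
  assumes "(u, v) \<in> word_cong A R" "a \<in> words A" "b \<in> words A"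
  shows "(a @ u @ b, a @ v @ b) \<in> word_cong A R"
  using assms
proof (induction rule: word_cong.induct)
  case (cancel u v x c)
  then show ?case
    using word_cong.cancel[of "a @ u" A "v @ b" x c R] by simp
next
  case (relator u v r)
  then show ?case
    using word_cong.relator[of "a @ u" A "v @ b" r R] by simp
qed (auto intro: word_cong.intros)

lemma word_cong_append:
  assumes "(u, u') \<in> word_cong A R" "(v, v') \<in> word_cong A R"
  shows "(u @ v, u' @ v') \<in> word_cong A R"
proof -
  have "(u @ v, u' @ v) \<in> word_cong A R"
    using word_cong_context[OF assms(1), of "[]" v] word_cong_words[OF assms(2)] by simp
  moreover have "(u' @ v, u' @ v') \<in> word_cong A R"
    using word_cong_context[OF assms(2), of u' "[]"] word_cong_words[OF assms(1)] by simp
  ultimately show ?thesis by (rule word_cong.trans)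
qed

lemma mult_presented_group:
  assumes "u \<in> words A" "v \<in> words A"
  shows "(word_cong A R `` {u}) \<otimes>\<^bsub>presented_group A R\<^esub> (word_cong A R `` {v})
    = word_cong A R `` {u @ v}"
proof -
  have "(\<lambda>u v. word_cong A R `` {u @ v}) respects2 word_cong A R"
    by (rule congruent2I')
      (meson equiv_class_eq equiv_word_cong word_cong_append)
  from UN_equiv_class2[OF equiv_word_cong equiv_word_cong this assms]
  show ?thesis by (simp add: presented_group_def)
qed

lemma inverse_word_cong:
  "w \<in> words A \<Longrightarrow> (rev (map (\<lambda>(x, b). (x, \<not> b)) w) @ w, []) \<in> word_cong A R
    \<and> rev (map (\<lambda>(x, b). (x, \<not> b)) w) \<in> words A"
proof (induction w)
  case Nil
  then show ?case by (auto intro: word_cong.refl)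
next
  case (Cons a w)
  obtain x b where a: "a = (x, b)" by (cases a)
  let ?i = "rev (map (\<lambda>(x, b). (x, \<not> b)) w)"
  have x: "x \<in> A" and w: "w \<in> words A" and IH: "(?i @ w, []) \<in> word_cong A R" "?i \<in> words A"
    using Cons a by auto
  have "(?i @ [(x, \<not> b), (x, \<not> \<not> b)] @ w, ?i @ w) \<in> word_cong A R"
    using IH w x by (intro word_cong.cancel) auto
  then show ?case
    using IH x a by (auto intro: word_cong.trans)
qed

lemma group_presented_group: "group (presented_group A R)"
proof (rule groupI)
  let ?G = "presented_group A R"
  note E = equiv_word_cong[of A R]
  have car: "carrier ?G = words A // word_cong A R"
    and one: "\<one>\<^bsub>?G\<^esub> = word_cong A R `` {[]}" by (simp_all add: presented_group_def)
  show "\<one>\<^bsub>?G\<^esub> \<in> carrier ?G" unfolding car one by (simp add: quotientI)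
  fix P Q S assume P: "P \<in> carrier ?G" and Q: "Q \<in> carrier ?G" and S: "S \<in> carrier ?G"
  then obtain u v w where uvw: "u \<in> words A" "v \<in> words A" "w \<in> words A"
    and eq: "P = word_cong A R `` {u}" "Q = word_cong A R `` {v}" "S = word_cong A R `` {w}"
    unfolding car by (auto elim!: quotientE)
  show "P \<otimes>\<^bsub>?G\<^esub> Q \<in> carrier ?G"
    using uvw unfolding eq car by (simp add: mult_presented_group quotientI)
  show "P \<otimes>\<^bsub>?G\<^esub> Q \<otimes>\<^bsub>?G\<^esub> S = P \<otimes>\<^bsub>?G\<^esub> (Q \<otimes>\<^bsub>?G\<^esub> S)"
    using uvw unfolding eq by (simp add: mult_presented_group)
  show "\<one>\<^bsub>?G\<^esub> \<otimes>\<^bsub>?G\<^esub> P = P"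
    using uvw unfolding eq one by (simp add: mult_presented_group)
  show "\<exists>Q\<in>carrier ?G. Q \<otimes>\<^bsub>?G\<^esub> P = \<one>\<^bsub>?G\<^esub>"
  proof
    let ?i = "rev (map (\<lambda>(x, b). (x, \<not> b)) u)"
    have i: "(?i @ u, []) \<in> word_cong A R" "?i \<in> words A"
      using inverse_word_cong[OF uvw(1)] by auto
    show "word_cong A R `` {?i} \<in> carrier ?G" using i unfolding car by (simp add: quotientI)
    show "word_cong A R `` {?i} \<otimes>\<^bsub>?G\<^esub> P = \<one>\<^bsub>?G\<^esub>"
      unfolding eq one mult_presented_group[OF i(2) uvw(1)]
      by (rule equiv_class_eq[OF E i(1)])
  qed
qed


section \<open>Coxeter groups\<close>

text \<open>A labelling of the edges of \<open>\<Gamma>\<close> is a function \<open>l\<close> on vertex sets, only used on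
  \<open>edges \<Gamma>\<close>. Pairs of vertices that do not span an edge contribute no relation.\<close>

definition coxeter_relators :: "'a ugraph \<Rightarrow> ('a set \<Rightarrow> nat) \<Rightarrow> 'a word set" where
  "coxeter_relators \<Gamma> l =
    {[(s, True), (s, True)] | s. s \<in> verts \<Gamma>} \<union>
    {concat (replicate (l {s, t}) [(s, True), (t, True)]) | s t. {s, t} \<in> edges \<Gamma>}"

definition coxeter_group :: "'a ugraph \<Rightarrow> ('a set \<Rightarrow> nat) \<Rightarrow> 'a word set monoid" where
  "coxeter_group \<Gamma> l = presented_group (verts \<Gamma>) (coxeter_relators \<Gamma> l)"


section \<open>Cayley graphs\<close>

definition finite_generating_set :: "('g, 'b) monoid_scheme \<Rightarrow> 'g set \<Rightarrow> bool" where
  "finite_generating_set G S \<longleftrightarrow> finite S \<and> S \<subseteq> carrier G \<and> generate G S = carrier G"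

definition cayley_graph :: "('g, 'b) monoid_scheme \<Rightarrow> 'g set \<Rightarrow> 'g ugraph" where
  "cayley_graph G S =
    \<lparr> verts = carrier G,
      edges = {{g, g \<otimes>\<^bsub>G\<^esub> s} | g s. g \<in> carrier G \<and> s \<in> S \<and> g \<otimes>\<^bsub>G\<^esub> s \<noteq> g} \<rparr>"


section \<open>Poincare profiles\<close>

definition lp_norm :: "ereal \<Rightarrow> 'x set \<Rightarrow> ('x \<Rightarrow> real) \<Rightarrow> real" where
  "lp_norm p A f =
    (if p = \<infinity> then Max (insert 0 ((\<lambda>x. \<bar>f x\<bar>) ` A))
     else (\<Sum>x\<in>A. \<bar>f x\<bar> powr real_of_ereal p) powr (1 / real_of_ereal p))"

definition abs_gradient :: "('v \<Rightarrow> real) \<Rightarrow> 'v set \<Rightarrow> real" where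
  "abs_gradient f e = (THE d. \<exists>x y. e = {x, y} \<and> d = \<bar>f x - f y\<bar>)"

lemma abs_gradient_pair: "abs_gradient f {x, y} = \<bar>f x - f y\<bar>"
  unfolding abs_gradient_def by (rule the_equality) (auto simp: doubleton_eq_iff)

text \<open>Only the restriction of \<open>f\<close> to \<open>verts Y\<close> matters. For one vertex the set of quotients is
  empty, so the conventional value is imposed.\<close>

definition poincare_const :: "ereal \<Rightarrow> 'v ugraph \<Rightarrow> real" where
  "poincare_const p Y =
    (if card (verts Y) \<le> 1 then 0
     else Inf {lp_norm p (edges Y) (abs_gradient f) / lp_norm p (verts Y) f | f.
                 (\<Sum>v\<in>verts Y. f v) = 0 \<and> (\<exists>v\<in>verts Y. f v \<noteq> 0)})"

text \<open>The empty subgraph is admitted; it contributes the value 0, so that the supremum is over a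
  nonempty set for every \<open>r \<ge> 0\<close>.\<close>

definition poincare_profile :: "ereal \<Rightarrow> 'v ugraph \<Rightarrow> real \<Rightarrow> real" where
  "poincare_profile p X r =
    Sup {real (card (verts Y)) * poincare_const p Y | Y.
           subgraph_of Y X \<and> finite (verts Y) \<and> real (card (verts Y)) \<le> r}"

definition coarse_le :: "(real \<Rightarrow> real) \<Rightarrow> (real \<Rightarrow> real) \<Rightarrow> bool" where
  "coarse_le f g \<longleftrightarrow> (\<exists>C>0. \<forall>r\<ge>0. f r \<le> C * g (C * r + C) + C)"

text \<open>Extended real valued, so that the infimum is \<open>\<infinity>\<close> if no finite exponent qualifies; for
  \<open>p = \<infinity>\<close> the term \<open>1 / p\<close> is 0.\<close>

definition critical_exponent :: "'v ugraph \<Rightarrow> ereal" where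
  "critical_exponent X =
    Inf {p. 1 \<le> p \<and> coarse_le (poincare_profile p X) (\<lambda>r. r powr (1 - real_of_ereal (1 / p)))}"

end

theory Submission
  imports Defs "HOL-Library.Transitive_Closure_Table" "HOL-Real_Asymp.Real_Asymp"
begin

text \<open>Words act on real functions on the generators by the numbers game of the Coxeter
  matrix, the contragredient of the geometric representation. Starting from a path in the Cayley
  graph whose edges carry disjoint lists of \<open>V = \<lfloor>(m - 5) / 3\<rfloor>\<close> further generators, each of the
  \<open>V\<close> choices pushes the path off itself: an edge labelled \<open>l\<close> is replaced by the far side of the
  polygon spanned by \<open>l\<close> and the chosen generator, and two neighbouring far sides are joined around
  a second polygon. The length grows at most by the factor \<open>2M - 1\<close>. A ping-pong argument
  for the numbers game shows that after \<open>n\<close> rounds the \<open>V\<^sup>n\<close> resulting paths are pairwise disjoint;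
  rays join them to one root path. Averaging over the root path bounds the \<open>p\<close>-Poincare
  constant \<open>h\<close> of this tree of paths with \<open>N\<close> vertices from below: \<open>N\<^bsup>1/p\<^esup> h\<close> is unbounded as
  soon as \<open>(2M - 1)\<^bsup>p - 1\<^esup> < V\<close>, which excludes every such \<open>p\<close>.\<close>

section \<open>The numbers game of a Coxeter matrix\<close>

text \<open>Disjointness of paths is decided by signs. Congruent words act equally on the constant
  function 1, and a negative coordinate at \<open>s\<close> of the image marks \<open>s\<close> as a
  possible first letter. A word leaving a vertex along branch \<open>v\<close> makes some
  \<open>v\<close>-th list letter of that vertex negative and keeps every coordinate outside these
  letters positive, so branch, step and remaining vector can be recovered from the image. This
  survives the next step because new lists avoid the generators that the current step involves: at
  most five letters and the preceding list, so \<open>2 * V + 5\<close> generators suffice. In the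
  Poincare inequality a path of length L costs about L^p, while V^n disjoint paths of that length
  have V^n L vertices; L is at most (2M - 1)^n up to a polynomial factor, so the quotient L^(p-1) /
  V^n decays. Two obstacles remain. The paths may differ in length, so only one dyadic class of
  lengths is kept, at the price of a factor linear in the number n of rounds. The rays have length n
  and must not outweigh the paths, so the root path gets the polynomial length (n+1)^j with j at
  least p + 1, which leaves the exponential rates unchanged.\<close>

fun alt :: "'a \<Rightarrow> 'a \<Rightarrow> nat \<Rightarrow> 'a list" where
  "alt a b 0 = []"
| "alt a b (Suc n) = a # alt b a n"

lemma length_alt [simp]: "length (alt a b n) = n"
  by (induction n arbitrary: a b) auto

lemma set_alt: "set (alt a b n) \<subseteq> {a, b}"
  by (induction n arbitrary: a b) fastforce+

lemma alt_append: "alt a b (n + k) = alt a b n @ (if even n then alt a b k else alt b a k)"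
  by (induction n arbitrary: a b) auto

lemma rev_alt: "rev (alt a b n) = (if odd n then alt a b n else alt b a n)"
proof (induction n arbitrary: a b)
  case (Suc n)
  have "alt x y n @ [if even n then x else y] = alt x y (Suc n)" for x y :: 'a
    using alt_append[of x y n 1] by simp
  from this[of a b] this[of b a] show ?case by (auto simp: Suc)
qed simp

locale coxeter_numbers =
  fixes A :: "'a set" and mm :: "'a \<Rightarrow> 'a \<Rightarrow> nat"
  assumes finite_A: "finite A"
    and mm_sym: "mm s t = mm t s"
    and mm_ge: "s \<in> A \<Longrightarrow> t \<in> A \<Longrightarrow> s \<noteq> t \<Longrightarrow> 3 \<le> mm s t"
begin

definition cc :: "'a \<Rightarrow> 'a \<Rightarrow> real" where
  "cc s t = 2 * cos (pi / mm s t)"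

text \<open>Coordinates of a functional in the simple roots: \<open>x j\<close> is its value at the
  root of \<open>j\<close>, and the reflection \<open>s\<close> maps that root to itself plus
  \<open>cc s j\<close> times the root of \<open>s\<close>. For positive \<open>x\<close>, a
  negative \<open>act w x s\<close> thus means that \<open>s\<close> is a left descent of
  \<open>w\<close>.\<close>

definition flip :: "'a \<Rightarrow> ('a \<Rightarrow> real) \<Rightarrow> ('a \<Rightarrow> real)" where
  "flip s x = (\<lambda>j. if j = s then - x s else x j + (if j \<in> A then cc s j * x s else 0))"

definition act :: "'a list \<Rightarrow> ('a \<Rightarrow> real) \<Rightarrow> ('a \<Rightarrow> real)" where
  "act w x = foldr flip w x"

lemma act_Nil [simp]: "act [] x = x"
  and act_Cons: "act (s # w) x = flip s (act w x)"
  and act_append: "act (u @ v) x = act u (act v x)"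
  by (simp_all add: act_def)

lemma cc_sym: "cc s t = cc t s"
  by (simp add: cc_def mm_sym)

text \<open>Here labels at least 3 enter: flipping a positive coordinate raises every other
  coordinate in \<open>A\<close> by at least that amount, which is the estimate behind the growth
  and domination arguments below.\<close>

lemma cc_ge_1:
  assumes "s \<in> A" "t \<in> A" "s \<noteq> t"
  shows "1 \<le> cc s t"
proof -
  have m: "3 \<le> mm s t" using mm_ge assms by blast
  have "cos (pi / 3) \<le> cos (pi / mm s t)"
    using m by (intro cos_monotone_0_pi_le) (auto simp: field_simps)
  then show ?thesis by (simp add: cc_def cos_60)
qed

lemma cc_less_2:
  assumes "s \<in> A" "t \<in> A" "s \<noteq> t"
  shows "cc s t < 2"
proof -
  have m: "3 \<le> mm s t" using mm_ge assms by blast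
  have "cos (pi / mm s t) < cos 0"
    using m by (intro cos_monotone_0_pi) (auto simp: field_simps)
  then show ?thesis by (simp add: cc_def)
qed

lemma flip_flip [simp]: "flip s (flip s x) = x"
  by (rule ext) (simp add: flip_def)

lemma flip_same [simp]: "flip s x s = - x s"
  by (simp add: flip_def)

lemma flip_other: "j \<noteq> s \<Longrightarrow> j \<in> A \<Longrightarrow> flip s x j = x j + cc s j * x s"
  by (simp add: flip_def)

lemma act_rev_act [simp]: "act (rev w) (act w x) = x"
  by (induction w arbitrary: x) (simp_all add: act_append act_Cons)

text \<open>For natural \<open>k\<close> this is the Chebyshev polynomial U_(k-1) of the second kind
  at \<open>cc s t / 2\<close>. A real argument lets the coordinate formulas use the index
  -1.\<close>

definition cheb :: "'a \<Rightarrow> 'a \<Rightarrow> real \<Rightarrow> real" where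
  "cheb s t k = sin (k * (pi / mm s t)) / sin (pi / mm s t)"

lemma cheb_sym: "cheb s t k = cheb t s k"
  by (simp add: cheb_def mm_sym)

lemma sin_angle_pos:
  assumes "s \<in> A" "t \<in> A" "s \<noteq> t"
  shows "0 < sin (pi / mm s t)"
  using mm_ge[OF assms] by (intro sin_gt_zero) (auto simp: field_simps)

lemma cheb_rec: "cc s t * cheb s t (k + 1) - cheb s t k = cheb s t (k + 2)"
proof -
  define \<theta> where "\<theta> = pi / mm s t"
  have "2 * cos \<theta> * sin ((k + 1) * \<theta>) = sin ((k + 2) * \<theta>) + sin (k * \<theta>)"
    using sin_times_cos[of "(k + 1) * \<theta>" \<theta>] by (simp add: algebra_simps)
  then have "2 * cos \<theta> * sin ((k + 1) * \<theta>) - sin (k * \<theta>) = sin ((k + 2) * \<theta>)"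
    by simp
  then show ?thesis
    unfolding cheb_def cc_def \<theta>_def[symmetric] diff_divide_distrib[symmetric] times_divide_eq_right
    by simp
qed

lemma cheb_nonneg:
  assumes "s \<in> A" "t \<in> A" "s \<noteq> t" "0 \<le> k" "k \<le> real (mm s t)"
  shows "0 \<le> cheb s t k"
proof -
  have "0 \<le> sin (k * (pi / mm s t))"
    using assms mm_ge[OF assms(1-3)] by (intro sin_ge_zero) (auto simp: field_simps)
  then show ?thesis
    unfolding cheb_def using sin_angle_pos[OF assms(1-3)] by simp
qed

lemma cheb_pos:
  assumes "s \<in> A" "t \<in> A" "s \<noteq> t" "0 < k" "k < real (mm s t)"
  shows "0 < cheb s t k"
proof -
  have "0 < sin (k * (pi / mm s t))"
    using assms mm_ge[OF assms(1-3)] by (intro sin_gt_zero) (auto simp: field_simps)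
  then show ?thesis
    unfolding cheb_def using sin_angle_pos[OF assms(1-3)] by simp
qed

text \<open>By \<open>cheb_rec\<close> the formulas for \<open>n + 1\<close> follow from those for
  \<open>n\<close> with the two generators exchanged. The rightmost letter acts first and depends on
  the parity of \<open>n\<close>, hence the case distinction between \<open>z a\<close> and
  \<open>z b\<close>.\<close>

lemma act_alt_coords:
  assumes "a \<in> A" "b \<in> A" "a \<noteq> b"
  shows "act (alt b a n) z a = cheb a b (real n + 1) * (if even n then z a else z b)
        + cheb a b (real n) * (if even n then z b else z a)"
    and "act (alt b a n) z b = - (cheb a b (real n) * (if even n then z a else z b)
        + cheb a b (real n - 1) * (if even n then z b else z a))"
  using assms
proof (induction n arbitrary: a b)
  case 0
  {
    case 1
    then show ?case using sin_angle_pos[of a b] by (simp add: cheb_def)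
  next
    case 2
    then show ?case using sin_angle_pos[of a b] by (simp add: cheb_def)
  }
next
  case (Suc n)
  {
    case 1
    let ?f = "if even n then z b else z a" and ?o = "if even n then z a else z b"
    have "act (alt b a (Suc n)) z a = act (alt a b n) z a + cc b a * act (alt a b n) z b"
      using 1 by (simp add: act_Cons flip_other)
    also have "\<dots> = - (cheb b a (real n) * ?f + cheb b a (real n - 1) * ?o)
       + cc b a * (cheb b a (real n + 1) * ?f + cheb b a (real n) * ?o)"
      using Suc.IH(1)[of b a] Suc.IH(2)[of b a] 1 by simp
    also have "\<dots> = (cc b a * cheb b a (real n + 1) - cheb b a (real n)) * ?f
       + (cc b a * cheb b a (real n) - cheb b a (real n - 1)) * ?o"
      by (simp add: algebra_simps)
    also have "\<dots> = cheb a b (real (Suc n) + 1) * ?f + cheb a b (real (Suc n)) * ?o"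
      using cheb_rec[of b a "real n"] cheb_rec[of b a "real n - 1"] cheb_sym[of a b]
      by (simp add: algebra_simps)
    finally show ?case by simp
  next
    case 2
    then show ?case
      using Suc.IH(1)[of b a] cheb_sym[of a b] by (simp add: act_Cons add.commute)
  }
qed

text \<open>On the two coordinates \<open>s\<close> and \<open>t\<close> the Chebyshev values have
  period \<open>2 * mm s t\<close>. Any third coordinate is then recovered from an invariant linear
  form, whose coefficients exist because \<open>cc s t\<close> lies strictly below 2, so that the
  dihedral subgroup has a nondegenerate form.\<close>

lemma act_alt_full:
  assumes "s \<in> A" "t \<in> A" "s \<noteq> t"
  shows "act (alt s t (2 * mm s t)) x = x"
proof
  fix j
  let ?w = "alt s t (2 * mm s t)"
  have m: "3 \<le> mm s t" using mm_ge assms by blast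
  have per: "cheb s t (2 * real (mm s t) + k) = cheb s t k" for k
  proof -
    have "(2 * real (mm s t) + k) * (pi / mm s t) = k * (pi / mm s t) + 2 * pi"
      using m by (simp add: field_simps)
    then show ?thesis by (simp add: cheb_def)
  qed
  have c1: "cheb s t 1 = 1" and c0: "cheb s t 0 = 0" and cm: "cheb s t (-1) = -1"
    using sin_angle_pos[OF assms] by (simp_all add: cheb_def)
  have t: "act ?w x t = x t"
    using act_alt_coords(1)[of t s "2 * mm s t" x] assms per[of 1] per[of 0] c1 c0
    by (simp add: cheb_sym[of t s])
  have s: "act ?w x s = x s"
    using act_alt_coords(2)[of t s "2 * mm s t" x] assms per[of "-1"] per[of 0] cm c0
    by (simp add: cheb_sym[of t s])
  show "act ?w x j = x j"
  proof (cases "j \<in> A \<and> j \<noteq> s \<and> j \<noteq> t")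
    case False
    have "act w x j = x j" if "j \<notin> A" "set w \<subseteq> A" for w
      using that by (induction w) (auto simp: act_Cons flip_def)
    moreover have "set ?w \<subseteq> A" using set_alt[of s t] assms by blast
    ultimately show ?thesis using False s t by blast
  next
    case True
    define c where "c = cc s t"
    have c: "4 - c\<^sup>2 \<noteq> 0"
      using cc_less_2[OF assms] cc_ge_1[OF assms] unfolding c_def
      by (metis abs_of_nonneg add_0 diff_eq_eq less_irrefl order.trans real_sqrt_abs real_sqrt_four zero_le_one)
    define \<alpha> where "\<alpha> = (2 * cc s j + c * cc t j) / (4 - c\<^sup>2)"
    define \<beta> where "\<beta> = (2 * cc t j + c * cc s j) / (4 - c\<^sup>2)"
    have ab: "cc s j - 2 * \<alpha> + \<beta> * c = 0" "cc t j - 2 * \<beta> + \<alpha> * c = 0"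
      unfolding \<alpha>_def \<beta>_def using c by (simp_all add: field_simps power2_eq_square)
    \<comment> \<open>a linear form that both reflections leave invariant\<close>
    define I where "I y = y j + \<alpha> * y s + \<beta> * y t" for y :: "'a \<Rightarrow> real"
    have Is: "I (flip s y) = I y" for y
    proof -
      have "I (flip s y) = I y + (cc s j - 2 * \<alpha> + \<beta> * c) * y s"
        using True assms unfolding I_def by (simp add: flip_other c_def algebra_simps)
      then show ?thesis using ab by simp
    qed
    have It: "I (flip t y) = I y" for y
    proof -
      have "I (flip t y) = I y + (cc t j - 2 * \<beta> + \<alpha> * c) * y t"
        using True assms unfolding I_def
        by (simp add: flip_other c_def cc_sym[of t s] algebra_simps)
      then show ?thesis using ab by simp
    qed
    have "I (act (alt a b n) x) = I x" if "{a, b} = {s, t}" for a b n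
      using that
    proof (induction n arbitrary: a b)
      case (Suc n)
      then show ?case by (auto simp: act_Cons Is It doubleton_eq_iff)
    qed simp
    from this[of s t "2 * mm s t"] show ?thesis using s t by (simp add: I_def)
  qed
qed

text \<open>The two Chebyshev indices \<open>n\<close> and \<open>n + 1\<close> lie between 0 and
  \<open>mm a b\<close>, where the values are nonnegative, and the values do not vanish
  together.\<close>

lemma act_alt_flip_nonneg:
  assumes "a \<in> A" "b \<in> A" "a \<noteq> b" "0 < z a" "0 < z b" "n < mm a b"
  shows "0 < act (alt b a n) z a"
proof -
  have "0 \<le> cheb a b (real n + 1)" "0 \<le> cheb a b (real n)"
    using assms cheb_nonneg[of a b "real n + 1"] cheb_nonneg[of a b "real n"] by simp_all
  moreover have "0 < cheb a b (real n + 1) \<or> 0 < cheb a b (real n)"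
    using assms cheb_pos[of a b "real n + 1"] cheb_pos[of a b "real n"] mm_ge[of a b]
    by (cases "n = 0") auto
  ultimately show ?thesis
    using assms by (auto simp: act_alt_coords(1) intro: add_pos_nonneg add_nonneg_pos)
qed

lemma act_alt_hd:
  assumes "a \<in> A" "b \<in> A" "a \<noteq> b" "0 < z a" "0 < z b" "0 < n" "n \<le> mm a b"
  shows "act (alt a b n) z a < 0"
proof -
  obtain k where k: "n = Suc k" using assms by (cases n) auto
  then show ?thesis using act_alt_flip_nonneg[of a b z k] assms by (simp add: act_Cons)
qed

text \<open>Every letter applied to a vector that is positive on \<open>{a, b}\<close> flips a positive
  coordinate and thereby raises each outer coordinate at least by its value.\<close>

lemma act_alt_step:
  assumes "a \<in> A" "b \<in> A" "a \<noteq> b" "0 < z a" "0 < z b" "n < mm a b" "j \<in> A" "j \<noteq> a" "j \<noteq> b"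
  shows "act (alt b a n) z j + act (alt b a n) z a \<le> act (alt a b (Suc n)) z j"
proof -
  have "act (alt b a n) z a \<le> cc a j * act (alt b a n) z a"
    using cc_ge_1[of a j] act_alt_flip_nonneg[of a b z n] assms by simp
  then show ?thesis using assms by (simp add: act_Cons flip_other)
qed

lemma act_alt_outer_mono:
  assumes "a \<in> A" "b \<in> A" "a \<noteq> b" "0 < z a" "0 < z b" "n \<le> mm a b" "j \<in> A" "j \<noteq> a" "j \<noteq> b"
  shows "z j \<le> act (alt a b n) z j"
  using assms
proof (induction n arbitrary: a b)
  case (Suc n)
  have "z j \<le> act (alt b a n) z j"
    using Suc.IH[of b a] Suc.prems mm_sym[of a b] by simp
  then show ?case
    using act_alt_step[of a b z n j] act_alt_flip_nonneg[of a b z n] Suc.prems by simp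
qed simp

text \<open>The first two letters to act contribute both values: one adds at least its own
  coordinate, the next at least the other coordinate, which has only grown meanwhile. All later
  letters increase the result further.\<close>

lemma act_alt_outer:
  assumes "a \<in> A" "b \<in> A" "a \<noteq> b" "0 < z a" "0 < z b" "2 \<le> n" "n \<le> mm a b"
    and "j \<in> A" "j \<noteq> a" "j \<noteq> b"
  shows "z j + z a + z b \<le> act (alt a b n) z j"
  using assms(6) assms(1-5,7-)
proof (induction n arbitrary: a b rule: nat_induct_at_least)
  case base
  have 1: "act (alt b a 1) z j + act (alt b a 1) z a \<le> act (alt a b 2) z j"
    using act_alt_step[of a b z 1 j] base by (simp add: eval_nat_numeral)
  have 2: "z j + z b \<le> act (alt b a 1) z j"
    using act_alt_step[of b a z 0 j] base mm_sym[of a b] by simp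
  have "z a \<le> act (alt b a 1) z a"
    using base cc_ge_1[of b a] by (simp add: act_Cons flip_other)
  with 1 2 show ?case by simp
next
  case (Suc n)
  have "z j + z b + z a \<le> act (alt b a n) z j"
    using Suc.IH[of b a] Suc.prems mm_sym[of a b] by simp
  then show ?case
    using act_alt_step[of a b z n j] act_alt_flip_nonneg[of a b z n] Suc.prems by simp
qed

end

section \<open>Ping-pong for configurations\<close>

text \<open>An edge \<open>(l, q, L)\<close> of a path in the Cayley graph has label \<open>l\<close> and lies on a polygon
  with labels \<open>l\<close> and \<open>q\<close>; branch \<open>v\<close> leaves it with the generator \<open>L ! v\<close>. A configuration
  consists of the path edges before and after a vertex, \<open>None\<close> standing for an end of the path.\<close>

type_synonym 'a edge = "'a \<times> 'a \<times> 'a list"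
type_synonym 'a config = "'a edge option \<times> 'a edge option"

definition sides :: "'a config \<Rightarrow> 'a edge set" where
  "sides C = set_option (fst C) \<union> set_option (snd C)"

definition letters :: "nat \<Rightarrow> 'a config \<Rightarrow> 'a set" where
  "letters v C = (\<lambda>(l, q, L). L ! v) ` sides C"

definition downs :: "'a config \<Rightarrow> 'a set" where
  "downs C = (\<lambda>(l, q, L). q) ` sides C"

text \<open>The generators at which a vector must be positive for a step beginning with
  \<open>\<tau>\<close> to be recognised. Lists at the next vertex are kept off this set, so that
  \<open>tame\<close> there yields this positivity.\<close>

definition blocked :: "nat \<Rightarrow> 'a config \<Rightarrow> 'a \<Rightarrow> 'a set" where
  "blocked v C \<tau> = downs C \<union> letters v C \<union> {l. \<exists>q L. (l, q, L) \<in> sides C \<and> L ! v = \<tau>}"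

lemma finite_sides [simp]: "finite (sides C)"
  by (simp add: sides_def)

locale coxeter_paths = coxeter_numbers A mm for A :: "'a set" and mm +
  fixes V :: nat
begin

definition wf_edge :: "'a edge \<Rightarrow> bool" where
  "wf_edge = (\<lambda>(l, q, L). l \<in> A \<and> q \<in> A \<and> l \<noteq> q \<and> set L \<subseteq> A \<and> length L = V \<and> distinct L)"

text \<open>Not symmetric: \<open>wf_config\<close> asks for all ordered pairs, and pairing an edge
  with itself keeps its own \<open>l\<close> and \<open>q\<close> out of its list.\<close>

definition compatible :: "'a edge \<Rightarrow> 'a edge \<Rightarrow> bool" where
  "compatible = (\<lambda>(l, q, L) (l', q', L'). l' \<notin> set L \<and> q' \<notin> set L \<and> (L' = L \<or> set L \<inter> set L' = {}))"

definition wf_config :: "'a config \<Rightarrow> bool" where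
  "wf_config C \<longleftrightarrow> (\<forall>e\<in>sides C. wf_edge e \<and> (\<forall>e'\<in>sides C. compatible e e'))"

text \<open>\<open>child v C d C'\<close>: on branch \<open>v\<close> a vertex with configuration \<open>C\<close> is followed by the
  vertex reached by the word \<open>d\<close>, with configuration \<open>C'\<close>. It lies next to the old vertex, or on
  half of a far side of a polygon over a path edge, or on half of a polygon between two
  neighbouring far sides; the side condition for \<open>n = mm \<tau> x\<close> selects one of the two words for
  the middle vertex of the latter.\<close>

definition child :: "nat \<Rightarrow> 'a config \<Rightarrow> 'a list \<Rightarrow> 'a config \<Rightarrow> bool" where
  "child v C d C' \<longleftrightarrow> (\<exists>\<tau>\<in>letters v C. sides C' \<noteq> {} \<and>
     (\<forall>(l, q, L)\<in>sides C'. set L \<inter> blocked v C \<tau> = {}) \<and>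
     (d = [\<tau>] \<and> downs C' = {\<tau>} \<or>
      (\<exists>x n. 2 \<le> n \<and> d = alt \<tau> x n \<and> downs C' = {\<tau>, x} \<and>
        ((\<exists>q L. (x, q, L) \<in> sides C \<and> L ! v = \<tau>) \<and> n < mm \<tau> x \<or>
         x \<in> letters v C \<and> x \<noteq> \<tau> \<and> n < mm \<tau> x \<or>
         x \<in> letters v C \<and> x \<noteq> \<tau> \<and> n = mm \<tau> x
           \<and> (\<exists>l q L. fst C = Some (l, q, L) \<and> L ! v = \<tau>)))))"

text \<open>The ping-pong domain: words leading away from a vertex with configuration \<open>C\<close> along
  branch \<open>v\<close> map the constant function 1 to such a \<open>y\<close>.\<close>

definition tame :: "nat \<Rightarrow> 'a config \<Rightarrow> ('a \<Rightarrow> real) \<Rightarrow> bool" where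
  "tame v C y \<longleftrightarrow> (\<forall>j\<in>A - letters v C. 0 < y j) \<and>
     (\<forall>\<tau>\<in>letters v C. 0 < y \<tau> + (\<Sum>q\<in>downs C. y q))"

lemma wf_configD:
  assumes "wf_config C" "(l, q, L) \<in> sides C"
  shows "l \<in> A" "q \<in> A" "l \<noteq> q" "set L \<subseteq> A" "length L = V" "distinct L"
  using assms by (auto simp: wf_config_def wf_edge_def)

lemma wf_config_compatible:
  assumes "wf_config C" "(l, q, L) \<in> sides C" "(l', q', L') \<in> sides C"
  shows "l' \<notin> set L" "q' \<notin> set L" "L' = L \<or> set L \<inter> set L' = {}"
proof -
  have "compatible (l, q, L) (l', q', L')" using assms unfolding wf_config_def by blast
  then show "l' \<notin> set L" "q' \<notin> set L" "L' = L \<or> set L \<inter> set L' = {}"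
    by (simp_all add: compatible_def)
qed

lemma letter_in_side:
  assumes "wf_config C" "v < V" "(l, q, L) \<in> sides C"
  shows "L ! v \<in> set L" "L ! v \<in> A"
  using wf_configD[OF assms(1,3)] assms(2) by auto

lemma lettersE:
  assumes "\<tau> \<in> letters v C"
  obtains l q L where "(l, q, L) \<in> sides C" "L ! v = \<tau>"
  using assms by (auto simp: letters_def)

lemma downsE:
  assumes "q \<in> downs C"
  obtains l L where "(l, q, L) \<in> sides C"
  using assms by (auto simp: downs_def)

lemma letters_in_A: "wf_config C \<Longrightarrow> v < V \<Longrightarrow> letters v C \<subseteq> A"
  by (auto elim!: lettersE dest: letter_in_side)

lemma downs_in_A: "wf_config C \<Longrightarrow> downs C \<subseteq> A"
  by (auto elim!: downsE dest: wf_configD)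

lemma blocked_in_A:
  assumes "wf_config C" "v < V"
  shows "blocked v C \<tau> \<subseteq> A"
  using letters_in_A[OF assms] downs_in_A[OF assms(1)] wf_configD(1)[OF assms(1)]
  unfolding blocked_def by blast

lemma downs_letters_disjoint:
  assumes "wf_config C" "v < V"
  shows "downs C \<inter> letters v C = {}"
proof -
  have "q \<noteq> L ! v" if "(l', q, L') \<in> sides C" "(l, q', L) \<in> sides C" for l q L l' q' L'
    using wf_config_compatible(2)[OF assms(1) that(2,1)] letter_in_side[OF assms that(2)] by metis
  then show ?thesis by (blast elim: lettersE downsE)
qed

lemma label_not_letter:
  assumes "wf_config C" "v < V" "(l, q, L) \<in> sides C"
  shows "l \<notin> letters v C"
proof
  assume "l \<in> letters v C"
  then obtain l' q' L' where L': "(l', q', L') \<in> sides C" "L' ! v = l" by (rule lettersE)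
  then show False
    using wf_config_compatible(1)[OF assms(1) L'(1) assms(3)] letter_in_side[OF assms(1,2) L'(1)]
    by simp
qed

lemma letters_determine_branch:
  assumes "wf_config C" "v < V" "w < V" "\<tau> \<in> letters v C" "\<tau> \<in> letters w C"
  shows "v = w"
proof -
  obtain l q L where L: "(l, q, L) \<in> sides C" "L ! v = \<tau>" using assms(4) by (rule lettersE)
  obtain l' q' L' where L': "(l', q', L') \<in> sides C" "L' ! w = \<tau>"
    using assms(5) by (rule lettersE)
  have "\<tau> \<in> set L \<inter> set L'"
    using letter_in_side[OF assms(1,2) L(1)] letter_in_side[OF assms(1,3) L'(1)] L L' by simp
  then have "L' = L" using wf_config_compatible(3)[OF assms(1) L(1) L'(1)] by blast
  then show ?thesis
    using L L' wf_configD(5,6)[OF assms(1) L(1)] assms(2,3) by (metis nth_eq_iff_index_eq)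
qed

text \<open>The sum over \<open>downs C\<close> in \<open>tame\<close> lets any single down
  generator pay for a negative letter: down generators are never letters, so the other summands are
  positive.\<close>

lemma tameI:
  assumes wf: "wf_config C" "v < V"
    and pos: "\<And>j. j \<in> A \<Longrightarrow> j \<notin> letters v C \<Longrightarrow> 0 < y j"
    and dom: "\<And>\<tau>. \<tau> \<in> letters v C \<Longrightarrow> 0 < y \<tau> \<or> (\<exists>q\<in>downs C. 0 < y \<tau> + y q)"
  shows "tame v C y"
  unfolding tame_def
proof (intro conjI ballI)
  fix \<tau> assume \<tau>: "\<tau> \<in> letters v C"
  have D: "0 < y q" if "q \<in> downs C" for q
    using that pos[of q] wf downs_in_A downs_letters_disjoint by blast
  have fin: "finite (downs C)" by (simp add: downs_def)
  from dom[OF \<tau>] show "0 < y \<tau> + (\<Sum>q\<in>downs C. y q)"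
  proof
    assume "0 < y \<tau>"
    moreover have "0 \<le> (\<Sum>q\<in>downs C. y q)" using D by (intro sum_nonneg) force
    ultimately show ?thesis by simp
  next
    assume "\<exists>q\<in>downs C. 0 < y \<tau> + y q"
    then obtain q where q: "q \<in> downs C" "0 < y \<tau> + y q" by blast
    then have "y q \<le> (\<Sum>q\<in>downs C. y q)" using D fin by (intro member_le_sum) force+
    then show ?thesis using q by simp
  qed
qed (use pos in blast)

text \<open>The longest element of a dihedral group maps simple roots to negatives of simple roots,
  exchanging them when \<open>mm a b\<close> is odd.\<close>

lemma act_alt_longest:
  assumes "a \<in> A" "b \<in> A" "a \<noteq> b"
  shows "act (alt b a (mm a b)) z a = - (if even (mm a b) then z a else z b)"
proof -
  have m: "3 \<le> mm a b" using mm_ge assms by blast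
  have "sin ((real (mm a b) + 1) * (pi / real (mm a b))) = sin (pi / mm a b + pi)"
    using m by (intro arg_cong[where f = sin]) (simp add: field_simps)
  then have "cheb a b (real (mm a b) + 1) = -1" "cheb a b (real (mm a b)) = 0"
    using sin_angle_pos[OF assms] m by (simp_all add: cheb_def)
  then show ?thesis using assms by (simp add: act_alt_coords(1))
qed

text \<open>Joins to each form of \<open>child\<close> what tameness at the child gives. Its letters
  miss \<open>blocked v C \<tau>\<close>, which contains its down generators \<open>\<tau>\<close>
  and \<open>x\<close>; hence these are positive, and their sum compensates any other negative
  coordinate.\<close>

lemma child_cases:
  assumes "child v C d C'" "wf_config C" "wf_config C'" "v < V" "v' < V" "tame v' C' z"
  obtains (single) \<tau> where "d = [\<tau>]" "\<tau> \<in> letters v C" "downs C' = {\<tau>}"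
      "\<And>j. j \<in> blocked v C \<tau> \<Longrightarrow> 0 < z j" "\<And>j. j \<in> A \<Longrightarrow> j \<noteq> \<tau> \<Longrightarrow> 0 < z j + z \<tau>"
  | (half) \<tau> x n q L where "d = alt \<tau> x n" "\<tau> \<in> letters v C" "2 \<le> n" "n < mm \<tau> x"
      "(x, q, L) \<in> sides C" "L ! v = \<tau>" "downs C' = {\<tau>, x}"
      "\<And>j. j \<in> blocked v C \<tau> \<Longrightarrow> 0 < z j"
      "\<And>j. j \<in> A \<Longrightarrow> j \<noteq> \<tau> \<Longrightarrow> j \<noteq> x \<Longrightarrow> 0 < z j + z \<tau> + z x"
      "\<tau> \<noteq> x" "x \<in> A" "\<tau> \<in> A" "0 < z \<tau>" "0 < z x"
  | (wedge) \<tau> x n where "d = alt \<tau> x n" "\<tau> \<in> letters v C" "2 \<le> n" "n \<le> mm \<tau> x"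
      "x \<in> letters v C" "downs C' = {\<tau>, x}"
      "n = mm \<tau> x \<Longrightarrow> (\<exists>l q L. fst C = Some (l, q, L) \<and> L ! v = \<tau>)"
      "\<And>j. j \<in> blocked v C \<tau> \<Longrightarrow> 0 < z j"
      "\<And>j. j \<in> A \<Longrightarrow> j \<noteq> \<tau> \<Longrightarrow> j \<noteq> x \<Longrightarrow> 0 < z j + z \<tau> + z x"
      "\<tau> \<noteq> x" "x \<in> A" "\<tau> \<in> A" "0 < z \<tau>" "0 < z x"
proof -
  obtain \<tau> where \<tau>: "\<tau> \<in> letters v C"
    and av: "\<forall>(l, q, L)\<in>sides C'. set L \<inter> blocked v C \<tau> = {}"
    and cs: "d = [\<tau>] \<and> downs C' = {\<tau>} \<or>
      (\<exists>x n. 2 \<le> n \<and> d = alt \<tau> x n \<and> downs C' = {\<tau>, x} \<and>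
        ((\<exists>q L. (x, q, L) \<in> sides C \<and> L ! v = \<tau>) \<and> n < mm \<tau> x \<or>
         x \<in> letters v C \<and> x \<noteq> \<tau> \<and> n < mm \<tau> x \<or>
         x \<in> letters v C \<and> x \<noteq> \<tau> \<and> n = mm \<tau> x
           \<and> (\<exists>l q L. fst C = Some (l, q, L) \<and> L ! v = \<tau>)))"
    using assms(1) unfolding child_def by blast
  have disj: "letters v' C' \<inter> blocked v C \<tau> = {}"
    using av letter_in_side[OF assms(3,5)] by (fastforce elim!: lettersE)
  have pos: "0 < z j" if "j \<in> blocked v C \<tau>" for j
    using that disj blocked_in_A[OF assms(2,4)] assms(6) unfolding tame_def by blast
  have \<tau>A: "\<tau> \<in> A" using \<tau> letters_in_A assms by blast
  have \<tau>b: "\<tau> \<in> blocked v C \<tau>" using \<tau> by (simp add: blocked_def)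
  have dom: "0 < z j + (\<Sum>q\<in>downs C'. z q)" if "j \<in> A" "\<And>q. q \<in> downs C' \<Longrightarrow> 0 < z q" for j
  proof (cases "j \<in> letters v' C'")
    case True
    then show ?thesis using assms(6) by (simp add: tame_def)
  next
    case False
    then have "0 < z j" using that assms(6) by (simp add: tame_def)
    moreover have "0 \<le> (\<Sum>q\<in>downs C'. z q)" using that(2) by (intro sum_nonneg) force
    ultimately show ?thesis by simp
  qed
  from cs show ?thesis
  proof
    assume d: "d = [\<tau>] \<and> downs C' = {\<tau>}"
    show ?thesis
      by (rule single[of \<tau>]) (use d \<tau> pos \<tau>b dom in auto)
  next
    assume "\<exists>x n. 2 \<le> n \<and> d = alt \<tau> x n \<and> downs C' = {\<tau>, x} \<and>
        ((\<exists>q L. (x, q, L) \<in> sides C \<and> L ! v = \<tau>) \<and> n < mm \<tau> x \<or>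
         x \<in> letters v C \<and> x \<noteq> \<tau> \<and> n < mm \<tau> x \<or>
         x \<in> letters v C \<and> x \<noteq> \<tau> \<and> n = mm \<tau> x
           \<and> (\<exists>l q L. fst C = Some (l, q, L) \<and> L ! v = \<tau>))"
    then obtain x n where n: "2 \<le> n" "d = alt \<tau> x n" "downs C' = {\<tau>, x}"
      and cs: "(\<exists>q L. (x, q, L) \<in> sides C \<and> L ! v = \<tau>) \<and> n < mm \<tau> x \<or>
         x \<in> letters v C \<and> x \<noteq> \<tau> \<and> n \<le> mm \<tau> x \<and>
         (n = mm \<tau> x \<longrightarrow> (\<exists>l q L. fst C = Some (l, q, L) \<and> L ! v = \<tau>))"
      by (metis order.order_iff_strict nat_less_le)
    have xb: "x \<in> blocked v C \<tau>" using cs unfolding blocked_def by blast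
    then have xA: "x \<in> A" using blocked_in_A assms by blast
    have zt: "0 < z \<tau>" "0 < z x" using pos \<tau>b xb by auto
    have x\<tau>: "\<tau> \<noteq> x" using cs label_not_letter[OF assms(2,4)] \<tau> by blast
    have dom2: "0 < z j + z \<tau> + z x" if "j \<in> A" for j
    proof -
      have "0 < z j + (z \<tau> + z x)" using dom[of j] that n(3) zt x\<tau> by force
      then show ?thesis by simp
    qed
    from cs show ?thesis
    proof
      assume "(\<exists>q L. (x, q, L) \<in> sides C \<and> L ! v = \<tau>) \<and> n < mm \<tau> x"
      then obtain q L where "(x, q, L) \<in> sides C" "L ! v = \<tau>" "n < mm \<tau> x" by blast
      then show ?thesis
        using half[of \<tau> x n q L] n \<tau> pos dom2 x\<tau> xA \<tau>A zt by blast
    next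
      assume "x \<in> letters v C \<and> x \<noteq> \<tau> \<and> n \<le> mm \<tau> x \<and>
         (n = mm \<tau> x \<longrightarrow> (\<exists>l q L. fst C = Some (l, q, L) \<and> L ! v = \<tau>))"
      then show ?thesis
        using wedge[of \<tau> x n] n \<tau> pos dom2 x\<tau> xA \<tau>A zt by blast
    qed
  qed
qed

text \<open>The last letter to act negates the coordinate of \<open>\<tau>\<close> and adds at least
  the same amount to that of \<open>q\<close>, so the sum is at least what \<open>q\<close> carried
  before, and outer coordinates never fall.\<close>

lemma act_alt_dominated:
  assumes "\<tau> \<in> A" "x \<in> A" "\<tau> \<noteq> x" "0 < z \<tau>" "0 < z x" "0 < n" "n \<le> mm \<tau> x"
    and "q \<in> A" "q \<noteq> \<tau>" "q \<noteq> x" "0 < z q"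
  shows "0 < act (alt \<tau> x n) z \<tau> + act (alt \<tau> x n) z q"
proof -
  obtain k where k: "n = Suc k" using assms by (cases n) auto
  have "z q \<le> act (alt x \<tau> k) z q"
    using act_alt_outer_mono[of x \<tau> z k q] assms k mm_sym[of \<tau> x] by simp
  moreover have "act (alt x \<tau> k) z q + act (alt x \<tau> k) z \<tau> \<le> act (alt \<tau> x n) z q"
    using act_alt_step[of \<tau> x z k q] assms k by simp
  moreover have "act (alt \<tau> x n) z \<tau> = - act (alt x \<tau> k) z \<tau>" by (simp add: k act_Cons)
  ultimately show ?thesis using assms by simp
qed

text \<open>The ping-pong step, pulling tameness back from a child to its parent. Only
  \<open>\<tau>\<close>, and at the middle of a wedge also \<open>x\<close>, can become negative;
  both are then letters of branch \<open>v\<close>, and a down generator \<open>q\<close> of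
  \<open>C\<close>, which the word raises, dominates each of them.\<close>

lemma tame_parent:
  assumes "child v C d C'" "wf_config C" "wf_config C'" "v < V" "v' < V" "tame v' C' z"
  shows "tame v C (act d z)"
  using assms
proof (cases rule: child_cases)
  case (single \<tau>)
  have A: "\<tau> \<in> A" "0 < z \<tau>"
    using single letters_in_A[OF assms(2,4)] by (auto simp: blocked_def)
  obtain q where q: "q \<in> downs C" using single by (auto simp: letters_def downs_def)
  have up: "z j + z \<tau> \<le> flip \<tau> z j" if "j \<in> A" "j \<noteq> \<tau>" for j
    using cc_ge_1[of \<tau> j] A that by (simp add: flip_other)
  have dom: "0 < flip \<tau> z j" if "j \<in> A" "j \<noteq> \<tau>" for j
    using up[OF that] single(5)[OF that] by simp
  have "0 < flip \<tau> z \<tau> + flip \<tau> z q"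
  proof -
    have "q \<in> A" "q \<noteq> \<tau>" "0 < z q"
      using q downs_in_A[OF assms(2)] downs_letters_disjoint[OF assms(2,4)] assms single by (auto simp: blocked_def)
    then show ?thesis using up[of q] A by simp
  qed
  then have "tame v C (flip \<tau> z)"
    using dom q single letters_in_A[OF assms(2,4)] assms(2,4) by (intro tameI) blast+
  then show ?thesis by (simp add: single act_Cons)
next
  case (half \<tau> x n q L)
  have q: "q \<in> downs C" "q \<in> A" "q \<noteq> \<tau>" "q \<noteq> x" "0 < z q"
  proof -
    show D: "q \<in> downs C" using half by (force simp: downs_def)
    then show "q \<in> A" "q \<noteq> \<tau>" "0 < z q"
      using downs_in_A[OF assms(2)] downs_letters_disjoint[OF assms(2,4)] assms half by (auto simp: blocked_def)
    show "q \<noteq> x" using half assms by (auto simp: wf_config_def wf_edge_def)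
  qed
  have xpos: "0 < act (alt \<tau> x n) z x"
    using act_alt_flip_nonneg[of x \<tau> z n] half mm_sym[of x \<tau>] by simp
  have outer: "0 < act (alt \<tau> x n) z j" if "j \<in> A" "j \<noteq> \<tau>" "j \<noteq> x" for j
    using act_alt_outer[of \<tau> x z n j] half that by fastforce
  have "0 < act (alt \<tau> x n) z \<tau> + act (alt \<tau> x n) z q"
    using act_alt_dominated half q by simp
  then have "tame v C (act (alt \<tau> x n) z)"
    using q xpos outer half letters_in_A[OF assms(2,4)] assms(2,4) by (intro tameI) blast+
  then show ?thesis by (simp add: half)
next
  case (wedge \<tau> x n)
  obtain q where q: "q \<in> downs C" using wedge by (auto simp: letters_def downs_def)
  have q': "q \<in> A" "q \<noteq> \<tau>" "q \<noteq> x" "0 < z q"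
    using q downs_in_A[OF assms(2)] downs_letters_disjoint[OF assms(2,4)] assms wedge by (auto simp: blocked_def)
  have outer: "0 < act (alt \<tau> x n) z j" if "j \<in> A" "j \<noteq> \<tau>" "j \<noteq> x" for j
    using act_alt_outer[of \<tau> x z n j] wedge that by fastforce
  have d\<tau>: "0 < act (alt \<tau> x n) z \<tau> + act (alt \<tau> x n) z q"
    using act_alt_dominated wedge q' by simp
  have dx: "0 < act (alt \<tau> x n) z x + act (alt \<tau> x n) z q"
  proof (cases "n = mm \<tau> x")
    case True
    then have "act (alt \<tau> x n) z x = - (if even n then z x else z \<tau>)"
      using act_alt_longest[of x \<tau> z] wedge mm_sym[of \<tau> x] by simp
    moreover have "z q + z \<tau> + z x \<le> act (alt \<tau> x n) z q"
      using act_alt_outer[of \<tau> x z n q] wedge q' by simp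
    ultimately show ?thesis using q' wedge by (auto split: if_splits)
  next
    case False
    then have "0 < act (alt \<tau> x n) z x"
      using act_alt_flip_nonneg[of x \<tau> z n] wedge mm_sym[of x \<tau>] by simp
    then show ?thesis using outer[OF q'(1-3)] by simp
  qed
  have "tame v C (act (alt \<tau> x n) z)"
    using q d\<tau> dx outer wedge letters_in_A[OF assms(2,4)] assms(2,4) by (intro tameI) blast+
  then show ?thesis by (simp add: wedge)
qed

lemma child_hd_negative:
  assumes "child v C d C'" "wf_config C" "wf_config C'" "v < V" "v' < V" "tame v' C' z"
  shows "d \<noteq> [] \<and> hd d \<in> letters v C \<and> act d z (hd d) < 0"
  using assms
proof (cases rule: child_cases)
  case (single \<tau>)
  then show ?thesis by (simp add: act_Cons blocked_def)
next
  case (half \<tau> x n q L)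
  then show ?thesis using act_alt_hd[of \<tau> x z n] by (cases n) auto
next
  case (wedge \<tau> x n)
  then show ?thesis using act_alt_hd[of \<tau> x z n] by (cases n) auto
qed

text \<open>Two letters can be negative together only for the longest word of a wedge, which has two
  alternating spellings. \<open>child\<close> admits the spelling that starts with the letter of the
  edge before the vertex, and this makes the first letter unique.\<close>

lemma second_negative_letter:
  assumes "child v C d C'" "wf_config C" "wf_config C'" "v < V" "v' < V" "tame v' C' z"
    and "\<sigma> \<in> letters v C" "\<sigma> \<noteq> hd d" "act d z \<sigma> < 0"
  shows "\<exists>l q L. fst C = Some (l, q, L) \<and> L ! v = hd d"
  using assms(1-6)
proof (cases rule: child_cases)
  case (single \<tau>)
  have A: "\<tau> \<in> A" "0 < z \<tau>" "\<sigma> \<in> A"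
    using single letters_in_A[OF assms(2,4)] assms(7) by (auto simp: blocked_def)
  then have "z \<sigma> + z \<tau> \<le> flip \<tau> z \<sigma>"
    using cc_ge_1[of \<tau> \<sigma>] assms single by (simp add: flip_other)
  moreover have "0 < z \<sigma> + z \<tau>" using single(5)[of \<sigma>] A assms(8) single(1) by simp
  ultimately show ?thesis using assms(9) single(1) by (simp add: act_Cons)
next
  case (half \<tau> x n q L)
  have "hd d = \<tau>" using half by (cases n) auto
  then have "\<sigma> \<in> A" "\<sigma> \<noteq> \<tau>" "\<sigma> \<noteq> x"
    using letters_in_A[OF assms(2,4)] assms(7,8) label_not_letter[OF assms(2,4)] half by auto
  then show ?thesis using act_alt_outer[of \<tau> x z n \<sigma>] half assms by fastforce
next
  case (wedge \<tau> x n)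
  have hd: "hd d = \<tau>" using wedge by (cases n) auto
  have \<sigma>: "\<sigma> \<in> A" "\<sigma> \<noteq> \<tau>"
    using letters_in_A[OF assms(2,4)] assms(7,8) hd by auto
  have "\<sigma> = x"
    using act_alt_outer[of \<tau> x z n \<sigma>] wedge assms \<sigma> by fastforce
  then have "n = mm \<tau> x"
    using act_alt_flip_nonneg[of x \<tau> z n] wedge assms(9) mm_sym[of x \<tau>] by force
  then show ?thesis using wedge hd by simp
qed

text \<open>Undoing the first letter leaves either the child's vector or an alternating word that
  starts with \<open>x\<close>. Such a word makes \<open>x\<close> negative and does not lower the
  other blocked coordinates, so a sign tells the two cases apart and reveals
  \<open>x\<close>.\<close>

lemma child_tail_signs:
  assumes "child v C d C'" "wf_config C" "wf_config C'" "v < V" "v' < V" "tame v' C' z"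
  obtains \<tau> where "d = [\<tau>]" "\<And>j. j \<in> blocked v C \<tau> \<Longrightarrow> j \<noteq> \<tau> \<Longrightarrow> 0 < act (tl d) z j"
  | \<tau> x n where "d = alt \<tau> x n" "2 \<le> n" "n \<le> mm \<tau> x" "x \<in> blocked v C \<tau>" "\<tau> \<noteq> x"
      "\<tau> \<in> A" "x \<in> A" "0 < z \<tau>" "0 < z x" "act (tl d) z x < 0"
      "\<And>j. j \<in> blocked v C \<tau> \<Longrightarrow> j \<noteq> \<tau> \<Longrightarrow> j \<noteq> x \<Longrightarrow> 0 < act (tl d) z j"
proof -
  note intro = that
  have alt: thesis
    if prem: "d = alt \<tau> x n" "2 \<le> n" "n \<le> mm \<tau> x" "x \<in> blocked v C \<tau>" "\<tau> \<noteq> x"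
      "\<tau> \<in> A" "x \<in> A" "0 < z \<tau>" "0 < z x" "\<And>j. j \<in> blocked v C \<tau> \<Longrightarrow> 0 < z j" for \<tau> x n
  proof -
    obtain k where k: "n = Suc k" using prem(2) by (cases n) auto
    have "act (alt x \<tau> k) z x < 0"
      using act_alt_hd[of x \<tau> z k] prem k mm_sym[of x \<tau>] by simp
    moreover have "0 < act (alt x \<tau> k) z j" if j: "j \<in> blocked v C \<tau>" "j \<noteq> \<tau>" "j \<noteq> x" for j
      using act_alt_outer_mono[of x \<tau> z k j] prem(1-9) k mm_sym[of x \<tau>] j
        blocked_in_A[OF assms(2,4)] prem(10)[OF j(1)] by fastforce
    ultimately show thesis using prem(1-9) k by (intro intro(2)[of \<tau> x n]) auto
  qed
  show thesis
    using assms
  proof (cases rule: child_cases)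
    case (single \<tau>)
    then show thesis using intro(1)[of \<tau>] by simp
  next
    case (half \<tau> x n q L)
    have "x \<in> blocked v C \<tau>" using half unfolding blocked_def by blast
    then show thesis using alt[of \<tau> x n] half by simp
  next
    case (wedge \<tau> x n)
    have "x \<in> blocked v C \<tau>" using wedge unfolding blocked_def by blast
    then show thesis using alt[of \<tau> x n] wedge by simp
  qed
qed

text \<open>Otherwise, cancelling the shorter word would write a vector positive at \<open>a\<close>
  and \<open>b\<close> as the image under a nonempty alternating word of length at most
  \<open>mm a b\<close>, and such an image is negative at the first letter.\<close>

lemma act_alt_inj:
  assumes "a \<in> A" "b \<in> A" "a \<noteq> b" "0 < z a" "0 < z b" "0 < z' a" "0 < z' b"
    and "n \<le> mm a b" "k \<le> mm a b" "act (alt a b n) z = act (alt a b k) z'"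
  shows "n = k"
proof -
  have False if prem: "act (alt a b n) z = act (alt a b k) z'" "n < k" "k \<le> mm a b"
    "0 < z a" "0 < z b" "0 < z' a" "0 < z' b" for n k z z'
  proof -
    obtain j where j: "k = n + j" "0 < j" "j \<le> mm a b"
      using prem(2,3) less_imp_add_positive by (metis add_leD2)
    let ?e = "if even n then alt a b j else alt b a j"
    have "z = act ?e z'"
      using arg_cong[OF prem(1), of "act (rev (alt a b n))"]
      by (simp add: j alt_append act_append)
    moreover have "act (alt a b j) z' a < 0" "act (alt b a j) z' b < 0"
      using act_alt_hd[of a b z' j] act_alt_hd[of b a z' j] assms prem j mm_sym[of a b] by auto
    ultimately show False using prem(4,5) by (metis order.asym)
  qed
  then show ?thesis using assms by (metis nat_neq_iff)
qed

text \<open>The vector is decoded from the left. A negative letter gives the branch, and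
  \<open>second_negative_letter\<close> the first generator; once that is undone, the negative
  blocked coordinate gives the second generator, and \<open>act_alt_inj\<close> gives the
  length.\<close>

lemma child_determined:
  assumes d: "child v C d C'" "wf_config C'" "v < V" "v' < V" "tame v' C' z"
    and e: "child w C e C''" "wf_config C''" "w < V" "w' < V" "tame w' C'' z'"
    and C: "wf_config C" and eq: "act d z = act e z'"
  shows "v = w" "d = e" "z = z'"
proof -
  note d' = d(1) C d(2-5) and e' = e(1) C e(2-5)
  have neg: "hd d \<in> letters v C" "act d z (hd d) < 0" "hd e \<in> letters w C" "act d z (hd e) < 0"
    using child_hd_negative[OF d'] child_hd_negative[OF e'] eq by auto
  have "tame w C (act d z)" unfolding eq using tame_parent[OF e'] .
  then have "hd d \<in> letters w C"
    using neg letters_in_A[OF C d(3)] unfolding tame_def by (metis DiffI in_mono order.asym)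
  with neg(1) show vw: "v = w" using letters_determine_branch C d(3) e(3) by blast
  have hd: "hd d = hd e"
  proof (rule ccontr)
    assume "hd d \<noteq> hd e"
    then show False
      using second_negative_letter[OF d', of "hd e"] second_negative_letter[OF e', of "hd d"]
        neg vw eq by auto
  qed
  have "d \<noteq> []" "e \<noteq> []" using child_hd_negative[OF d'] child_hd_negative[OF e'] by auto
  then obtain \<tau> d1 e1 where de: "d = \<tau> # d1" "e = \<tau> # e1" using hd by (metis list.collapse)
  have w: "act (tl d) z = act (tl e) z'"
    using arg_cong[OF eq, of "flip \<tau>"] by (simp add: de act_Cons)
  have alt_hd: "\<sigma> = \<tau>" if "\<tau> # us = alt \<sigma> x n" for \<sigma> us x n
    using that by (cases n) auto
  show "d = e"
    using d'
  proof (cases rule: child_tail_signs)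
    case (1 \<sigma>)
    note d1 = 1
    show ?thesis
      using e'
    proof (cases rule: child_tail_signs)
      case (1 \<sigma>')
      then show ?thesis using d1 de by simp
    next
      case (2 \<sigma>' x n)
      then have "0 < act (tl d) z x" using d1 de vw alt_hd[of e1 \<sigma>' x n] by auto
      then show ?thesis using 2 w by simp
    qed
  next
    case (2 \<sigma> x n)
    note d2 = 2
    have \<sigma>: "\<sigma> = \<tau>" using d2 de alt_hd by metis
    show ?thesis
      using e'
    proof (cases rule: child_tail_signs)
      case (1 \<sigma>')
      then have "0 < act (tl e) z' x" using d2 de vw \<sigma> by auto
      then show ?thesis using d2 w by simp
    next
      case (2 \<sigma>' x' n')
      have \<sigma>': "\<sigma>' = \<tau>" using 2 de alt_hd by metis
      have "x' = x"
      proof (rule ccontr)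
        assume "x' \<noteq> x"
        then have "0 < act (tl d) z x'" using d2(11)[of x'] 2 \<sigma> \<sigma>' vw by simp
        then show False using 2 w by simp
      qed
      then have "n = n'"
        using act_alt_inj[of \<tau> x z z' n n'] d2 2 \<sigma> \<sigma>' eq by simp
      then show ?thesis using d2 2 \<sigma> \<sigma>' \<open>x' = x\<close> by simp
    qed
  qed
  then show "z = z'" using arg_cong[OF eq, of "act (rev d)"] by simp
qed

end

section \<open>Refinement of paths\<close>

lemma alt_eq_iff:
  "alt a b n = alt c d k \<longleftrightarrow> n = k \<and> (1 \<le> n \<longrightarrow> a = c) \<and> (2 \<le> n \<longrightarrow> b = d)"
proof (cases "n = k")
  case True
  have "alt a b n = alt c d n \<longleftrightarrow> (1 \<le> n \<longrightarrow> a = c) \<and> (2 \<le> n \<longrightarrow> b = d)"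
  proof (induction n arbitrary: a b c d)
    case (Suc n)
    show ?case by (cases n) (auto simp: Suc)
  qed simp
  then show ?thesis using True by simp
next
  case False
  then show ?thesis by (metis length_alt)
qed

fun alt_edges :: "'a \<Rightarrow> 'a \<Rightarrow> 'a list \<Rightarrow> nat \<Rightarrow> 'a edge list" where
  "alt_edges a b L 0 = []"
| "alt_edges a b L (Suc n) = (a, b, L) # alt_edges b a L n"

lemma length_alt_edges [simp]: "length (alt_edges a b L n) = n"
  by (induction n arbitrary: a b) auto

lemma hd_alt_edges: "0 < n \<Longrightarrow> hd (alt_edges a b L n) = (a, b, L)"
  by (cases n) auto

lemma last_alt_edges: "0 < n \<Longrightarrow> last (alt_edges a b L n) = (if odd n then (a, b, L) else (b, a, L))"
proof (induction n arbitrary: a b)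
  case (Suc n)
  then show ?case by (cases n) auto
qed simp

text \<open>\<open>x\<close> is the word of the current vertex and \<open>u\<close> the edge through
  which it was entered, so that each configuration can be formed on the way.\<close>

fun positions :: "'a edge option \<Rightarrow> 'a list \<Rightarrow> 'a edge list \<Rightarrow> ('a list \<times> 'a config) list" where
  "positions u x [] = [(x, (u, None))]"
| "positions u x (e # es) = (x, (u, Some e)) # positions (Some e) (x @ [fst e]) es"

lemma length_positions [simp]: "length (positions u x es) = Suc (length es)"
  by (induction es arbitrary: u x) auto

lemma positions_alt_edges:
  "positions u x (alt_edges a b L (Suc n) @ es) =
     (x, (u, Some (a, b, L)))
     # map (\<lambda>j. (x @ alt a b j, if odd j then (Some (a, b, L), Some (b, a, L))
                                else (Some (b, a, L), Some (a, b, L)))) [1..<Suc n]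
     @ positions (Some (if even n then (a, b, L) else (b, a, L))) (x @ alt a b (Suc n)) es"
proof (induction n arbitrary: a b u x)
  case (Suc n)
  have "[1..<Suc (Suc n)] = 1 # map Suc [1..<Suc n]"
    by (simp add: upt_conv_Cons map_Suc_upt del: upt_Suc)
  then show ?case
    unfolding alt_edges.simps(2)[of a b L "Suc n"] append_Cons positions.simps Suc
    by (simp del: upt_Suc add: comp_def)
qed simp

text \<open>The first alternative describes two edges of one polygon. In the second they lie on
  different polygons sharing the down generator \<open>q\<close>, as at a corner of a refined path,
  and then the lists must be disjoint.\<close>

definition adj :: "'a edge \<Rightarrow> 'a edge \<Rightarrow> bool" where
  "adj = (\<lambda>(l, q, L) (l', q', L'). l' \<noteq> l \<and> l \<notin> set L' \<and> l' \<notin> set L \<and>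
     (l' = q \<and> q' = l \<and> L' = L \<or> q' = q \<and> set L \<inter> set L' = {}))"

context coxeter_paths
begin

definition good :: "'a edge list \<Rightarrow> bool" where
  "good es \<longleftrightarrow> (\<forall>e\<in>set es. wf_edge e \<and> compatible e e) \<and> successively adj es"

definition fresh :: "'a set \<Rightarrow> 'a list" where
  "fresh X = (SOME L. distinct L \<and> length L = V \<and> set L \<subseteq> A \<and> set L \<inter> X = {})"

lemma fresh:
  assumes "finite X" "card X + V \<le> card A"
  shows "distinct (fresh X)" "length (fresh X) = V" "set (fresh X) \<subseteq> A" "set (fresh X) \<inter> X = {}"
proof -
  have "card A - card X \<le> card (A - X)" using assms by (intro diff_card_le_card_Diff)
  then have "V \<le> card (A - X)" using assms by simp
  then obtain B where B: "B \<subseteq> A - X" "card B = V" by (rule obtain_subset_with_card_n)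
  then obtain L where "set L = B" "distinct L"
    using finite_distinct_list finite_A finite_subset by (metis finite_Diff)
  then have "\<exists>L. distinct L \<and> length L = V \<and> set L \<subseteq> A \<and> set L \<inter> X = {}"
    using B distinct_card[of L] by (intro exI[of _ L]) auto
  from someI_ex[OF this]
  show "distinct (fresh X)" "length (fresh X) = V" "set (fresh X) \<subseteq> A" "set (fresh X) \<inter> X = {}"
    unfolding fresh_def by blast+
qed

text \<open>At the end of the path the value is \<open>\<tau>\<close> itself, so that
  \<open>refine\<close> inserts no further polygon there.\<close>

definition next_letter :: "nat \<Rightarrow> 'a \<Rightarrow> 'a edge list \<Rightarrow> 'a" where
  "next_letter v \<tau> es = (case es of [] \<Rightarrow> \<tau> | (l, q, L) # es' \<Rightarrow> L ! v)"

text \<open>\<open>p\<close> and \<open>P\<close> are the branch generator and the new list used just before. A polygon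
  over an edge loses that edge and its two neighbours, whence \<open>2 * m - 3\<close>; a polygon between two
  far sides loses the two edges that meet in the old vertex.\<close>

fun refine :: "nat \<Rightarrow> 'a \<Rightarrow> 'a list \<Rightarrow> 'a edge list \<Rightarrow> 'a edge list" where
  "refine v p P [] = []"
| "refine v p P ((l, q, L) # es) =
    (let \<tau> = L ! v; \<tau>' = next_letter v \<tau> es; L1 = fresh ({l, q, \<tau>, p, \<tau>'} \<union> set P);
       L2 = fresh ({l, q, \<tau>, \<tau>', fst (hd es)} \<union> set L1)
     in alt_edges l \<tau> L1 (2 * mm l \<tau> - 3) @
        (if \<tau>' = \<tau> then refine v \<tau> L1 es
         else alt_edges \<tau>' \<tau> L2 (2 * mm \<tau> \<tau>' - 2) @ refine v \<tau> L2 es))"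

text \<open>The entry \<open>(i, d)\<close> says that the corresponding vertex of the refined path is reached by
  \<open>d\<close> from vertex \<open>i\<close> of the old one; the very first vertex is omitted.\<close>

fun keys_from :: "nat \<Rightarrow> nat \<Rightarrow> 'a edge list \<Rightarrow> (nat \<times> 'a list) list" where
  "keys_from v i [] = []"
| "keys_from v i ((l, q, L) # es) =
    (let \<tau> = L ! v; \<tau>' = next_letter v \<tau> es; m = mm l \<tau>; k = mm \<tau> \<tau>'
     in map (\<lambda>n. if n < m then (i, alt \<tau> l n) else (Suc i, alt \<tau> l (2 * m - 1 - n))) [2..<2 * m - 1] @
        (if \<tau>' = \<tau> then []
         else map (\<lambda>n. (Suc i, if n \<le> k then alt \<tau> \<tau>' n else alt \<tau>' \<tau> (2 * k - n))) [2..<2 * k]) @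
        keys_from v (Suc i) es)"

lemma card_insert5: "card {a, b, c, d, e} \<le> 5"
  by (simp add: card_insert_if)

text \<open>The origin of \<open>2 * V + 5\<close>: five single letters and one list of length
  \<open>V\<close> are avoided, and \<open>V\<close> letters are drawn from the rest.\<close>

lemma fresh5:
  fixes a b c d e :: 'a and P :: "'a list"
  defines "X \<equiv> {a, b, c, d, e} \<union> set P"
  assumes "2 * V + 5 \<le> card A" "length P = V"
  shows "distinct (fresh X)" "length (fresh X) = V" "set (fresh X) \<subseteq> A" "set (fresh X) \<inter> X = {}"
proof -
  have "card X \<le> card {a, b, c, d, e} + card (set P)" unfolding X_def by (rule card_Un_le)
  also have "\<dots> \<le> 5 + V" using card_insert5[of a b c d e] card_length[of P] assms(3) by linarith
  finally have c: "card X + V \<le> card A" using assms(2) by simp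
  have f: "finite X" by (simp add: X_def)
  show "distinct (fresh X)" "length (fresh X) = V" "set (fresh X) \<subseteq> A" "set (fresh X) \<inter> X = {}"
    using fresh[OF f c] by blast+
qed

lemma good_alt_edges:
  assumes "a \<in> A" "b \<in> A" "a \<noteq> b" "length L = V" "distinct L" "set L \<subseteq> A" "set L \<inter> {a, b} = {}"
  shows "good (alt_edges a b L n)"
  using assms
proof (induction n arbitrary: a b)
  case (Suc n)
  then have "good (alt_edges b a L n)" by (simp add: insert_commute)
  then show ?case
    using Suc.prems by (cases n) (auto simp: good_def adj_def wf_edge_def compatible_def)
qed (simp add: good_def)

lemma good_append:
  "good (es @ fs) \<longleftrightarrow> good es \<and> good fs \<and> (es = [] \<or> fs = [] \<or> adj (last es) (hd fs))"
  by (auto simp: good_def successively_append_iff)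

text \<open>The lists of consecutive edges are equal or disjoint, so equal \<open>v\<close>-th
  letters force both edges onto the same polygon.\<close>

lemma next_letter_Cons:
  assumes "good ((l, q, L) # (l', q', L') # es)" "v < V"
  shows "next_letter v \<tau> ((l', q', L') # es) = L' ! v"
    and "L' ! v = L ! v \<Longrightarrow> l' = q \<and> q' = l \<and> L' = L"
    and "L' ! v \<noteq> L ! v \<Longrightarrow> q' = q \<and> set L \<inter> set L' = {}"
    and "l' \<noteq> l" "l \<notin> set L'" "l' \<notin> set L" "L ! v \<in> set L" "L' ! v \<in> set L'"
      "L ! v \<in> A" "L' ! v \<in> A" "l \<in> A" "l' \<in> A" "L ! v \<noteq> l" "L' ! v \<noteq> l'" "L ! v \<noteq> l'" "L' ! v \<noteq> l"
      "L ! v \<noteq> q" "L' ! v \<noteq> q'" "l \<noteq> q" "l' \<noteq> q'"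
proof -
  have g: "l' \<noteq> l" "l \<notin> set L'" "l' \<notin> set L" "l' = q \<and> q' = l \<and> L' = L \<or> q' = q \<and> set L \<inter> set L' = {}"
    "l \<in> A" "l' \<in> A" "set L \<subseteq> A" "set L' \<subseteq> A" "length L = V" "length L' = V" "l \<notin> set L" "l' \<notin> set L'"
    "q \<notin> set L" "q' \<notin> set L'" "l \<noteq> q" "l' \<noteq> q'"
    using assms(1) by (auto simp: good_def adj_def wf_edge_def compatible_def)
  have t: "L ! v \<in> set L" "L' ! v \<in> set L'" using g assms(2) by auto
  show "next_letter v \<tau> ((l', q', L') # es) = L' ! v" by (simp add: next_letter_def)
  show "L' ! v = L ! v \<Longrightarrow> l' = q \<and> q' = l \<and> L' = L" using g t by auto
  show "L' ! v \<noteq> L ! v \<Longrightarrow> q' = q \<and> set L \<inter> set L' = {}" using g by auto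
  show "l' \<noteq> l" "l \<notin> set L'" "l' \<notin> set L" "L ! v \<in> set L" "L' ! v \<in> set L'"
      "L ! v \<in> A" "L' ! v \<in> A" "l \<in> A" "l' \<in> A" "L ! v \<noteq> l" "L' ! v \<noteq> l'" "L ! v \<noteq> l'" "L' ! v \<noteq> l"
      "L ! v \<noteq> q" "L' ! v \<noteq> q'" "l \<noteq> q" "l' \<noteq> q'"
    using g(1-3,5-) t by auto
qed

lemma good_ConsD:
  assumes "good ((l, q, L) # es)" "v < V"
  shows "l \<in> A" "q \<in> A" "l \<noteq> q" "set L \<subseteq> A" "length L = V" "distinct L" "l \<notin> set L" "q \<notin> set L"
    "L ! v \<in> set L" "L ! v \<in> A" "L ! v \<noteq> l" "L ! v \<noteq> q" "good es"
  using assms by (auto simp: good_def wf_edge_def compatible_def successively_Cons)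

text \<open>The second conjunct carries the induction across the seams: the first list of each block
  avoids the list and the branch generator used just before, as \<open>adj\<close> requires.\<close>

lemma refine_good:
  assumes "2 * V + 5 \<le> card A" "good es" "v < V" "length P = V"
  shows "good (refine v p P es) \<and>
    (\<forall>l q L es'. es = (l, q, L) # es' \<longrightarrow>
       (\<exists>L1 fs. refine v p P es = (l, L ! v, L1) # fs \<and> set L1 \<inter> ({l, q, L ! v, p} \<union> set P) = {}))"
  using assms(2,4)
proof (induction es arbitrary: p P)
  case Nil
  then show ?case by (simp add: good_def)
next
  case (Cons e es)
  note prems = Cons.prems and IH = Cons.IH
  obtain l q L where e: "e = (l, q, L)" by (cases e) auto
  note g = good_ConsD[OF prems(1)[unfolded e] assms(3)]
  define \<tau> where "\<tau> = L ! v"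
  define \<tau>' where "\<tau>' = next_letter v \<tau> es"
  define L1 where "L1 = fresh ({l, q, \<tau>, p, \<tau>'} \<union> set P)"
  \<comment> \<open>\<open>hd es\<close> matters only if \<open>\<tau>' \<noteq> \<tau>\<close>,
    which forces \<open>es\<close> to be nonempty; \<open>fresh5\<close> holds for any
    value.\<close>
  define L2 where "L2 = fresh ({l, q, \<tau>, \<tau>', fst (hd es)} \<union> set L1)"
  note L1 = fresh5[OF assms(1) prems(2), of l q \<tau> p \<tau>', folded L1_def]
  note L2 = fresh5[OF assms(1) L1(2), of l q \<tau> \<tau>' "fst (hd es)", folded L2_def]
  define m where "m = 2 * mm l \<tau> - 3"
  define k where "k = 2 * mm \<tau> \<tau>' - 2"
  have mm: "3 \<le> mm l \<tau>" using mm_ge g \<tau>_def by metis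
  \<comment> \<open>An odd number of edges makes the far side start and end with label
    \<open>l\<close>. The polygon between two far sides contributes an even number, from
    \<open>\<tau>'\<close> to \<open>\<tau>\<close>.\<close>
  then have m: "odd m" "0 < m" unfolding m_def by auto
  have eq: "refine v p P (e # es) = alt_edges l \<tau> L1 m @
      (if \<tau>' = \<tau> then refine v \<tau> L1 es else alt_edges \<tau>' \<tau> L2 k @ refine v \<tau> L2 es)"
    by (simp add: e Let_def L1_def L2_def m_def k_def \<tau>_def \<tau>'_def)
  have top: "good (alt_edges l \<tau> L1 m)"
    using g L1 by (intro good_alt_edges) (auto simp: \<tau>_def)
  have last: "last (alt_edges l \<tau> L1 m) = (l, \<tau>, L1)" using m by (simp add: last_alt_edges)
  have start: "\<exists>fs. refine v p P (e # es) = (l, \<tau>, L1) # fs"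
    using m unfolding eq by (cases m) auto
  have "good (refine v p P (e # es))"
  proof (cases es)
    case Nil
    then have "\<tau>' = \<tau>" by (simp add: \<tau>'_def next_letter_def)
    then show ?thesis using top Nil unfolding eq by simp
  next
    case (Cons e' es')
    note es = this
    obtain l' q' L' where e': "e' = (l', q', L')" by (cases e') auto
    note n = next_letter_Cons[OF prems(1)[unfolded e es e'] assms(3)]
    have \<tau>': "\<tau>' = L' ! v" using n(1) by (simp add: \<tau>'_def es e')
    show ?thesis
    proof (cases "\<tau>' = \<tau>")
      case True
      then have inner: "l' = q" "q' = l" "L' = L" using n(2) \<tau>' \<tau>_def by auto
      from IH[OF g(13) L1(2), of \<tau>] obtain L1' fs where
        fs: "good (refine v \<tau> L1 es)" "refine v \<tau> L1 es = (l', \<tau>', L1') # fs"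
        "set L1' \<inter> ({l', q', \<tau>', \<tau>} \<union> set L1) = {}"
        unfolding es e' \<tau>' by blast
      have "adj (l, \<tau>, L1) (l', \<tau>', L1')"
        using fs(3) inner True n(4-) L1(4) unfolding adj_def by auto
      then show ?thesis using True top last fs unfolding eq by (simp add: good_append)
    next
      case False
      then have bd: "q' = q" "set L \<inter> set L' = {}" using n(3) \<tau>' \<tau>_def by auto
      have "3 \<le> mm \<tau> \<tau>'" using mm_ge False n(4-) \<tau>' \<tau>_def by metis
      then have k: "even k" "0 < k" unfolding k_def by auto
      from IH[OF g(13) L2(2), of \<tau>] obtain L1' fs where
        fs: "good (refine v \<tau> L2 es)" "refine v \<tau> L2 es = (l', \<tau>', L1') # fs"
        "set L1' \<inter> ({l', q', \<tau>', \<tau>} \<union> set L2) = {}"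
        unfolding es e' \<tau>' by blast
      have L2': "set L2 \<inter> ({l, q, \<tau>, \<tau>', l'} \<union> set L1) = {}" using L2(4) by (simp add: es e')
      have "good (alt_edges \<tau>' \<tau> L2 k)"
        using n(4-) L2 L2' False \<tau>' \<tau>_def by (intro good_alt_edges) auto
      moreover have "last (alt_edges \<tau>' \<tau> L2 k) = (\<tau>, \<tau>', L2)" using k by (simp add: last_alt_edges)
      moreover have "hd (alt_edges \<tau>' \<tau> L2 k) = (\<tau>', \<tau>, L2)" using k by (simp add: hd_alt_edges)
      moreover have "alt_edges \<tau>' \<tau> L2 k \<noteq> []" using k by (cases k) auto
      moreover have "adj (l, \<tau>, L1) (\<tau>', \<tau>, L2)"
        using L1(4) L2' n(4-) \<tau>' \<tau>_def unfolding adj_def by auto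
      moreover have "adj (\<tau>, \<tau>', L2) (l', \<tau>', L1')"
        using fs(3) L2' n(4-) \<tau>' \<tau>_def unfolding adj_def by auto
      ultimately show ?thesis using False top last fs unfolding eq by (simp add: good_append)
    qed
  qed
  moreover have "set L1 \<inter> ({l, q, \<tau>, p} \<union> set P) = {}" using L1(4) by blast
  ultimately show ?case using start by (auto simp: e \<tau>_def)
qed

end

section \<open>Placing the refined path in the group\<close>

locale coxeter_words = coxeter_paths A mm V for A :: "'a set" and mm V +
  fixes eqv :: "'a list \<Rightarrow> 'a list \<Rightarrow> bool"
  assumes eqv_refl: "set u \<subseteq> A \<Longrightarrow> eqv u u"
    and eqv_sym: "eqv u v \<Longrightarrow> eqv v u"
    and eqv_trans: "eqv u v \<Longrightarrow> eqv v w \<Longrightarrow> eqv u w"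
    and eqv_append: "eqv u v \<Longrightarrow> eqv u' v' \<Longrightarrow> eqv (u @ u') (v @ v')"
    and eqv_square: "s \<in> A \<Longrightarrow> eqv [s, s] []"
    and eqv_alt: "s \<in> A \<Longrightarrow> t \<in> A \<Longrightarrow> s \<noteq> t \<Longrightarrow> eqv (alt s t (2 * mm s t)) []"
    and eqv_act: "eqv u v \<Longrightarrow> act u x = act v x"
    and eqv_cancel: "eqv (u @ v) (u @ w) \<Longrightarrow> set u \<subseteq> A \<Longrightarrow> eqv v w"
    and card_A: "2 * V + 5 \<le> card A"
begin

lemma eqv_rev: "set u \<subseteq> A \<Longrightarrow> eqv (u @ rev u) []"
proof (induction u)
  case (Cons s u)
  have "eqv ([s] @ (u @ rev u) @ [s]) ([s] @ [] @ [s])"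
    using Cons by (intro eqv_append eqv_refl) auto
  moreover have "eqv ([s] @ [] @ [s]) []" using eqv_square Cons by simp
  ultimately show ?case using eqv_trans by auto
qed (simp add: eqv_refl)

text \<open>The two words run around the polygon with \<open>2 * mm a b\<close> sides in opposite
  directions between the same two vertices.\<close>

lemma eqv_braid:
  assumes "a \<in> A" "b \<in> A" "a \<noteq> b" "n \<le> 2 * mm a b"
  shows "eqv (alt a b n) (alt b a (2 * mm a b - n))"
proof -
  let ?u = "alt a b n" and ?v = "alt b a (2 * mm a b - n)"
  have A: "set ?u \<subseteq> A" "set ?v \<subseteq> A" using set_alt[of a b] set_alt[of b a] assms by blast+
  have "rev ?u @ ?v = (if odd n then alt a b (2 * mm a b) else alt b a (2 * mm a b))"
    using alt_append[of a b n "2 * mm a b - n"] alt_append[of b a n "2 * mm a b - n"] assms(4)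
    by (simp add: rev_alt)
  then have "eqv (rev ?u @ ?v) []"
    using eqv_alt[of a b] eqv_alt[of b a] assms mm_sym[of a b] by simp
  then have "eqv (?u @ rev ?u @ ?v) (?u @ [])"
    using A by (intro eqv_append eqv_refl)
  moreover have "eqv ((?u @ rev ?u) @ ?v) ([] @ ?v)"
    using A by (intro eqv_append eqv_refl eqv_rev)
  ultimately show ?thesis using eqv_sym eqv_trans by (metis append.assoc append_Nil append_Nil2)
qed

lemma eqv_append_left: "eqv u v \<Longrightarrow> set x \<subseteq> A \<Longrightarrow> eqv (x @ u) (x @ v)"
  by (intro eqv_append eqv_refl)

text \<open>A vertex of the polygon over an edge labelled \<open>b\<close>, reached from either end
  of that edge.\<close>

lemma eqv_across:
  assumes "a \<in> A" "b \<in> A" "a \<noteq> b" "n < 2 * mm a b"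
  shows "eqv (alt a b n) (b # alt a b (2 * mm a b - 1 - n))"
proof -
  have "2 * mm a b - n = Suc (2 * mm a b - 1 - n)" using assms by simp
  then have "alt b a (2 * mm a b - n) = b # alt a b (2 * mm a b - 1 - n)" by (metis alt.simps(2))
  then show ?thesis using eqv_braid[of a b n] assms by simp
qed

definition located :: "nat \<Rightarrow> (nat \<Rightarrow> 'a list \<times> 'a config) \<Rightarrow> nat \<times> 'a list \<Rightarrow> 'a list \<times> 'a config \<Rightarrow> bool" where
  "located v XC = (\<lambda>(i, d) (x, C). eqv x (fst (XC i) @ d) \<and> child v (snd (XC i)) d C)"

lemma blocked_end:
  assumes "sides C = {(l, q, L)}"
  shows "blocked v C (L ! v) \<subseteq> {l, q, L ! v}"
  using assms by (auto simp: blocked_def downs_def letters_def)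

lemma blocked_adj:
  assumes "sides C = {(l, q, L), (l', q', L')}"
    and "l' = q \<and> q' = l \<and> L' = L \<or> q' = q \<and> L' ! v \<noteq> L ! v"
  shows "blocked v C (L ! v) \<subseteq> {l, q, L ! v, L' ! v}"
  using assms by (auto simp: blocked_def downs_def letters_def)

lemma child_single:
  assumes "\<tau> \<in> letters v C" "sides C' \<noteq> {}"
    and "\<And>a b L'. (a, b, L') \<in> sides C' \<Longrightarrow> b = \<tau> \<and> set L' \<inter> blocked v C \<tau> = {}"
  shows "child v C [\<tau>] C'"
proof -
  obtain a b L' where "(a, b, L') \<in> sides C'" using assms(2) by auto
  then have "(a, \<tau>, L') \<in> sides C'" using assms(3) by blast
  then have "\<tau> \<in> downs C'" by (force simp: downs_def)
  moreover have "downs C' \<subseteq> {\<tau>}" using assms(3) by (auto simp: downs_def)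
  ultimately have "downs C' = {\<tau>}" by blast
  then show ?thesis using assms unfolding child_def by blast
qed

lemma child_half:
  assumes "(l, q, L) \<in> sides C" "2 \<le> n" "n < mm (L ! v) l"
    and "sides C' = {(a, b, L'), (b, a, L')}" "{a, b} = {L ! v, l}" "set L' \<inter> blocked v C (L ! v) = {}"
  shows "child v C (alt (L ! v) l n) C'"
proof -
  have "L ! v \<in> letters v C" using assms(1) by (force simp: letters_def)
  moreover have "downs C' = {L ! v, l}" using assms(4,5) by (auto simp: downs_def)
  moreover have "sides C' \<noteq> {}" "\<forall>(l, q, L')\<in>sides C'. set L' \<inter> blocked v C (L ! v) = {}"
    using assms(4,6) by auto
  ultimately show ?thesis unfolding child_def using assms(1-3) by blast
qed

lemma child_wedge:
  assumes "fst C = Some (l, q, L)" "L ! v = \<tau>" "\<tau>' \<in> letters v C" "\<tau> \<noteq> \<tau>'"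
    and "sides C' = {(a, b, L'), (b, a, L')}" "{a, b} = {\<tau>, \<tau>'}"
    and "set L' \<inter> (blocked v C \<tau> \<union> blocked v C \<tau>') = {}" "2 \<le> n"
  shows "n \<le> mm \<tau> \<tau>' \<Longrightarrow> child v C (alt \<tau> \<tau>' n) C'"
    and "n < mm \<tau> \<tau>' \<Longrightarrow> child v C (alt \<tau>' \<tau> n) C'"
proof -
  have \<tau>: "\<tau> \<in> letters v C" using assms(1,2) by (force simp: letters_def sides_def)
  have D: "downs C' = {\<tau>, \<tau>'}" "downs C' = {\<tau>', \<tau>}" using assms(5,6) by (auto simp: downs_def)
  have L': "\<forall>(l, q, L)\<in>sides C'. set L \<inter> blocked v C \<tau> = {}"
    "\<forall>(l, q, L)\<in>sides C'. set L \<inter> blocked v C \<tau>' = {}" "sides C' \<noteq> {}"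
    using assms(5,7) by auto
  show "child v C (alt \<tau> \<tau>' n) C'" if "n \<le> mm \<tau> \<tau>'"
  proof -
    have "n < mm \<tau> \<tau>' \<or> n = mm \<tau> \<tau>'" using that by auto
    then show ?thesis unfolding child_def using \<tau> D L' assms by blast
  qed
  show "child v C (alt \<tau>' \<tau> n) C'" if "n < mm \<tau> \<tau>'"
    unfolding child_def using \<tau> D L' assms that mm_sym[of \<tau> \<tau>'] by metis
qed

lemma list_all2_map_upt:
  assumes "\<And>j. j < n \<Longrightarrow> R (f (a + j)) (g (b + j))"
  shows "list_all2 R (map f [a..<a + n]) (map g [b..<b + n])"
  using assms by (auto simp: list_all2_conv_all_nth)

text \<open>Each vertex of the far side is attributed to the nearer end of the old edge, so all
  words are shorter than \<open>mm l \<tau>\<close>, as \<open>child\<close> demands;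
  \<open>eqv_across\<close> changes between the ends.\<close>

lemma top_located:
  assumes "l \<in> A" "\<tau> \<in> A" "l \<noteq> \<tau>" "L ! v = \<tau>" "set x \<subseteq> A" "eqv x' (x @ [\<tau>])"
    and XC: "fst (XC i) = x" "fst (XC (Suc i)) = x @ [l]"
      "(l, q, L) \<in> sides (snd (XC i))" "(l, q, L) \<in> sides (snd (XC (Suc i)))"
      "set L1 \<inter> blocked v (snd (XC i)) \<tau> = {}" "set L1 \<inter> blocked v (snd (XC (Suc i))) \<tau> = {}"
    and rest: "list_all2 (located v XC) ((Suc i, [\<tau>]) # ks)
      (positions (Some (l, \<tau>, L1)) (x' @ alt l \<tau> (2 * mm l \<tau> - 3)) fs)"
    and start: "u' = None \<or> (\<exists>a Lo. u' = Some (a, \<tau>, Lo) \<and> set Lo \<inter> blocked v (snd (XC i)) \<tau> = {})"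
  shows "list_all2 (located v XC)
     ((i, [\<tau>]) # map (\<lambda>n. if n < mm l \<tau> then (i, alt \<tau> l n)
         else (Suc i, alt \<tau> l (2 * mm l \<tau> - 1 - n))) [2..<2 * mm l \<tau> - 1] @ ks)
     (positions u' x' (alt_edges l \<tau> L1 (2 * mm l \<tau> - 3) @ fs))"
proof -
  define m where "m = mm l \<tau>"
  have m: "3 \<le> m" using mm_ge assms m_def by metis
  have m': "mm \<tau> l = m" using m_def mm_sym by metis
  define key where "key n = (if n < m then (i, alt \<tau> l n) else (Suc i, alt \<tau> l (2 * m - 1 - n)))" for n
  define pos where "pos j = (x' @ alt l \<tau> j, if odd j then (Some (l, \<tau>, L1), Some (\<tau>, l, L1))
                                else (Some (\<tau>, l, L1), Some (l, \<tau>, L1)))" for j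
  \<comment> \<open>A far side of \<open>2 * m - 3\<close> edges has \<open>2 * m - 4\<close>
    interior vertices. Key indices run one ahead of positions because each word includes the initial
    step \<open>\<tau>\<close>; the last key is the common end with \<open>rest\<close>.\<close>
  have N: "2 * m - 3 = Suc (2 * m - 4)" "even (2 * m - 4)" using m by auto
  have "positions u' x' (alt_edges l \<tau> L1 (2 * m - 3) @ fs) = (x', (u', Some (l, \<tau>, L1)))
      # map pos [1..<1 + (2 * m - 4)] @ positions (Some (l, \<tau>, L1)) (x' @ alt l \<tau> (2 * m - 3)) fs"
    unfolding N(1) positions_alt_edges pos_def using N(2) by simp
  moreover have "map key [2..<2 * m - 1] @ ks = map key [2..<2 + (2 * m - 4)] @ (Suc i, [\<tau>]) # ks"
  proof -
    have "2 * m - 1 = Suc (2 + (2 * m - 4))" using m by simp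
    then have "[2..<2 * m - 1] = [2..<2 + (2 * m - 4)] @ [2 + (2 * m - 4)]" by simp
    moreover have "key (2 + (2 * m - 4)) = (Suc i, [\<tau>])"
    proof -
      have "2 * m - 1 - (2 + (2 * m - 4)) = Suc 0" "\<not> 2 + (2 * m - 4) < m" using m by auto
      then show ?thesis by (simp add: key_def)
    qed
    ultimately show ?thesis by simp
  qed
  moreover have "located v XC (i, [\<tau>]) (x', (u', Some (l, \<tau>, L1)))"
  proof -
    have "child v (snd (XC i)) [\<tau>] (u', Some (l, \<tau>, L1))"
    proof (rule child_single)
      show "\<tau> \<in> letters v (snd (XC i))" using XC(3) assms(4) by (force simp: letters_def)
    qed (use XC(5) start in \<open>auto simp: sides_def\<close>)
    then show ?thesis using assms(6) XC(1) by (simp add: located_def)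
  qed
  moreover have "list_all2 (located v XC) (map key [2..<2 + (2 * m - 4)]) (map pos [1..<1 + (2 * m - 4)])"
  proof (rule list_all2_map_upt)
    fix j assume j: "j < 2 * m - 4"
    let ?C = "snd (pos (1 + j))"
    have C: "sides ?C = {(l, \<tau>, L1), (\<tau>, l, L1)}" by (auto simp: pos_def sides_def)
    have A: "set (alt \<tau> l n) \<subseteq> A" "set (alt l \<tau> n) \<subseteq> A" for n
      using set_alt[of \<tau> l n] set_alt[of l \<tau> n] assms by blast+
    have "eqv (x' @ alt l \<tau> (1 + j)) ((x @ [\<tau>]) @ alt l \<tau> (1 + j))"
      using assms(6) A by (intro eqv_append eqv_refl)
    then have e: "eqv (x' @ alt l \<tau> (1 + j)) (x @ alt \<tau> l (2 + j))"
      by (simp add: numeral_2_eq_2)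
    show "located v XC (key (2 + j)) (pos (1 + j))"
    proof (cases "2 + j < m")
      case True
      then have "child v (snd (XC i)) (alt (L ! v) l (2 + j)) ?C"
        using XC(3,5) C assms(4) m' by (intro child_half) auto
      then show ?thesis using True e XC(1) assms(4) by (simp add: located_def key_def pos_def)
    next
      case False
      define n where "n = 2 * m - 1 - (2 + j)"
      have n: "2 \<le> n" "n < m" using False j m by (auto simp: n_def)
      then have "child v (snd (XC (Suc i))) (alt (L ! v) l n) ?C"
        using XC(4,6) C assms(4) m' by (intro child_half) auto
      moreover have "eqv (alt \<tau> l (2 + j)) (l # alt \<tau> l n)"
        unfolding n_def using eqv_across[of \<tau> l "2 + j"] assms j m' by simp
      then have "eqv (x @ alt \<tau> l (2 + j)) (x @ l # alt \<tau> l n)"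
        using assms by (intro eqv_append eqv_refl)
      then have "eqv (x' @ alt l \<tau> (1 + j)) ((x @ [l]) @ alt \<tau> l n)"
        using e eqv_trans by auto
      moreover have "key (2 + j) = (Suc i, alt \<tau> l n)"
        using False by (simp add: key_def n_def)
      ultimately show ?thesis using XC(2) assms(4) by (simp add: located_def pos_def)
    qed
  qed
  ultimately show ?thesis
    using rest unfolding m_def[symmetric] key_def[symmetric]
    by (simp add: list_all2_appendI del: upt_Suc)
qed

text \<open>Both halves hang on the same old vertex. The middle vertex is assigned the word starting
  with \<open>\<tau>\<close>, the letter of the edge before that vertex, in agreement with the side
  condition of \<open>child\<close>.\<close>

lemma wedge_located:
  assumes "\<tau> \<in> A" "\<tau>' \<in> A" "\<tau> \<noteq> \<tau>'" "set x \<subseteq> A" "eqv x' (x @ [\<tau>])"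
    and XC: "fst (XC i) = x" "fst (snd (XC i)) = Some (l, q, L)" "L ! v = \<tau>" "\<tau>' \<in> letters v (snd (XC i))"
      "set L2 \<inter> (blocked v (snd (XC i)) \<tau> \<union> blocked v (snd (XC i)) \<tau>') = {}"
    and rest: "list_all2 (located v XC) ((i, [\<tau>']) # ks)
      (positions (Some (\<tau>, \<tau>', L2)) (x' @ alt \<tau>' \<tau> (2 * mm \<tau> \<tau>' - 2)) fs)"
    and start: "u' = Some (a, \<tau>, Lo)" "set Lo \<inter> blocked v (snd (XC i)) \<tau> = {}"
  shows "list_all2 (located v XC)
     ((i, [\<tau>]) # map (\<lambda>n. (i, if n \<le> mm \<tau> \<tau>' then alt \<tau> \<tau>' n
         else alt \<tau>' \<tau> (2 * mm \<tau> \<tau>' - n))) [2..<2 * mm \<tau> \<tau>'] @ ks)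
     (positions u' x' (alt_edges \<tau>' \<tau> L2 (2 * mm \<tau> \<tau>' - 2) @ fs))"
proof -
  define m where "m = mm \<tau> \<tau>'"
  have m: "3 \<le> m" using mm_ge assms m_def by metis
  define key where "key n = (i, if n \<le> m then alt \<tau> \<tau>' n else alt \<tau>' \<tau> (2 * m - n))" for n
  define pos where "pos j = (x' @ alt \<tau>' \<tau> j, if odd j then (Some (\<tau>', \<tau>, L2), Some (\<tau>, \<tau>', L2))
                                else (Some (\<tau>, \<tau>', L2), Some (\<tau>', \<tau>, L2)))" for j
  have N: "2 * m - 2 = Suc (2 * m - 3)" "odd (2 * m - 3)" using m by auto
  have "positions u' x' (alt_edges \<tau>' \<tau> L2 (2 * m - 2) @ fs) = (x', (u', Some (\<tau>', \<tau>, L2)))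
      # map pos [1..<1 + (2 * m - 3)] @ positions (Some (\<tau>, \<tau>', L2)) (x' @ alt \<tau>' \<tau> (2 * m - 2)) fs"
    unfolding N(1) positions_alt_edges pos_def using N(2) by simp
  moreover have "map key [2..<2 * m] @ ks = map key [2..<2 + (2 * m - 3)] @ (i, [\<tau>']) # ks"
  proof -
    have "[2..<Suc (2 + (2 * m - 3))] = [2..<2 + (2 * m - 3)] @ [2 + (2 * m - 3)]" by simp
    moreover have "Suc (2 + (2 * m - 3)) = 2 * m" using m by simp
    ultimately have "[2..<2 * m] = [2..<2 + (2 * m - 3)] @ [2 + (2 * m - 3)]" by metis
    moreover have "key (2 + (2 * m - 3)) = (i, [\<tau>'])"
    proof -
      have "2 * m - (2 + (2 * m - 3)) = Suc 0" "\<not> 2 + (2 * m - 3) \<le> m" using m by auto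
      then show ?thesis by (simp add: key_def)
    qed
    ultimately show ?thesis by simp
  qed
  moreover have "located v XC (i, [\<tau>]) (x', (u', Some (\<tau>', \<tau>, L2)))"
  proof -
    have "child v (snd (XC i)) [\<tau>] (u', Some (\<tau>', \<tau>, L2))"
    proof (rule child_single)
      show "\<tau> \<in> letters v (snd (XC i))" using XC(2,3) by (force simp: letters_def sides_def)
    qed (use XC(5) start in \<open>auto simp: sides_def\<close>)
    then show ?thesis using assms(5) XC(1) by (simp add: located_def)
  qed
  moreover have "list_all2 (located v XC) (map key [2..<2 + (2 * m - 3)]) (map pos [1..<1 + (2 * m - 3)])"
  proof (rule list_all2_map_upt)
    fix j assume j: "j < 2 * m - 3"
    let ?C = "snd (pos (1 + j))"
    have C: "sides ?C = {(\<tau>', \<tau>, L2), (\<tau>, \<tau>', L2)}" by (auto simp: pos_def sides_def)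
    have A: "set (alt \<tau> \<tau>' n) \<subseteq> A" "set (alt \<tau>' \<tau> n) \<subseteq> A" for n
      using set_alt[of \<tau> \<tau>' n] set_alt[of \<tau>' \<tau> n] assms by blast+
    have "eqv (x' @ alt \<tau>' \<tau> (1 + j)) ((x @ [\<tau>]) @ alt \<tau>' \<tau> (1 + j))"
      using assms(5) A by (intro eqv_append eqv_refl)
    then have e: "eqv (x' @ alt \<tau>' \<tau> (1 + j)) (x @ alt \<tau> \<tau>' (2 + j))"
      by (simp add: numeral_2_eq_2)
    note wedge = child_wedge[OF XC(2,3,4) assms(3) C _ XC(5)]
    show "located v XC (key (2 + j)) (pos (1 + j))"
    proof (cases "2 + j \<le> m")
      case True
      then have "child v (snd (XC i)) (alt \<tau> \<tau>' (2 + j)) ?C"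
        using wedge(1)[of "2 + j"] m_def by auto
      then show ?thesis using True e XC(1) by (simp add: located_def key_def pos_def)
    next
      case False
      define n where "n = 2 * m - (2 + j)"
      have n: "2 \<le> n" "n < m" using False j m by (auto simp: n_def)
      then have "child v (snd (XC i)) (alt \<tau>' \<tau> n) ?C"
        using wedge(2)[of n] m_def by auto
      moreover have "eqv (alt \<tau> \<tau>' (2 + j)) (alt \<tau>' \<tau> n)"
        unfolding n_def m_def using eqv_braid[of \<tau> \<tau>' "2 + j"] assms j m_def by simp
      then have "eqv (x @ alt \<tau> \<tau>' (2 + j)) (x @ alt \<tau>' \<tau> n)"
        using assms by (intro eqv_append eqv_refl)
      then have "eqv (x' @ alt \<tau>' \<tau> (1 + j)) (x @ alt \<tau>' \<tau> n)"
        using e eqv_trans by blast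
      moreover have "key (2 + j) = (i, alt \<tau>' \<tau> n)"
        using False by (simp add: key_def n_def)
      ultimately show ?thesis using XC(1) by (simp add: located_def pos_def)
    qed
  qed
  ultimately show ?thesis
    using rest unfolding m_def[symmetric] key_def[symmetric]
    by (simp add: list_all2_appendI del: upt_Suc)
qed

text \<open>The induction carries the old edge \<open>u\<close> and the new edge \<open>u'\<close>
  entering the current block, because both appear in the configurations at the seam;
  \<open>p\<close> is the branch generator of \<open>u\<close>.\<close>

lemma refine_located:
  assumes "v < V" "good es" "es \<noteq> []" "length P = V" "set x \<subseteq> A"
    and "\<And>j. j \<le> length es \<Longrightarrow> XC (i + j) = positions u x es ! j"
    and "u = None \<or> (\<exists>lo qo Lo. u = Some (lo, qo, Lo) \<and> good ((lo, qo, Lo) # es) \<and> Lo ! v = p)"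
    and "\<tau> = snd (snd (hd es)) ! v" "eqv x' (x @ [\<tau>])"
    and "u' = None \<or> (\<exists>a Lo. u' = Some (a, \<tau>, Lo) \<and> set Lo \<inter> blocked v (snd (XC i)) \<tau> = {})"
  shows "list_all2 (located v XC) ((i, [\<tau>]) # keys_from v i es) (positions u' x' (refine v p P es))"
  using assms(2-)
proof (induction es arbitrary: p P x i u \<tau> x' u')
  case Nil
  then show ?case by simp
next
  case (Cons e es)
  obtain l q L where e: "e = (l, q, L)" by (cases e) auto
  note prems = Cons.prems[unfolded e] and IH = Cons.IH
  note g = good_ConsD[OF prems(1) assms(1)]
  have \<tau>: "\<tau> = L ! v" using prems(7) by simp
  define \<tau>' where "\<tau>' = next_letter v \<tau> es"
  \<comment> \<open>\<open>L1\<close> must miss the blocked sets at both ends of the edge, which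
    \<open>bi\<close> and \<open>bs\<close> place in \<open>{l, q, \<tau>, p}\<close> and
    \<open>{l, q, \<tau>, \<tau>'}\<close>. \<open>L2\<close> must miss those of
    \<open>\<tau>\<close> and \<open>\<tau>'\<close> at the second end, where the next label occurs
    as well. The preceding list is avoided to make neighbouring lists disjoint.\<close>
  define L1 where "L1 = fresh ({l, q, \<tau>, p, \<tau>'} \<union> set P)"
  define L2 where "L2 = fresh ({l, q, \<tau>, \<tau>', fst (hd es)} \<union> set L1)"
  note L1 = fresh5[OF card_A prems(3), of l q \<tau> p \<tau>', folded L1_def]
  note L2 = fresh5[OF card_A L1(2), of l q \<tau> \<tau>' "fst (hd es)", folded L2_def]
  have eq: "refine v p P (e # es) = alt_edges l \<tau> L1 (2 * mm l \<tau> - 3) @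
      (if \<tau>' = \<tau> then refine v \<tau> L1 es
       else alt_edges \<tau>' \<tau> L2 (2 * mm \<tau> \<tau>' - 2) @ refine v \<tau> L2 es)"
    by (simp add: e Let_def L1_def L2_def \<tau> \<tau>'_def)
  have keq: "keys_from v i (e # es) =
      map (\<lambda>n. if n < mm l \<tau> then (i, alt \<tau> l n)
         else (Suc i, alt \<tau> l (2 * mm l \<tau> - 1 - n))) [2..<2 * mm l \<tau> - 1] @
      ((if \<tau>' = \<tau> then [] else map (\<lambda>n. (Suc i, if n \<le> mm \<tau> \<tau>' then alt \<tau> \<tau>' n
         else alt \<tau>' \<tau> (2 * mm \<tau> \<tau>' - n))) [2..<2 * mm \<tau> \<tau>']) @ keys_from v (Suc i) es)"
    by (simp add: e Let_def \<tau> \<tau>'_def)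
  have XCi: "XC i = (x, (u, Some e))" using prems(5)[of 0] e by simp
  have XCs: "XC (Suc i + j) = positions (Some e) (x @ [l]) es ! j" if "j \<le> length es" for j
    using prems(5)[of "Suc j"] that e by simp
  have XCs0: "XC (Suc i) = (x @ [l], (Some e, case es of [] \<Rightarrow> None | e' # _ \<Rightarrow> Some e'))"
    using XCs[of 0] by (cases es) simp_all
  have bi: "blocked v (snd (XC i)) \<tau> \<subseteq> {l, q, \<tau>, p}"
    using prems(6)
  proof
    assume "u = None"
    then show ?thesis
      using blocked_end[of "snd (XC i)" l q L v] by (auto simp: XCi e sides_def \<tau>)
  next
    assume "\<exists>lo qo Lo. u = Some (lo, qo, Lo) \<and> good ((lo, qo, Lo) # (l, q, L) # es) \<and> Lo ! v = p"
    then obtain lo qo Lo where u: "u = Some (lo, qo, Lo)" "good ((lo, qo, Lo) # (l, q, L) # es)" "Lo ! v = p"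
      by blast
    note n = next_letter_Cons(2,3,7,8)[OF u(2) assms(1)]
    have "lo = q \<and> qo = l \<and> Lo = L \<or> qo = q \<and> Lo ! v \<noteq> L ! v"
      using n by (cases "L ! v = Lo ! v") auto
    then show ?thesis
      using blocked_adj[of "snd (XC i)" l q L lo qo Lo v] u
      by (simp add: XCi e sides_def \<tau> insert_commute)
  qed
  have bs: "blocked v (snd (XC (Suc i))) \<tau> \<subseteq> {l, q, \<tau>, \<tau>'}"
  proof (cases es)
    case Nil
    then show ?thesis
      using blocked_end[of "snd (XC (Suc i))" l q L v] by (auto simp: XCs0 e sides_def \<tau>)
  next
    case (Cons e' es')
    obtain l' q' L' where e': "e' = (l', q', L')" by (cases e') auto
    have gd: "good ((l, q, L) # (l', q', L') # es')" using prems(1) Cons e' by simp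
    note n = next_letter_Cons(1-3)[OF gd assms(1)]
    have "l' = q \<and> q' = l \<and> L' = L \<or> q' = q \<and> L' ! v \<noteq> L ! v"
      using n(2,3) by blast
    then show ?thesis
      using blocked_adj[of "snd (XC (Suc i))" l q L l' q' L' v] n(1)
      by (simp add: XCs0 Cons e e' sides_def \<tau> \<tau>'_def insert_commute)
  qed
  have d1: "set L1 \<inter> blocked v (snd (XC i)) \<tau> = {}" "set L1 \<inter> blocked v (snd (XC (Suc i))) \<tau> = {}"
    using bi bs L1(4) by blast+
  have xA: "set (x @ [l]) \<subseteq> A" using prems(4) g by simp
  define x'' where "x'' = x' @ alt l \<tau> (2 * mm l \<tau> - 3)"
  have l\<tau>: "l \<in> A" "\<tau> \<in> A" "l \<noteq> \<tau>" using g \<tau> by auto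
  have m: "3 \<le> mm l \<tau>" using mm_ge l\<tau> by blast
  have x'': "eqv x'' ((x @ [l]) @ [\<tau>])"
  proof -
    have A: "set (alt l \<tau> n) \<subseteq> A" for n using set_alt[of l \<tau> n] l\<tau> by blast
    have "eqv x'' ((x @ [\<tau>]) @ alt l \<tau> (2 * mm l \<tau> - 3))"
      unfolding x''_def using prems(8) A by (intro eqv_append eqv_refl)
    moreover have "[\<tau>] @ alt l \<tau> (2 * mm l \<tau> - 3) = alt \<tau> l (2 * mm l \<tau> - 2)"
    proof -
      have "Suc (2 * mm l \<tau> - 3) = 2 * mm l \<tau> - 2" using m by simp
      then show ?thesis by (metis alt.simps(2) append_Cons append_Nil)
    qed
    moreover have "eqv (alt \<tau> l (2 * mm l \<tau> - 2)) (l # alt \<tau> l 1)"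
    proof -
      have "2 * mm \<tau> l - 1 - (2 * mm \<tau> l - 2) = 1" "2 * mm \<tau> l - 2 < 2 * mm \<tau> l"
        using m mm_sym[of l \<tau>] by auto
      then show ?thesis using eqv_across[of \<tau> l "2 * mm \<tau> l - 2"] l\<tau> mm_sym[of l \<tau>] by simp
    qed
    then have "eqv (x @ alt \<tau> l (2 * mm l \<tau> - 2)) (x @ l # alt \<tau> l 1)"
      by (rule eqv_append_left[OF _ prems(4)])
    ultimately show ?thesis using eqv_trans by simp
  qed
  have rest: "list_all2 (located v XC)
     ((Suc i, [\<tau>]) # (if \<tau>' = \<tau> then [] else map (\<lambda>n. (Suc i, if n \<le> mm \<tau> \<tau>' then alt \<tau> \<tau>' n
         else alt \<tau>' \<tau> (2 * mm \<tau> \<tau>' - n))) [2..<2 * mm \<tau> \<tau>']) @ keys_from v (Suc i) es)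
     (positions (Some (l, \<tau>, L1)) x'' (if \<tau>' = \<tau> then refine v \<tau> L1 es
       else alt_edges \<tau>' \<tau> L2 (2 * mm \<tau> \<tau>' - 2) @ refine v \<tau> L2 es))"
  proof (cases es)
    case Nil
    then have "\<tau>' = \<tau>" by (simp add: \<tau>'_def next_letter_def)
    moreover have "child v (snd (XC (Suc i))) [\<tau>] (Some (l, \<tau>, L1), None)"
    proof (rule child_single)
      show "\<tau> \<in> letters v (snd (XC (Suc i)))" by (simp add: XCs0 e letters_def sides_def \<tau>)
    qed (use d1 in \<open>auto simp: sides_def\<close>)
    ultimately show ?thesis using x'' by (simp add: Nil located_def XCs0)
  next
    case (Cons e' es')
    note es = this
    obtain l' q' L' where e': "e' = (l', q', L')" by (cases e') auto
    have gd: "good ((l, q, L) # (l', q', L') # es')" using prems(1) es e' by simp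
    note n = next_letter_Cons[OF gd assms(1)]
    have \<tau>': "\<tau>' = L' ! v" using n(1) by (simp add: \<tau>'_def es e')
    have hd: "\<tau>' = snd (snd (hd es)) ! v" by (simp add: es e' \<tau>')
    have u: "Some e = None \<or> (\<exists>lo qo Lo. Some e = Some (lo, qo, Lo) \<and> good ((lo, qo, Lo) # es) \<and> Lo ! v = \<tau>)"
      using prems(1) e \<tau> by blast
    show ?thesis
    proof (cases "\<tau>' = \<tau>")
      case True
      have "list_all2 (located v XC) ((Suc i, [\<tau>']) # keys_from v (Suc i) es)
        (positions (Some (l, \<tau>, L1)) x'' (refine v \<tau> L1 es))"
        using d1 x'' XCs u xA g(13) L1(2) es True hd
        by (intro IH[of L1 "x @ [l]" "Suc i" "Some e" \<tau> \<tau>' x'']) auto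
      then show ?thesis using True by simp
    next
      case False
      then have bd: "q' = q" using n(3) \<tau>' \<tau> by auto
      have L2': "set L2 \<inter> ({l, q, \<tau>, \<tau>', l'} \<union> set L1) = {}" using L2(4) by (simp add: es e')
      have "blocked v (snd (XC (Suc i))) \<tau>' \<subseteq> {l', q', \<tau>', \<tau>}"
        using blocked_adj[of "snd (XC (Suc i))" l' q' L' l q L v] False bd
        by (simp add: XCs0 es e e' sides_def \<tau> \<tau>' insert_commute)
      then have d2: "set L2 \<inter> (blocked v (snd (XC (Suc i))) \<tau> \<union> blocked v (snd (XC (Suc i))) \<tau>') = {}"
        using bs L2' bd by blast
      have \<tau>'A: "\<tau>' \<in> A" using n \<tau>' by simp
      have m': "3 \<le> mm \<tau> \<tau>'" using mm_ge False l\<tau> \<tau>'A by metis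
      have w: "eqv (x'' @ alt \<tau>' \<tau> (2 * mm \<tau> \<tau>' - 2)) ((x @ [l]) @ [\<tau>'])"
      proof -
        have A: "set (alt \<tau>' \<tau> k) \<subseteq> A" for k using set_alt[of \<tau>' \<tau> k] l\<tau> \<tau>'A by blast
        have "eqv (x'' @ alt \<tau>' \<tau> (2 * mm \<tau> \<tau>' - 2)) (((x @ [l]) @ [\<tau>]) @ alt \<tau>' \<tau> (2 * mm \<tau> \<tau>' - 2))"
          using x'' A by (intro eqv_append eqv_refl)
        moreover have "[\<tau>] @ alt \<tau>' \<tau> (2 * mm \<tau> \<tau>' - 2) = alt \<tau> \<tau>' (2 * mm \<tau> \<tau>' - 1)"
        proof -
          have "Suc (2 * mm \<tau> \<tau>' - 2) = 2 * mm \<tau> \<tau>' - 1" using m' by simp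
          then show ?thesis by (metis alt.simps(2) append_Cons append_Nil)
        qed
        moreover have "eqv (alt \<tau> \<tau>' (2 * mm \<tau> \<tau>' - 1)) (alt \<tau>' \<tau> 1)"
        proof -
          have "2 * mm \<tau> \<tau>' - (2 * mm \<tau> \<tau>' - 1) = 1" using m' by simp
          then show ?thesis
            using eqv_braid[of \<tau> \<tau>' "2 * mm \<tau> \<tau>' - 1"] l\<tau> \<tau>'A False by simp
        qed
        then have "eqv ((x @ [l]) @ alt \<tau> \<tau>' (2 * mm \<tau> \<tau>' - 1)) ((x @ [l]) @ alt \<tau>' \<tau> 1)"
          by (rule eqv_append_left[OF _ xA])
        ultimately show ?thesis using eqv_trans by simp
      qed
      have "list_all2 (located v XC) ((Suc i, [\<tau>']) # keys_from v (Suc i) es)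
        (positions (Some (\<tau>, \<tau>', L2)) (x'' @ alt \<tau>' \<tau> (2 * mm \<tau> \<tau>' - 2)) (refine v \<tau> L2 es))"
        using d2 w XCs u xA g(13) L2(2) es hd
        by (intro IH[of L2 "x @ [l]" "Suc i" "Some e" \<tau> \<tau>']) auto
      then have "list_all2 (located v XC)
       ((Suc i, [\<tau>]) # map (\<lambda>n. (Suc i, if n \<le> mm \<tau> \<tau>' then alt \<tau> \<tau>' n
         else alt \<tau>' \<tau> (2 * mm \<tau> \<tau>' - n))) [2..<2 * mm \<tau> \<tau>'] @ keys_from v (Suc i) es)
       (positions (Some (l, \<tau>, L1)) x'' (alt_edges \<tau>' \<tau> L2 (2 * mm \<tau> \<tau>' - 2) @ refine v \<tau> L2 es))"
        using l\<tau> \<tau>'A False xA x'' d1 d2 e \<tau>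
        by (intro wedge_located[where x = "x @ [l]" and l = l and q = q and L = L and a = l and Lo = L1])
          (auto simp: XCs0 es e' \<tau>' letters_def sides_def)
      then show ?thesis using False by simp
    qed
  qed
  show ?case
    unfolding eq keq
    using l\<tau> \<tau> prems(4,8,9) d1 rest[unfolded x''_def]
    by (intro top_located[where x = x and q = q and L = L])
      (auto simp: XCi XCs0 e sides_def)
qed

end

section \<open>Iterated refinements\<close>

text \<open>Each change of the list along the path may force a polygon between two far sides in the
  next refinement, so it is counted like an edge.\<close>

fun cost :: "'a list \<Rightarrow> 'a edge list \<Rightarrow> nat" where
  "cost P [] = 0"
| "cost P ((l, q, L) # es) = 1 + (if L = P then 0 else 1) + cost L es"

lemma cost_bounds: "length es \<le> cost P es" "cost P es \<le> 2 * length es"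
  by (induction P es rule: cost.induct) auto

lemma cost_alt_edges: "0 < n \<Longrightarrow> cost P (alt_edges a b L n @ es) \<le> n + 1 + cost L es"
proof -
  have "cost L (alt_edges a b L n @ es) = n + cost L es" for a b n
    by (induction n arbitrary: a b) auto
  then show "0 < n \<Longrightarrow> cost P (alt_edges a b L n @ es) \<le> n + 1 + cost L es"
    by (cases n) auto
qed

definition config_at :: "'a edge list \<Rightarrow> nat \<Rightarrow> 'a config" where
  "config_at es i = (if i = 0 then None else Some (es ! (i - 1)), if i < length es then Some (es ! i) else None)"

lemma positions_nth:
  "i \<le> length es \<Longrightarrow> positions None x es ! i = (x @ map fst (take i es), config_at es i)"
proof -
  have "positions u x es ! i = (x @ map fst (take i es),
     (if i = 0 then u else Some (es ! (i - 1)), if i < length es then Some (es ! i) else None))"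
    if "i \<le> length es" for u
    using that
  proof (induction es arbitrary: u x i)
    case (Cons e es)
    then show ?case by (cases i) (auto simp: nth_Cons')
  qed simp
  then show "i \<le> length es \<Longrightarrow> positions None x es ! i = (x @ map fst (take i es), config_at es i)"
    by (simp add: config_at_def)
qed

context coxeter_words
begin

definition next_path :: "nat \<Rightarrow> 'a edge list \<Rightarrow> 'a edge list" where
  "next_path v es = refine v (snd (snd (hd es)) ! v) (snd (snd (hd es))) es"

definition keys :: "nat \<Rightarrow> 'a edge list \<Rightarrow> (nat \<times> 'a list) list" where
  "keys v es = (0, [snd (snd (hd es)) ! v]) # keys_from v 0 es"

fun path_after :: "nat list \<Rightarrow> 'a edge list \<Rightarrow> 'a edge list" where
  "path_after [] es = es"
| "path_after (v # vs) es = path_after vs (next_path v es)"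

fun start_after :: "nat list \<Rightarrow> 'a list \<Rightarrow> 'a edge list \<Rightarrow> 'a list" where
  "start_after [] x es = x"
| "start_after (v # vs) x es = start_after vs (x @ [snd (snd (hd es)) ! v]) (next_path v es)"

text \<open>\<open>chain vs es i r k\<close>: the word \<open>r\<close> leads from vertex \<open>i\<close> of \<open>es\<close> through its successive
  refinements along \<open>vs\<close> to vertex \<open>k\<close> of the last one.\<close>

fun chain :: "nat list \<Rightarrow> 'a edge list \<Rightarrow> nat \<Rightarrow> 'a list \<Rightarrow> nat \<Rightarrow> bool" where
  "chain [] es i r k \<longleftrightarrow> k = i \<and> r = [] \<and> i \<le> length es"
| "chain (v # vs) es i r k \<longleftrightarrow> (\<exists>j d r'. j < length (keys v es) \<and> keys v es ! j = (i, d) \<and>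
     r = d @ r' \<and> chain vs (next_path v es) j r' k)"

lemma keys_from_bounds: "(j, d) \<in> set (keys_from v i es) \<Longrightarrow> i \<le> j \<and> j \<le> i + length es"
proof (induction es arbitrary: i)
  case (Cons e es)
  obtain l q L where e: "e = (l, q, L)" by (cases e) auto
  from Cons.prems have "j = i \<or> j = Suc i \<or> (j, d) \<in> set (keys_from v (Suc i) es)"
    by (auto simp: e Let_def split: if_splits)
  then show ?case using Cons.IH[of "Suc i"] by auto
qed simp

text \<open>Distinct keys make a refined vertex a function of the old vertex and the word. Words at
  one old vertex differ in length or in their first two letters; the second conjunct describes those
  that the remaining path contributes at the vertex shared with the current block.\<close>

lemma keys_from_distinct:
  assumes "good es" "v < V"
  shows "distinct (keys_from v i es) \<and> (\<forall>d. (i, d) \<in> set (keys_from v i es) \<longrightarrow>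
    es \<noteq> [] \<and> (\<exists>n\<ge>2. d = alt (snd (snd (hd es)) ! v) (fst (hd es)) n))"
  using assms(1)
proof (induction es arbitrary: i)
  case (Cons e es)
  obtain l q L where e: "e = (l, q, L)" by (cases e) auto
  note g = good_ConsD[OF Cons.prems(1)[unfolded e] assms(2)]
  define \<tau> where "\<tau> = L ! v"
  define \<tau>' where "\<tau>' = next_letter v \<tau> es"
  define m where "m = mm l \<tau>"
  define k where "k = mm \<tau> \<tau>'"
  define X where "X = map (\<lambda>n. if n < m then (i, alt \<tau> l n) else (Suc i, alt \<tau> l (2 * m - 1 - n))) [2..<2 * m - 1]"
  define Y where "Y = (if \<tau>' = \<tau> then [] else map (\<lambda>n. (Suc i, if n \<le> k then alt \<tau> \<tau>' n else alt \<tau>' \<tau> (2 * k - n))) [2..<2 * k])"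
  define Z where "Z = keys_from v (Suc i) es"
  have eq: "keys_from v i (e # es) = X @ Y @ Z"
    by (simp add: e Let_def X_def Y_def Z_def \<tau>_def \<tau>'_def m_def k_def)
  \<comment> \<open>All words in \<open>X\<close> alternate in the same two letters, so old index
    and length tell them apart.\<close>
  have dX: "distinct X"
  proof -
    have "map (\<lambda>(j, d). (j, length d)) X = map (\<lambda>n. if n < m then (i, n) else (Suc i, 2 * m - 1 - n)) [2..<2 * m - 1]"
      by (simp add: X_def if_distrib)
    moreover have "inj_on (\<lambda>n. if n < m then (i, n) else (Suc i, 2 * m - 1 - n)) {2..<2 * m - 1}"
      by (intro inj_onI) (auto split: if_splits)
    ultimately have "distinct (map (\<lambda>(j, d). (j, length d)) X)" by (simp add: distinct_map)
    then show ?thesis by (simp add: distinct_map)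
  qed
  have dY: "distinct Y"
  proof (cases "\<tau>' = \<tau>")
    case False
    let ?f = "\<lambda>n. (Suc i, if n \<le> k then alt \<tau> \<tau>' n else alt \<tau>' \<tau> (2 * k - n))"
    have "inj_on ?f {2..<2 * k}"
    proof (rule inj_onI)
      fix n n' assume n: "n \<in> {2..<2 * k}" "n' \<in> {2..<2 * k}" "?f n = ?f n'"
      consider "n \<le> k" "n' \<le> k" | "n \<le> k" "\<not> n' \<le> k" | "\<not> n \<le> k" "n' \<le> k" | "\<not> n \<le> k" "\<not> n' \<le> k"
        by blast
      then show "n = n'"
        by cases (use n False in \<open>simp_all add: alt_eq_iff\<close>)
    qed
    then show ?thesis using False by (simp add: Y_def distinct_map)
  qed (simp add: Y_def)
  have Z: "distinct Z" "\<And>d. (Suc i, d) \<in> set Z \<Longrightarrow>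
    es \<noteq> [] \<and> (\<exists>n\<ge>2. d = alt (snd (snd (hd es)) ! v) (fst (hd es)) n)"
    "\<And>j d. (j, d) \<in> set Z \<Longrightarrow> Suc i \<le> j"
    using Cons.IH[OF g(13), of "Suc i"] keys_from_bounds unfolding Z_def by blast+
  have X: "(\<exists>n\<ge>2. (j, d) = (i, alt \<tau> l n)) \<or> (\<exists>n\<ge>1. (j, d) = (Suc i, alt \<tau> l n))"
    if "(j, d) \<in> set X" for j d
  proof -
    from that obtain n where n: "2 \<le> n" "n < 2 * m - 1"
      "(j, d) = (if n < m then (i, alt \<tau> l n) else (Suc i, alt \<tau> l (2 * m - 1 - n)))"
      unfolding X_def by auto
    show ?thesis
    proof (cases "n < m")
      case False
      then have "(j, d) = (Suc i, alt \<tau> l (2 * m - 1 - n))" "1 \<le> 2 * m - 1 - n" using n by auto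
      then show ?thesis by blast
    qed (use n in auto)
  qed
  have Y: "\<tau>' \<noteq> \<tau> \<and> ((\<exists>n\<ge>2. (j, d) = (Suc i, alt \<tau> \<tau>' n)) \<or> (\<exists>n\<ge>1. (j, d) = (Suc i, alt \<tau>' \<tau> n)))"
    if "(j, d) \<in> set Y" for j d
  proof -
    have ne: "\<tau>' \<noteq> \<tau>" using that by (auto simp: Y_def)
    with that obtain n where n: "2 \<le> n" "n < 2 * k"
      "(j, d) = (Suc i, if n \<le> k then alt \<tau> \<tau>' n else alt \<tau>' \<tau> (2 * k - n))"
      unfolding Y_def by auto
    show ?thesis
    proof (cases "n \<le> k")
      case False
      then have "(j, d) = (Suc i, alt \<tau>' \<tau> (2 * k - n))" "1 \<le> 2 * k - n" using n by auto
      then show ?thesis using ne by blast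
    qed (use n ne in auto)
  qed
  have "set X \<inter> set Y = {} \<and> set X \<inter> set Z = {} \<and> set Y \<inter> set Z = {}"
  proof (cases es)
    case Nil
    then show ?thesis by (simp add: Y_def Z_def \<tau>'_def next_letter_def)
  next
    case (Cons e' es')
    obtain l' q' L' where e': "e' = (l', q', L')" by (cases e') auto
    have gd: "good ((l, q, L) # (l', q', L') # es')" using \<open>good (e # es)\<close> Cons e e' by simp
    note n = next_letter_Cons(1,4-)[OF gd assms(2)]
    have \<tau>': "\<tau>' = L' ! v" using n(1) by (simp add: \<tau>'_def Cons e')
    have ne: "l' \<noteq> l" "\<tau>' \<noteq> l" "\<tau> \<noteq> l'" using n \<tau>' \<tau>_def by auto
    have Z': "\<exists>n\<ge>2. d = alt \<tau>' l' n" if "(Suc i, d) \<in> set Z" for d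
      using Z(2)[OF that] by (simp add: Cons e' \<tau>')
    have "a \<notin> set Y" if "a \<in> set X" for a
      using X[of "fst a" "snd a"] Y[of "fst a" "snd a"] that ne by (auto simp: alt_eq_iff)
    moreover have "a \<notin> set Z" if "a \<in> set X" for a
    proof
      assume "a \<in> set Z"
      then have "fst a = Suc i" "Suc i \<le> fst a"
        using X[of "fst a" "snd a"] Z(3)[of "fst a" "snd a"] that by auto
      then show False
        using X[of "fst a" "snd a"] Z'[of "snd a"] that ne \<open>a \<in> set Z\<close>
        by (cases a) (auto simp: alt_eq_iff)
    qed
    moreover have "a \<notin> set Z" if "a \<in> set Y" for a
    proof
      assume "a \<in> set Z"
      then show False
        using Y[of "fst a" "snd a"] Z'[of "snd a"] that ne by (cases a) (auto simp: alt_eq_iff)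
    qed
    ultimately show ?thesis by blast
  qed
  then have "distinct (keys_from v i (e # es))" using dX dY Z(1) by (auto simp: eq)
  moreover have "\<exists>n\<ge>2. d = alt \<tau> l n" if "(i, d) \<in> set (keys_from v i (e # es))" for d
    using that X[of i d] Y[of i d] Z(3)[of i d] by (auto simp: eq)
  ultimately show ?case by (simp add: e \<tau>_def)
qed simp

lemma keys_distinct: "good es \<Longrightarrow> v < V \<Longrightarrow> distinct (keys v es)"
proof -
  assume a: "good es" "v < V"
  have "(0, [\<tau>]) \<notin> set (keys_from v 0 es)" for \<tau>
  proof
    assume "(0, [\<tau>]) \<in> set (keys_from v 0 es)"
    then obtain n where n: "2 \<le> n" "[\<tau>] = alt (snd (snd (hd es)) ! v) (fst (hd es)) n"
      using keys_from_distinct[OF a, of 0] by blast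
    show False using n(1) arg_cong[OF n(2), of length] by simp
  qed
  then show "distinct (keys v es)" using keys_from_distinct[OF a, of 0] by (simp add: keys_def)
qed

lemma keys_fst: "j < length (keys v es) \<Longrightarrow> keys v es ! j = (i, d) \<Longrightarrow> i \<le> length es"
  using keys_from_bounds[of i d v 0 es] nth_mem[of j "keys v es"] by (auto simp: keys_def)

text \<open>Supplies the one-letter steps of which the rays are made.\<close>

lemma keys_single:
  assumes "i \<le> length es" "good es" "v < V"
  shows "\<exists>\<tau>. (i, [\<tau>]) \<in> set (keys v es)"
proof -
  have "\<exists>\<tau>. (Suc (i + j), [\<tau>]) \<in> set (keys_from v i es)" if "j < length es" "good es" for i j
    using that
  proof (induction es arbitrary: i j)
    case (Cons e es)
    obtain l q L where e: "e = (l, q, L)" by (cases e) auto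
    note g = good_ConsD[OF Cons.prems(2)[unfolded e] assms(3)]
    define m where "m = mm l (L ! v)"
    have m: "3 \<le> m" using mm_ge g m_def by metis
    show ?case
    proof (cases j)
      case 0
      have "2 * m - 2 \<in> set [2..<2 * m - 1]" using m by auto
      moreover have "(\<lambda>n. if n < m then (i, alt (L ! v) l n) else (Suc i, alt (L ! v) l (2 * m - 1 - n))) (2 * m - 2)
         = (Suc i, [L ! v])"
      proof -
        have "2 * m - 1 - (2 * m - 2) = Suc 0" "\<not> 2 * m - 2 < m" using m by auto
        then show ?thesis by simp
      qed
      ultimately have "(Suc i, [L ! v]) \<in> set (map (\<lambda>n. if n < m then (i, alt (L ! v) l n)
         else (Suc i, alt (L ! v) l (2 * m - 1 - n))) [2..<2 * m - 1])"
        unfolding set_map by (intro rev_image_eqI) auto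
      then show ?thesis unfolding e keys_from.simps Let_def m_def[symmetric] 0 by auto
    next
      case (Suc j')
      then show ?thesis
        using Cons.IH[of j' "Suc i"] Cons.prems g(13) by (auto simp: e Let_def)
    qed
  qed simp
  from this[of "i - 1" 0] show ?thesis using assms by (cases i) (auto simp: keys_def)
qed

lemma next_path_valid:
  assumes "good es" "es \<noteq> []" "v < V"
  shows "good (next_path v es)" "next_path v es \<noteq> []"
proof -
  obtain l q L es' where es: "es = (l, q, L) # es'" using assms(2) by (metis neq_Nil_conv prod_cases3)
  have "length L = V" using good_ConsD(5)[of l q L es' v] assms es by simp
  then show "good (next_path v es)" "next_path v es \<noteq> []"
    using refine_good[OF card_A assms(1,3), of L "L ! v"] by (auto simp: next_path_def es)
qed

lemma keys_located:
  assumes "good es" "es \<noteq> []" "v < V" "set x \<subseteq> A"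
  defines "\<tau> \<equiv> snd (snd (hd es)) ! v"
  shows "length (keys v es) = Suc (length (next_path v es))"
    and "j < length (keys v es) \<Longrightarrow> keys v es ! j = (i, d) \<Longrightarrow>
      eqv (x @ [\<tau>] @ map fst (take j (next_path v es))) (x @ map fst (take i es) @ d) \<and>
      child v (config_at es i) d (config_at (next_path v es) j)"
proof -
  obtain l q L es' where es: "es = (l, q, L) # es'" using assms(2) by (metis neq_Nil_conv prod_cases3)
  note g = good_ConsD[of l q L es' v]
  have L: "length L = V" "\<tau> \<in> A" using g assms es by (auto simp: \<tau>_def)
  have "list_all2 (located v (\<lambda>j. positions None x es ! j)) ((0, [\<tau>]) # keys_from v 0 es)
      (positions None (x @ [\<tau>]) (refine v \<tau> L es))"
    using assms(1-4) L by (intro refine_located) (auto simp: es \<tau>_def intro!: eqv_refl)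
  then have *: "list_all2 (located v (\<lambda>j. positions None x es ! j)) (keys v es)
      (positions None (x @ [\<tau>]) (next_path v es))"
    by (simp add: keys_def next_path_def es \<tau>_def)
  then show len: "length (keys v es) = Suc (length (next_path v es))"
    by (auto dest: list_all2_lengthD)
  assume j: "j < length (keys v es)" "keys v es ! j = (i, d)"
  then have "located v (\<lambda>j. positions None x es ! j) (i, d) (positions None (x @ [\<tau>]) (next_path v es) ! j)"
    using list_all2_nthD[OF *, of j] by simp
  then show "eqv (x @ [\<tau>] @ map fst (take j (next_path v es))) (x @ map fst (take i es) @ d) \<and>
      child v (config_at es i) d (config_at (next_path v es) j)"
    using positions_nth[of j "next_path v es" "x @ [\<tau>]"] positions_nth[of i es x] keys_fst[OF j] j len
    by (simp add: located_def)
qed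

lemma config_at_wf:
  assumes "good es" "i \<le> length es"
  shows "wf_config (config_at es i)"
proof -
  have edge: "wf_edge e \<and> compatible e e" if "e \<in> set es" for e
    using assms(1) that by (simp add: good_def)
  have pair: "compatible (es ! j) (es ! Suc j) \<and> compatible (es ! Suc j) (es ! j)" if "Suc j < length es" for j
  proof -
    have "adj (es ! j) (es ! Suc j)"
      using assms(1) that by (auto simp: good_def successively_conv_nth)
    moreover have "compatible (es ! j) (es ! j)" "compatible (es ! Suc j) (es ! Suc j)"
      using edge that by auto
    ultimately show ?thesis
      by (cases "es ! j"; cases "es ! Suc j") (auto simp: adj_def compatible_def)
  qed
  show ?thesis
  proof (cases i)
    case 0
    then show ?thesis using edge by (auto simp: wf_config_def sides_def config_at_def)
  next
    case (Suc j)
    then show ?thesis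
      using edge[of "es ! j"] edge[of "es ! i"] pair[of j] assms(2)
      by (auto simp: wf_config_def sides_def config_at_def)
  qed
qed

text \<open>A far side costs at most 2M - 3 edges and one change of list. A polygon between far
  sides costs at most 2M - 2 edges and one change, and is charged to the change of list in the old
  path that forced it. Hence the factor 2M - 1.\<close>

lemma next_path_cost:
  assumes "good es" "es \<noteq> []" "v < V" "\<And>s t. s \<in> A \<Longrightarrow> t \<in> A \<Longrightarrow> s \<noteq> t \<Longrightarrow> mm s t \<le> M"
  shows "cost Q (next_path v es) \<le> (2 * M - 1) * cost Q' es"
proof -
  have main: "cost Q (refine v p P ((l, q, L) # es)) \<le> (2 * M - 2) + (2 * M - 1) * cost L es"
    if "good ((l, q, L) # es)" for Q p P l q L es
    using that
  proof (induction es arbitrary: Q p P l q L)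
    case Nil
    note g = good_ConsD[OF Nil assms(3)]
    have m: "3 \<le> mm l (L ! v)" "mm l (L ! v) \<le> M" using mm_ge assms(4) g by metis+
    obtain L1 where "refine v p P [(l, q, L)] = alt_edges l (L ! v) L1 (2 * mm l (L ! v) - 3)"
      by (auto simp: Let_def next_letter_def)
    then have "cost Q (refine v p P [(l, q, L)]) \<le> 2 * mm l (L ! v) - 2"
      using cost_alt_edges[of "2 * mm l (L ! v) - 3" Q l "L ! v" L1 "[]"] m by simp
    then show ?case using m by simp
  next
    case (Cons e' es)
    obtain l' q' L' where e': "e' = (l', q', L')" by (cases e') auto
    note gd = Cons.prems[unfolded e']
    note g = good_ConsD[OF gd assms(3)] and n = next_letter_Cons[OF gd assms(3)]
    have m: "3 \<le> mm l (L ! v)" "mm l (L ! v) \<le> M" using mm_ge assms(4) g by metis+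
    define R where "R P = refine v (L ! v) P ((l', q', L') # es)" for P
    have R: "cost Q (R P) \<le> (2 * M - 2) + (2 * M - 1) * cost L' es" for Q P
      unfolding R_def by (rule Cons.IH[OF g(13)])
    show ?case
    proof (cases "L' ! v = L ! v")
      case True
      then have "L' = L" using n(2) by blast
      obtain L1 where "refine v p P ((l, q, L) # (l', q', L') # es) =
          alt_edges l (L ! v) L1 (2 * mm l (L ! v) - 3) @ R L1"
        using True n(1) unfolding R_def by (auto simp: Let_def)
      then have "cost Q (refine v p P ((l, q, L) # (l', q', L') # es)) \<le> 2 * mm l (L ! v) - 2 + cost L1 (R L1)"
        using cost_alt_edges[of "2 * mm l (L ! v) - 3" Q l "L ! v" L1 "R L1"] m by simp
      also have "\<dots> \<le> 2 * M - 2 + ((2 * M - 2) + (2 * M - 1) * cost L' es)"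
        using m R[of L1 L1] by simp
      also have "\<dots> \<le> (2 * M - 2) + (2 * M - 1) * cost L ((l', q', L') # es)"
        using \<open>L' = L\<close> m by simp
      finally show ?thesis by (simp add: e')
    next
      case False
      then have "L' \<noteq> L" by auto
      have m': "3 \<le> mm (L ! v) (L' ! v)" "mm (L ! v) (L' ! v) \<le> M" using mm_ge assms(4) n False by metis+
      obtain L1 L2 where "refine v p P ((l, q, L) # (l', q', L') # es) =
          alt_edges l (L ! v) L1 (2 * mm l (L ! v) - 3) @
          alt_edges (L' ! v) (L ! v) L2 (2 * mm (L ! v) (L' ! v) - 2) @ R L2"
        using False n(1) unfolding R_def by (auto simp: Let_def)
      moreover define X where "X = alt_edges (L' ! v) (L ! v) L2 (2 * mm (L ! v) (L' ! v) - 2) @ R L2"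
      moreover have "cost Q (alt_edges l (L ! v) L1 (2 * mm l (L ! v) - 3) @ X) \<le> 2 * mm l (L ! v) - 2 + cost L1 X"
        using cost_alt_edges[of "2 * mm l (L ! v) - 3" Q l "L ! v" L1 X] m by simp
      moreover have "cost L1 X \<le> 2 * mm (L ! v) (L' ! v) - 1 + cost L2 (R L2)"
        unfolding X_def
        using cost_alt_edges[of "2 * mm (L ! v) (L' ! v) - 2" L1 "L' ! v" "L ! v" L2 "R L2"] m' by simp
      ultimately have "cost Q (refine v p P ((l, q, L) # (l', q', L') # es))
          \<le> 2 * mm l (L ! v) - 2 + (2 * mm (L ! v) (L' ! v) - 1 + cost L2 (R L2))"
        by simp
      also have "\<dots> \<le> 2 * M - 2 + (2 * M - 1 + ((2 * M - 2) + (2 * M - 1) * cost L' es))"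
        using m m' R[of L2 L2] by simp
      also have "\<dots> \<le> (2 * M - 2) + (2 * M - 1) * cost L ((l', q', L') # es)"
        using \<open>L' \<noteq> L\<close> m by simp
      finally show ?thesis by (simp add: e')
    qed
  qed
  obtain l q L es' where es: "es = (l, q, L) # es'" using assms(2) by (metis neq_Nil_conv prod_cases3)
  have "cost Q (next_path v es) \<le> (2 * M - 2) + (2 * M - 1) * cost L es'"
    unfolding next_path_def es by (rule main) (use assms es in simp)
  also have "\<dots> \<le> (2 * M - 1) * (1 + cost L es')" by (simp add: distrib_left)
  also have "\<dots> \<le> (2 * M - 1) * cost Q' es" by (intro mult_left_mono) (auto simp: es)
  finally show ?thesis .
qed

section \<open>Following vertices through iterated refinements\<close>

lemma path_after_valid:
  assumes "good es" "es \<noteq> []" "set vs \<subseteq> {..<V}"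
  shows "good (path_after vs es)" "path_after vs es \<noteq> []"
proof -
  have "good (path_after vs es) \<and> path_after vs es \<noteq> []"
    using assms by (induction vs arbitrary: es) (auto simp: next_path_valid)
  then show "good (path_after vs es)" "path_after vs es \<noteq> []" by auto
qed

lemma path_after_length:
  assumes "good es" "es \<noteq> []" "set vs \<subseteq> {..<V}"
    "\<And>s t. s \<in> A \<Longrightarrow> t \<in> A \<Longrightarrow> s \<noteq> t \<Longrightarrow> mm s t \<le> M"
  shows "length (path_after vs es) \<le> (2 * M - 1) ^ length vs * (2 * length es)"
proof -
  have "cost Q (path_after vs es) \<le> (2 * M - 1) ^ length vs * cost Q es" for Q
    using assms(1-3)
  proof (induction vs arbitrary: es)
    case (Cons v vs)
    have "cost Q (path_after vs (next_path v es)) \<le> (2 * M - 1) ^ length vs * cost Q (next_path v es)"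
      using Cons.prems next_path_valid[of es v] by (intro Cons.IH) auto
    also have "\<dots> \<le> (2 * M - 1) ^ length vs * ((2 * M - 1) * cost Q es)"
      using Cons.prems by (intro mult_left_mono next_path_cost assms(4)) auto
    finally show ?case by (simp add: mult_ac)
  qed simp
  from this[of "[]"] have "length (path_after vs es) \<le> (2 * M - 1) ^ length vs * cost [] es"
    using cost_bounds(1)[of "path_after vs es" "[]"] by linarith
  also have "\<dots> \<le> (2 * M - 1) ^ length vs * (2 * length es)"
    by (intro mult_left_mono cost_bounds(2)) simp
  finally show ?thesis .
qed

lemma chain_exists:
  assumes "good es" "es \<noteq> []" "set vs \<subseteq> {..<V}" "k \<le> length (path_after vs es)"
  shows "\<exists>i\<le>length es. \<exists>r. chain vs es i r k"
  using assms
proof (induction vs arbitrary: es)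
  case (Cons v vs)
  have v: "v < V" "set vs \<subseteq> {..<V}" using Cons.prems by auto
  obtain j r where j: "j \<le> length (next_path v es)" "chain vs (next_path v es) j r k"
    using Cons.IH[of "next_path v es"] Cons.prems v next_path_valid[of es v] by auto
  obtain i d where id: "keys v es ! j = (i, d)" by fastforce
  have "j < length (keys v es)"
    using keys_located(1)[OF Cons.prems(1,2) v(1), of "[]"] j by simp
  then show ?case using id j keys_fst by fastforce
qed simp

lemma child_letters: "child v C d C' \<Longrightarrow> wf_config C \<Longrightarrow> v < V \<Longrightarrow> set d \<subseteq> A"
proof -
  assume a: "child v C d C'" "wf_config C" "v < V"
  then obtain \<tau> where \<tau>: "\<tau> \<in> letters v C"
    and "d = [\<tau>] \<or> (\<exists>x n. d = alt \<tau> x n \<and> ((\<exists>q L. (x, q, L) \<in> sides C) \<or> x \<in> letters v C))"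
    unfolding child_def by blast
  then have "d = [\<tau>] \<or> (\<exists>x n. d = alt \<tau> x n \<and> x \<in> A)"
    using a letters_in_A wf_configD(1) by blast
  then show ?thesis using \<tau> letters_in_A[OF a(2,3)] set_alt by fastforce
qed

lemma chain_word:
  assumes "good es" "es \<noteq> []" "set vs \<subseteq> {..<V}" "set x \<subseteq> A" "chain vs es i r k"
  shows "set r \<subseteq> A"
    and "eqv (start_after vs x es @ map fst (take k (path_after vs es))) (x @ map fst (take i es) @ r)"
proof -
  have "set r \<subseteq> A \<and> eqv (start_after vs x es @ map fst (take k (path_after vs es))) (x @ map fst (take i es) @ r)"
    using assms
  proof (induction vs arbitrary: es x i r)
    case Nil
    have "fst e \<in> A" if "e \<in> set es" for e
      using Nil that by (cases e) (auto simp: good_def wf_edge_def)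
    then have "set (map fst (take i es)) \<subseteq> A" by (auto dest: in_set_takeD)
    then have "set (x @ map fst (take i es)) \<subseteq> A" using Nil.prems(4) by simp
    then show ?case using Nil.prems(5) eqv_refl by simp
  next
    case (Cons v vs)
    have v: "v < V" "set vs \<subseteq> {..<V}" using Cons.prems by auto
    from Cons.prems(5) obtain j d r' where j: "j < length (keys v es)" "keys v es ! j = (i, d)"
      "r = d @ r'" "chain vs (next_path v es) j r' k" by auto
    let ?\<tau> = "snd (snd (hd es)) ! v"
    note loc = keys_located(2)[OF Cons.prems(1,2) v(1) Cons.prems(4) j(1,2)]
    obtain l q L es' where es: "es = (l, q, L) # es'" using Cons.prems(2) by (metis neq_Nil_conv prod_cases3)
    have "?\<tau> \<in> A"
      using good_ConsD(10)[OF Cons.prems(1)[unfolded es] v(1)] by (simp add: es)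
    then have IH: "set r' \<subseteq> A \<and> eqv (start_after vs (x @ [?\<tau>]) (next_path v es) @
        map fst (take k (path_after vs (next_path v es)))) ((x @ [?\<tau>]) @ map fst (take j (next_path v es)) @ r')"
      using Cons.prems j v next_path_valid[of es v] by (intro Cons.IH) auto
    have "eqv ((x @ [?\<tau>] @ map fst (take j (next_path v es))) @ r') ((x @ map fst (take i es) @ d) @ r')"
      by (rule eqv_append) (use IH loc in \<open>auto intro: eqv_refl\<close>)
    then have "eqv (start_after vs (x @ [?\<tau>]) (next_path v es) @
        map fst (take k (path_after vs (next_path v es)))) (x @ map fst (take i es) @ d @ r')"
      using eqv_trans[OF conjunct2[OF IH]] by simp
    moreover have "set d \<subseteq> A"
      using loc child_letters config_at_wf[OF Cons.prems(1) keys_fst[OF j(1,2)]] v by blast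
    ultimately show ?case using IH j(3) by simp
  qed
  then show "set r \<subseteq> A"
    and "eqv (start_after vs x es @ map fst (take k (path_after vs es))) (x @ map fst (take i es) @ r)"
    by auto
qed

text \<open>Tameness refers to the branch taken next. After the last refinement branch 0 stands in,
  since the constant function 1 is tame for every branch.\<close>

lemma chain_tame:
  assumes "good es" "es \<noteq> []" "set vs \<subseteq> {..<V}" "chain vs es i r k" "0 < V"
  shows "tame (hd (vs @ [0])) (config_at es i) (act r (\<lambda>_. 1))"
  using assms(1-4)
proof (induction vs arbitrary: es i r)
  case Nil
  have "0 \<le> (\<Sum>q\<in>downs C. 1 :: real)" for C :: "'a config" by (intro sum_nonneg) simp
  then show ?case using Nil by (auto simp: tame_def add_pos_nonneg)
next
  case (Cons v vs)
  have v: "v < V" "set vs \<subseteq> {..<V}" using Cons.prems by auto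
  from Cons.prems(4) obtain j d r' where j: "j < length (keys v es)" "keys v es ! j = (i, d)"
    "r = d @ r'" "chain vs (next_path v es) j r' k" by auto
  note n = next_path_valid[OF Cons.prems(1,2) v(1)]
  have IH: "tame (hd (vs @ [0])) (config_at (next_path v es) j) (act r' (\<lambda>_. 1))"
    using n v j by (intro Cons.IH)
  have "hd (vs @ [0]) < V" using v(2) assms(5) by (cases vs) auto
  moreover have "j \<le> length (next_path v es)"
    using keys_located(1)[OF Cons.prems(1,2) v(1), of "[]"] j by simp
  moreover have "child v (config_at es i) d (config_at (next_path v es) j)"
    using keys_located(2)[OF Cons.prems(1,2) v(1) _ j(1,2), of "[]"] by simp
  ultimately have "tame v (config_at es i) (act d (act r' (\<lambda>_. 1)))"
    using IH tame_parent config_at_wf Cons.prems(1) n(1) keys_fst[OF j(1,2)] v(1) by blast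
  then show ?case by (simp add: j(3) act_append)
qed

text \<open>\<open>child_determined\<close> peels off one refinement at a time. As keys are
  distinct, old vertex and word fix the next vertex, and the induction continues from there with
  equal vectors.\<close>

lemma chain_determines_branch:
  assumes "good es" "es \<noteq> []" "set vs \<subseteq> {..<V}" "set vs' \<subseteq> {..<V}" "length vs = length vs'" "0 < V"
    and "chain vs es i r k" "chain vs' es i r' k'" "act r (\<lambda>_. 1) = act r' (\<lambda>_. 1)"
  shows "vs = vs'"
  using assms(1-5,7-)
proof (induction vs arbitrary: es vs' i r r')
  case Nil
  then have "length vs' = 0" by (metis list.size(3))
  then show ?case by blast
next
  case (Cons v vs)
  from Cons.prems(5) obtain w ws where vs': "vs' = w # ws" by (cases vs') auto
  have v: "v < V" "set vs \<subseteq> {..<V}" "w < V" "set ws \<subseteq> {..<V}" using Cons.prems vs' by auto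
  from Cons.prems(6) obtain j d s where j: "j < length (keys v es)" "keys v es ! j = (i, d)"
    "r = d @ s" "chain vs (next_path v es) j s k" by auto
  from Cons.prems(7) obtain j' d' s' where j': "j' < length (keys w es)" "keys w es ! j' = (i, d')"
    "r' = d' @ s'" "chain ws (next_path w es) j' s' k'" by (auto simp: vs')
  note n = next_path_valid[OF Cons.prems(1,2) v(1)] and n' = next_path_valid[OF Cons.prems(1,2) v(3)]
  have len: "j \<le> length (next_path v es)" "j' \<le> length (next_path w es)"
    using keys_located(1)[OF Cons.prems(1,2) v(1), of "[]"] keys_located(1)[OF Cons.prems(1,2) v(3), of "[]"]
      j j' by auto
  have c: "child v (config_at es i) d (config_at (next_path v es) j)"
    "child w (config_at es i) d' (config_at (next_path w es) j')"
    using keys_located(2)[OF Cons.prems(1,2) v(1) _ j(1,2), of "[]"]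
      keys_located(2)[OF Cons.prems(1,2) v(3) _ j'(1,2), of "[]"] by simp_all
  have "hd (us @ [0]) < V" if "set us \<subseteq> {..<V}" for us
    using that assms(6) by (cases us) auto
  then have h: "hd (vs @ [0]) < V" "hd (ws @ [0]) < V" using v by blast+
  note det = child_determined[OF c(1) config_at_wf[OF n(1) len(1)] v(1) h(1) chain_tame[OF n v(2) j(4) assms(6)]
      c(2) config_at_wf[OF n'(1) len(2)] v(3) h(2) chain_tame[OF n' v(4) j'(4) assms(6)]
      config_at_wf[OF Cons.prems(1) keys_fst[OF j(1,2)]]]
  have "act d (act s (\<lambda>_. 1)) = act d' (act s' (\<lambda>_. 1))"
    using Cons.prems(8) by (simp add: j(3) j'(3) act_append)
  note det = det[OF this]
  have "j = j'"
  proof -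
    have "j' < length (keys v es)" "keys v es ! j = keys v es ! j'" using j j' det(1,2) by auto
    then show ?thesis
      using nth_eq_iff_index_eq[OF keys_distinct[OF Cons.prems(1) v(1)] j(1)] by blast
  qed
  then have "vs = ws"
    using Cons.IH[OF n v(2,4), of j s s'] Cons.prems(5) j(4) j'(4) det(1,3) vs' by simp
  then show ?case using det(1) vs' by simp
qed

text \<open>The prefixes are recorded as chains too because the interior points of a ray must also
  determine their root vertex.\<close>

lemma straight_chain:
  assumes "good es" "es \<noteq> []" "set vs \<subseteq> {..<V}" "i \<le> length es"
  shows "\<exists>r k. chain vs es i r k \<and> length r = length vs \<and>
    (\<forall>j\<le>length vs. \<exists>k'. chain (take j vs) es i (take j r) k')"
  using assms
proof (induction vs arbitrary: es i)
  case Nil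
  then have "chain [] es i [] i" by simp
  then show ?case by (intro exI[of _ "[]"] exI[of _ i]) auto
next
  case (Cons v vs)
  have v: "v < V" "set vs \<subseteq> {..<V}" using Cons.prems by auto
  obtain \<tau> j where j: "j < length (keys v es)" "keys v es ! j = (i, [\<tau>])"
    using keys_single[OF Cons.prems(4,1) v(1)] by (metis in_set_conv_nth)
  note n = next_path_valid[OF Cons.prems(1,2) v(1)]
  have "j \<le> length (next_path v es)"
    using keys_located(1)[OF Cons.prems(1,2) v(1), of "[]"] j by simp
  from Cons.IH[OF n v(2) this] obtain r k where r: "chain vs (next_path v es) j r k" "length r = length vs"
    "\<And>j'. j' \<le> length vs \<Longrightarrow> \<exists>k'. chain (take j' vs) (next_path v es) j (take j' r) k'" by blast
  have "\<exists>k'. chain (take j' (v # vs)) es i (take j' (\<tau> # r)) k'" if "j' \<le> length (v # vs)" for j'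
  proof (cases j')
    case (Suc j'')
    then have "j'' \<le> length vs" using that by simp
    from r(3)[OF this] obtain k' where k': "chain (take j'' vs) (next_path v es) j (take j'' r) k'" by blast
    have "chain (take j' (v # vs)) es i (take j' (\<tau> # r)) k'"
      unfolding Suc take_Suc_Cons chain.simps
      by (rule exI[of _ j], rule exI[of _ "[\<tau>]"], rule exI[of _ "take j'' r"]) (use j k' in simp)
    then show ?thesis by blast
  next
    case 0
    have "chain (take j' (v # vs)) es i (take j' (\<tau> # r)) i"
      using Cons.prems(4) by (simp add: 0)
    then show ?thesis by blast
  qed
  moreover have "chain (v # vs) es i (\<tau> # r) k"
    unfolding chain.simps
    by (rule exI[of _ j], rule exI[of _ "[\<tau>]"], rule exI[of _ r]) (use j r(1) in simp)
  ultimately show ?case using r(2) by (intro exI[of _ "\<tau> # r"] exI[of _ k]) simp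
qed

end

section \<open>A Poincare inequality for trees of paths\<close>

lemma abs_gradient_nonneg:
  assumes "card e = 2"
  shows "0 \<le> abs_gradient f e"
  using assms by (auto simp: card_2_iff abs_gradient_pair)

text \<open>Jensen's inequality. Zero summands are removed first, as convexity of the power is taken
  on the open half-line.\<close>

lemma power_sum_le:
  fixes a :: "'b \<Rightarrow> real"
  assumes "finite F" "1 \<le> p" "\<And>x. x \<in> F \<Longrightarrow> 0 \<le> a x"
  shows "(\<Sum>x\<in>F. a x) powr p \<le> real (card F) powr (p - 1) * (\<Sum>x\<in>F. a x powr p)"
proof -
  define F' where "F' = {x \<in> F. 0 < a x}"
  have F': "finite F'" "F' \<subseteq> F" using assms(1) by (auto simp: F'_def)
  have s: "(\<Sum>x\<in>F. a x) = (\<Sum>x\<in>F'. a x)" "(\<Sum>x\<in>F. a x powr p) = (\<Sum>x\<in>F'. a x powr p)"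
    using assms F' by (auto simp: F'_def less_le intro!: sum.mono_neutral_right)
  show ?thesis
  proof (cases "F' = {}")
    case True
    then show ?thesis unfolding s by simp
  next
    case False
    define n where "n = real (card F')"
    have n: "0 < n" using False F' by (simp add: n_def card_gt_0_iff)
    have "convex_on {0<..} (\<lambda>x::real. x powr p)" using assms(2) by (rule powr_convex)
    moreover have "(\<Sum>x\<in>F'. 1 / n) = 1" using n by (simp add: n_def)
    moreover have "\<And>x. x \<in> F' \<Longrightarrow> a x \<in> {0<..}" by (simp add: F'_def)
    ultimately have "(\<Sum>x\<in>F'. (1 / n) * a x) powr p \<le> (\<Sum>x\<in>F'. (1 / n) * a x powr p)"
      using convex_on_sum[OF F'(1) False, of "{0<..}" "\<lambda>x. x powr p" "\<lambda>_. 1 / n" a] n by simp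
    then have "((\<Sum>x\<in>F'. a x) / n) powr p \<le> (\<Sum>x\<in>F'. a x powr p) / n"
      by (simp add: sum_divide_distrib)
    moreover have nn: "0 \<le> (\<Sum>x\<in>F'. a x)" by (intro sum_nonneg) (simp add: F'_def)
    ultimately have "(\<Sum>x\<in>F'. a x) powr p / n powr p \<le> (\<Sum>x\<in>F'. a x powr p) / n"
      using n by (simp add: powr_divide)
    then have "(\<Sum>x\<in>F'. a x) powr p \<le> (n powr p / n) * (\<Sum>x\<in>F'. a x powr p)"
      using n by (simp add: field_simps)
    also have "n powr p / n = n powr (p - 1)" using n by (simp add: powr_diff)
    also have "n powr (p - 1) * (\<Sum>x\<in>F'. a x powr p) \<le> real (card F) powr (p - 1) * (\<Sum>x\<in>F'. a x powr p)"
      using n F' assms card_mono[of F F'] unfolding n_def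
      by (intro mult_right_mono powr_mono2 sum_nonneg) auto
    finally show ?thesis unfolding s .
  qed
qed

definition joined :: "'v set set \<Rightarrow> 'v set \<Rightarrow> 'v \<Rightarrow> 'v \<Rightarrow> bool" where
  "joined E X u v \<longleftrightarrow> u \<in> X \<and> v \<in> X \<and> {u, v} \<in> E"

definition connected_on :: "'v set set \<Rightarrow> 'v set \<Rightarrow> bool" where
  "connected_on E X \<longleftrightarrow> (\<forall>u\<in>X. \<forall>v\<in>X. (joined E X)\<^sup>*\<^sup>* u v)"

text \<open>The triangle inequality along the path; without repeated vertices no edge is counted
  twice.\<close>

lemma path_difference_le:
  assumes "rtrancl_path (joined E X) x xs y" "distinct (x # xs)" "finite E" "\<And>e. e \<in> E \<Longrightarrow> card e = 2"
  shows "\<bar>f x - f y\<bar> \<le> (\<Sum>e\<in>{e \<in> E. e \<subseteq> set (x # xs)}. abs_gradient f e)"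
  using assms(1,2)
proof (induction rule: rtrancl_path.induct)
  case (base x)
  then show ?case using assms(4) by (auto intro!: sum_nonneg abs_gradient_nonneg)
next
  case (step x z ys y)
  let ?E = "\<lambda>xs. {e \<in> E. e \<subseteq> set xs}"
  have e: "{x, z} \<in> E" "{x, z} \<notin> ?E (z # ys)" using step by (auto simp: joined_def)
  have "\<bar>f x - f y\<bar> \<le> \<bar>f x - f z\<bar> + \<bar>f z - f y\<bar>" by simp
  also have "\<dots> \<le> abs_gradient f {x, z} + (\<Sum>e\<in>?E (z # ys). abs_gradient f e)"
    using step by (simp add: abs_gradient_pair)
  also have "\<dots> = (\<Sum>e\<in>insert {x, z} (?E (z # ys)). abs_gradient f e)"
    using e assms(3) by (subst sum.insert) auto
  also have "\<dots> \<le> (\<Sum>e\<in>?E (x # z # ys). abs_gradient f e)"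
    using e assms(3,4) by (intro sum_mono2) (auto intro!: abs_gradient_nonneg)
  finally show ?case .
qed

lemma connected_difference_le:
  assumes "connected_on E X" "finite E" "\<And>e. e \<in> E \<Longrightarrow> card e = 2" "u \<in> X" "v \<in> X"
  shows "\<bar>f u - f v\<bar> \<le> (\<Sum>e\<in>{e \<in> E. e \<subseteq> X}. abs_gradient f e)"
proof -
  have "(joined E X)\<^sup>*\<^sup>* u v" using assms by (simp add: connected_on_def)
  then obtain xs where xs: "rtrancl_path (joined E X) u xs v"
    by (auto simp: rtranclp_eq_rtrancl_path)
  then obtain ys where ys: "rtrancl_path (joined E X) u ys v" "distinct (u # ys)"
    by (rule rtrancl_path_distinct)
  have "set (u # ys) \<subseteq> X"
    using ys(1) assms(4)
  proof (induction rule: rtrancl_path.induct)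
    case (step x y ys z)
    then show ?case by (auto simp: joined_def)
  qed auto
  then have "(\<Sum>e\<in>{e \<in> E. e \<subseteq> set (u # ys)}. abs_gradient f e) \<le> (\<Sum>e\<in>{e \<in> E. e \<subseteq> X}. abs_gradient f e)"
    using assms(2,3) by (intro sum_mono2) (auto intro!: abs_gradient_nonneg)
  then show ?thesis using path_difference_le[OF ys assms(2,3), of f] by linarith
qed

lemma connected_difference_powr_le:
  assumes "connected_on E X" "finite E" "\<And>e. e \<in> E \<Longrightarrow> card e = 2" "u \<in> X" "v \<in> X" "1 \<le> p"
    and "real (card {e \<in> E. e \<subseteq> X}) \<le> K"
  shows "\<bar>f u - f v\<bar> powr p \<le> K powr (p - 1) * (\<Sum>e\<in>E. if e \<subseteq> X then abs_gradient f e powr p else 0)"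
proof -
  have "\<bar>f u - f v\<bar> powr p \<le> (\<Sum>e\<in>{e \<in> E. e \<subseteq> X}. abs_gradient f e) powr p"
    using connected_difference_le[OF assms(1-5), of f] assms(6) by (intro powr_mono2) auto
  also have "\<dots> \<le> real (card {e \<in> E. e \<subseteq> X}) powr (p - 1) * (\<Sum>e\<in>{e \<in> E. e \<subseteq> X}. abs_gradient f e powr p)"
    using assms by (intro power_sum_le) (auto intro!: abs_gradient_nonneg)
  also have "\<dots> \<le> K powr (p - 1) * (\<Sum>e\<in>{e \<in> E. e \<subseteq> X}. abs_gradient f e powr p)"
    using assms by (intro mult_right_mono powr_mono2 sum_nonneg) auto
  also have "(\<Sum>e\<in>{e \<in> E. e \<subseteq> X}. abs_gradient f e powr p) = (\<Sum>e\<in>E. if e \<subseteq> X then abs_gradient f e powr p else 0)"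
    using assms(2) by (simp add: sum.inter_filter)
  finally show ?thesis .
qed

text \<open>Double counting: after the sums are exchanged, each \<open>e\<close> occurs at most
  \<open>\<kappa>\<close> times for every index in \<open>I\<close>.\<close>

lemma sum_count_le:
  fixes h :: "'e \<Rightarrow> real" and n :: "'i \<Rightarrow> real"
  assumes "finite E" "finite I" "finite T" "\<And>e. e \<in> E \<Longrightarrow> 0 \<le> h e" "\<And>a. a \<in> I \<Longrightarrow> 0 \<le> n a" "0 \<le> \<kappa>"
    and "\<And>e a. e \<in> E \<Longrightarrow> a \<in> I \<Longrightarrow> real (card {t \<in> T. Q e a t}) \<le> \<kappa>"
  shows "(\<Sum>a\<in>I. n a * (\<Sum>t\<in>T. \<Sum>e\<in>E. if Q e a t then h e else 0)) \<le> \<kappa> * (\<Sum>a\<in>I. n a) * (\<Sum>e\<in>E. h e)"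
proof -
  have "(\<Sum>t\<in>T. \<Sum>e\<in>E. if Q e a t then h e else 0) \<le> \<kappa> * (\<Sum>e\<in>E. h e)" if "a \<in> I" for a
  proof -
    have "(\<Sum>t\<in>T. \<Sum>e\<in>E. if Q e a t then h e else 0) = (\<Sum>e\<in>E. \<Sum>t\<in>T. if Q e a t then h e else 0)"
      by (rule sum.swap)
    also have "\<dots> = (\<Sum>e\<in>E. real (card {t \<in> T. Q e a t}) * h e)"
    proof (rule sum.cong[OF HOL.refl])
      fix e
      have "(\<Sum>t\<in>T. if Q e a t then h e else 0) = (\<Sum>t\<in>{t \<in> T. Q e a t}. h e)"
        by (rule sum.inter_filter[OF assms(3), symmetric])
      then show "(\<Sum>t\<in>T. if Q e a t then h e else 0) = real (card {t \<in> T. Q e a t}) * h e" by simp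
    qed
    also have "\<dots> \<le> (\<Sum>e\<in>E. \<kappa> * h e)"
      using assms that by (intro sum_mono mult_right_mono) auto
    finally show ?thesis by (simp add: sum_distrib_left)
  qed
  then have "(\<Sum>a\<in>I. n a * (\<Sum>t\<in>T. \<Sum>e\<in>E. if Q e a t then h e else 0)) \<le> (\<Sum>a\<in>I. n a * (\<kappa> * (\<Sum>e\<in>E. h e)))"
    using assms by (intro sum_mono mult_left_mono) auto
  also have "\<dots> = \<kappa> * (\<Sum>a\<in>I. n a) * (\<Sum>e\<in>E. h e)"
    by (simp add: sum_distrib_right sum_distrib_left mult_ac)
  finally show ?thesis .
qed

text \<open>As \<open>f\<close> has mean zero, the cardinality of \<open>V\<close> times
  \<open>\<bar>c\<bar>\<close> is at most the sum of \<open>\<bar>f v - c\<bar>\<close>. The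
  constant \<open>c\<close> therefore costs no more than \<open>f - c\<close>, whence the factor 2
  on norms.\<close>

lemma centred_powr_le:
  fixes f :: "'v \<Rightarrow> real"
  assumes "finite V" "1 \<le> p" "(\<Sum>v\<in>V. f v) = 0"
  shows "(\<Sum>v\<in>V. \<bar>f v\<bar> powr p) \<le> 2 powr p * (\<Sum>v\<in>V. \<bar>f v - c\<bar> powr p)"
proof (cases "V = {}")
  case False
  define N where "N = real (card V)"
  have N: "0 < N" using False assms(1) by (simp add: N_def card_gt_0_iff)
  have "N * \<bar>c\<bar> = \<bar>\<Sum>v\<in>V. f v - c\<bar>" using assms(3) N by (simp add: sum_subtractf N_def abs_mult)
  also have "\<dots> \<le> (\<Sum>v\<in>V. \<bar>f v - c\<bar>)" by (rule sum_abs)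
  finally have "(N * \<bar>c\<bar>) powr p \<le> (\<Sum>v\<in>V. \<bar>f v - c\<bar>) powr p"
    using N assms(2) by (intro powr_mono2) auto
  also have "\<dots> \<le> N powr (p - 1) * (\<Sum>v\<in>V. \<bar>f v - c\<bar> powr p)"
    unfolding N_def using assms by (intro power_sum_le) auto
  finally have "N powr (p - 1) * (N * \<bar>c\<bar> powr p) \<le> N powr (p - 1) * (\<Sum>v\<in>V. \<bar>f v - c\<bar> powr p)"
    using N by (simp add: powr_mult powr_diff)
  then have c: "N * \<bar>c\<bar> powr p \<le> (\<Sum>v\<in>V. \<bar>f v - c\<bar> powr p)" using N by simp
  have two: "\<bar>f v\<bar> powr p \<le> 2 powr (p - 1) * (\<bar>f v - c\<bar> powr p + \<bar>c\<bar> powr p)" for v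
  proof -
    have "\<bar>f v\<bar> powr p \<le> (\<bar>f v - c\<bar> + \<bar>c\<bar>) powr p" using assms(2) by (intro powr_mono2) auto
    also have "\<dots> \<le> 2 powr (p - 1) * (\<bar>f v - c\<bar> powr p + \<bar>c\<bar> powr p)"
      using power_sum_le[of "{True, False}" p "\<lambda>b. if b then \<bar>f v - c\<bar> else \<bar>c\<bar>"] assms(2) by simp
    finally show ?thesis .
  qed
  have "(\<Sum>v\<in>V. \<bar>f v\<bar> powr p) \<le> (\<Sum>v\<in>V. 2 powr (p - 1) * (\<bar>f v - c\<bar> powr p + \<bar>c\<bar> powr p))"
    by (intro sum_mono two)
  also have "\<dots> = 2 powr (p - 1) * ((\<Sum>v\<in>V. \<bar>f v - c\<bar> powr p) + N * \<bar>c\<bar> powr p)"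
    by (simp add: sum_distrib_left[symmetric] sum.distrib N_def)
  also have "\<dots> \<le> 2 powr (p - 1) * (2 * (\<Sum>v\<in>V. \<bar>f v - c\<bar> powr p))"
    using c by (intro mult_left_mono) auto
  also have "\<dots> = 2 powr p * (\<Sum>v\<in>V. \<bar>f v - c\<bar> powr p)" by (simp add: powr_diff)
  finally show ?thesis .
qed simp

text \<open>A vertex is compared with the average of \<open>f\<close> over the roots \<open>r t\<close> in three steps: along a
  ray \<open>P a t\<close> into \<open>\<beta> a\<close>, inside \<open>\<beta> a\<close> to the average over the feet of the rays, and from
  there to the roots, averaged over all \<open>t\<close>.\<close>

lemma tree_of_paths_poincare:
  fixes f :: "'v \<Rightarrow> real" and \<beta> :: "'i \<Rightarrow> 'v set" and P :: "'i \<Rightarrow> 't \<Rightarrow> 'v set" and r :: "'t \<Rightarrow> 'v"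
    and L D \<kappa> p :: real
  assumes p: "1 \<le> p" and finE: "finite E" and E2: "\<And>e. e \<in> E \<Longrightarrow> card e = 2"
    and I: "finite I" and T: "finite T" "T \<noteq> {}"
    and \<beta>: "\<And>a. a \<in> I \<Longrightarrow> connected_on E (\<beta> a)" "\<And>a. a \<in> I \<Longrightarrow> finite (\<beta> a)"
      "\<And>a. a \<in> I \<Longrightarrow> real (card (\<beta> a)) \<le> L"
    and P: "\<And>a t. a \<in> I \<Longrightarrow> t \<in> T \<Longrightarrow> connected_on E (P a t)" "\<And>a t. a \<in> I \<Longrightarrow> t \<in> T \<Longrightarrow> finite (P a t)"
      "\<And>a t. a \<in> I \<Longrightarrow> t \<in> T \<Longrightarrow> real (card (P a t)) \<le> D"
      "\<And>a t. a \<in> I \<Longrightarrow> t \<in> T \<Longrightarrow> r t \<in> P a t" "\<And>a t. a \<in> I \<Longrightarrow> t \<in> T \<Longrightarrow> P a t \<inter> \<beta> a \<noteq> {}"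
    and V: "V = (\<Union>a\<in>I. \<beta> a) \<union> (\<Union>a\<in>I. \<Union>t\<in>T. P a t)"
    and \<kappa>: "1 \<le> \<kappa>" "\<And>X. X \<subseteq> V \<Longrightarrow> real (card {e \<in> E. e \<subseteq> X}) \<le> \<kappa> * real (card X)"
      "\<And>v. v \<in> V \<Longrightarrow> real (card {a \<in> I. v \<in> \<beta> a}) \<le> \<kappa>"
      "\<And>v. v \<in> V \<Longrightarrow> real (card {t \<in> T. \<exists>a\<in>I. v \<in> P a t}) \<le> \<kappa>"
    and EV: "\<And>e. e \<in> E \<Longrightarrow> e \<subseteq> V" and f0: "(\<Sum>v\<in>V. f v) = 0"
  shows "(\<Sum>v\<in>V. \<bar>f v\<bar> powr p) \<le> (6 * \<kappa>) powr p *
    (L powr (p - 1) * (L + card T * D) + D powr (p - 1) * card V / card T + D powr p * card I) *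
    (\<Sum>e\<in>E. abs_gradient f e powr p)"
proof -
  define w where "w = real (card T)"
  have w: "0 < w" using T by (simp add: w_def card_gt_0_iff)
  have finV: "finite V" unfolding V using I T \<beta>(2) P(2) by auto
  define g where "g e = abs_gradient f e powr p" for e
  define G where "G = (\<Sum>e\<in>E. g e)"
  have g0: "0 \<le> g e" for e by (simp add: g_def)
  define GX where "GX X = (\<Sum>e\<in>E. if e \<subseteq> X then g e else 0)" for X
  have GX0: "0 \<le> GX X" for X unfolding GX_def by (intro sum_nonneg) (simp add: g0)
  have G0: "0 \<le> G" unfolding G_def by (intro sum_nonneg g0)
  have "\<forall>a t. \<exists>q. a \<in> I \<longrightarrow> t \<in> T \<longrightarrow> q \<in> P a t \<inter> \<beta> a" using P(5) by blast
  then obtain q where q: "\<And>a t. a \<in> I \<Longrightarrow> t \<in> T \<Longrightarrow> q a t \<in> P a t \<inter> \<beta> a" by metis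
  define F where "F a = (\<Sum>t\<in>T. f (q a t)) / w" for a
  define c where "c = (\<Sum>t\<in>T. f (r t)) / w"
  have osc\<beta>: "\<bar>f u - f v\<bar> powr p \<le> (\<kappa> * L) powr (p - 1) * GX (\<beta> a)"
    if "a \<in> I" "u \<in> \<beta> a" "v \<in> \<beta> a" for a u v
  proof -
    have "real (card {e \<in> E. e \<subseteq> \<beta> a}) \<le> \<kappa> * card (\<beta> a)" using that V by (intro \<kappa>(2)) auto
    also have "\<dots> \<le> \<kappa> * L" using \<beta>(3)[OF that(1)] \<kappa>(1) by simp
    finally show ?thesis
      unfolding GX_def g_def using that p \<beta>(1) finE E2 by (intro connected_difference_powr_le) auto
  qed
  have oscP: "\<bar>f u - f v\<bar> powr p \<le> (\<kappa> * D) powr (p - 1) * GX (P a t)"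
    if "a \<in> I" "t \<in> T" "u \<in> P a t" "v \<in> P a t" for a t u v
  proof -
    have "real (card {e \<in> E. e \<subseteq> P a t}) \<le> \<kappa> * card (P a t)" using that V by (intro \<kappa>(2)) auto
    also have "\<dots> \<le> \<kappa> * D" using P(3)[OF that(1,2)] \<kappa>(1) by simp
    finally show ?thesis
      unfolding GX_def g_def using that p P(1) finE E2 by (intro connected_difference_powr_le) auto
  qed
  have avg: "\<bar>(\<Sum>t\<in>T. h t) / w\<bar> powr p \<le> (\<Sum>t\<in>T. \<bar>h t\<bar> powr p) / w" for h :: "'t \<Rightarrow> real"
  proof -
    have "\<bar>\<Sum>t\<in>T. h t\<bar> powr p \<le> (\<Sum>t\<in>T. \<bar>h t\<bar>) powr p" using p by (intro powr_mono2) auto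
    also have "\<dots> \<le> w powr (p - 1) * (\<Sum>t\<in>T. \<bar>h t\<bar> powr p)"
      unfolding w_def using T p by (intro power_sum_le) auto
    finally have "\<bar>\<Sum>t\<in>T. h t\<bar> powr p / w powr p \<le> w powr (p - 1) * (\<Sum>t\<in>T. \<bar>h t\<bar> powr p) / w powr p"
      using w by (intro divide_right_mono) auto
    then show ?thesis using w by (simp add: powr_divide powr_diff abs_divide)
  qed
  have A2: "\<bar>f u - F a\<bar> powr p \<le> (\<kappa> * L) powr (p - 1) * GX (\<beta> a)" if "a \<in> I" "u \<in> \<beta> a" for a u
  proof -
    have "f u - F a = (\<Sum>t\<in>T. f u - f (q a t)) / w"
      using w by (simp add: F_def sum_subtractf w_def diff_divide_distrib)
    then have "\<bar>f u - F a\<bar> powr p \<le> (\<Sum>t\<in>T. \<bar>f u - f (q a t)\<bar> powr p) / w" using avg by simp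
    also have "\<dots> \<le> (\<Sum>t\<in>T. (\<kappa> * L) powr (p - 1) * GX (\<beta> a)) / w"
      using w that q by (intro divide_right_mono sum_mono osc\<beta>) auto
    also have "\<dots> = (\<kappa> * L) powr (p - 1) * GX (\<beta> a)" using w by (simp add: w_def)
    finally show ?thesis .
  qed
  have A3: "\<bar>F a - c\<bar> powr p \<le> (\<kappa> * D) powr (p - 1) * (\<Sum>t\<in>T. GX (P a t)) / w" if "a \<in> I" for a
  proof -
    have "F a - c = (\<Sum>t\<in>T. f (q a t) - f (r t)) / w"
      by (simp add: F_def c_def sum_subtractf diff_divide_distrib)
    then have "\<bar>F a - c\<bar> powr p \<le> (\<Sum>t\<in>T. \<bar>f (q a t) - f (r t)\<bar> powr p) / w" using avg by simp
    also have "\<dots> \<le> (\<Sum>t\<in>T. (\<kappa> * D) powr (p - 1) * GX (P a t)) / w"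
      using w that q P(4) by (intro divide_right_mono sum_mono oscP) auto
    finally show ?thesis by (simp add: sum_distrib_left)
  qed
  \<comment> \<open>A vertex may lie in several pieces; it is charged to one index
    \<open>own v\<close> and, outside \<open>\<beta> (own v)\<close>, to the ray towards
    \<open>tow v\<close>.\<close>
  have "\<forall>v. \<exists>a t. v \<in> V \<longrightarrow> a \<in> I \<and> (v \<in> \<beta> a \<or> t \<in> T \<and> v \<in> P a t)" unfolding V by blast
  then obtain own tow where own: "\<And>v. v \<in> V \<Longrightarrow> own v \<in> I"
    "\<And>v. v \<in> V \<Longrightarrow> v \<in> \<beta> (own v) \<or> tow v \<in> T \<and> v \<in> P (own v) (tow v)" by metis
  define n where "n a = card {v \<in> V. own v = a}" for a
  define A1 where "A1 v = (if v \<in> \<beta> (own v) then 0 else (\<kappa> * D) powr (p - 1) * GX (P (own v) (tow v)))" for v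
  have sum_own: "(\<Sum>v\<in>V. h (own v)) = (\<Sum>a\<in>I. n a * h a)" for h :: "'i \<Rightarrow> real"
  proof -
    have "(\<Sum>v\<in>V. h (own v)) = (\<Sum>a\<in>I. \<Sum>v\<in>{v \<in> V. own v = a}. h (own v))"
      using finV I own(1) by (intro sum.group[symmetric]) auto
    then show ?thesis by (simp add: n_def)
  qed
  have n_sum: "(\<Sum>a\<in>I. real (n a)) = card V" using sum_own[of "\<lambda>_. 1"] by simp
  have three: "\<bar>f v - c\<bar> powr p \<le> 3 powr (p - 1) * (A1 v
      + (\<kappa> * L) powr (p - 1) * GX (\<beta> (own v)) + (\<kappa> * D) powr (p - 1) * (\<Sum>t\<in>T. GX (P (own v) t)) / w)"
    if v: "v \<in> V" for v
  proof -
    define u where "u = (if v \<in> \<beta> (own v) then v else q (own v) (tow v))"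
    have u: "u \<in> \<beta> (own v)" using own[OF v] q by (auto simp: u_def)
    have a1: "\<bar>f v - f u\<bar> powr p \<le> A1 v"
      using own[OF v] oscP q by (auto simp: u_def A1_def)
    have "\<bar>f v - c\<bar> powr p \<le> (\<Sum>i\<in>{0,1,2::nat}. [\<bar>f v - f u\<bar>, \<bar>f u - F (own v)\<bar>, \<bar>F (own v) - c\<bar>] ! i) powr p"
      using p by (intro powr_mono2) auto
    also have "\<dots> \<le> real (card {0,1,2::nat}) powr (p - 1) *
       (\<Sum>i\<in>{0,1,2::nat}. ([\<bar>f v - f u\<bar>, \<bar>f u - F (own v)\<bar>, \<bar>F (own v) - c\<bar>] ! i) powr p)"
      using p by (intro power_sum_le) auto
    also have "\<dots> = 3 powr (p - 1) * (\<bar>f v - f u\<bar> powr p + \<bar>f u - F (own v)\<bar> powr p + \<bar>F (own v) - c\<bar> powr p)"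
      by simp
    also have "\<dots> \<le> 3 powr (p - 1) * (A1 v
      + (\<kappa> * L) powr (p - 1) * GX (\<beta> (own v)) + (\<kappa> * D) powr (p - 1) * (\<Sum>t\<in>T. GX (P (own v) t)) / w)"
      using a1 A2[OF own(1)[OF v] u] A3[OF own(1)[OF v]] by (intro mult_left_mono add_mono) auto
    finally show ?thesis .
  qed
  \<comment> \<open>Nonnegativity of \<open>L\<close> and \<open>D\<close> comes only from the sets
    they bound; hence the recurring case \<open>I = {}\<close>, in which \<open>V\<close> is
    empty.\<close>
  have L0: "0 \<le> L" if "I \<noteq> {}" using \<beta>(3) that by (metis all_not_in_conv of_nat_0_le_iff order.trans)
  have D0: "0 \<le> D" if "I \<noteq> {}" using P(3) that T(2) by (metis all_not_in_conv of_nat_0_le_iff order.trans)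
  have edge_vertex: "\<exists>v\<in>V. v \<in> e" if "e \<in> E" for e
    using E2[OF that] EV[OF that] by (auto simp: card_2_iff)
  have c\<beta>: "real (card {a \<in> I. e \<subseteq> \<beta> a}) \<le> \<kappa>" if e: "e \<in> E" for e
  proof -
    obtain v where v: "v \<in> V" "v \<in> e" using edge_vertex[OF e] by blast
    have "card {a \<in> I. e \<subseteq> \<beta> a} \<le> card {a \<in> I. v \<in> \<beta> a}" using I v by (intro card_mono) auto
    then show ?thesis using \<kappa>(3)[OF v(1)] by linarith
  qed
  have cP: "real (card {t \<in> T. e \<subseteq> P a t}) \<le> \<kappa>" if e: "e \<in> E" "a \<in> I" for e a
  proof -
    obtain v where v: "v \<in> V" "v \<in> e" using edge_vertex[OF e(1)] by blast
    have "card {t \<in> T. e \<subseteq> P a t} \<le> card {t \<in> T. \<exists>a\<in>I. v \<in> P a t}"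
      using T v e by (intro card_mono) auto
    then show ?thesis using \<kappa>(4)[OF v(1)] by linarith
  qed
  \<comment> \<open>At most \<open>L + w * D\<close> vertices are charged to one index, and an edge
    lies in at most \<open>\<kappa>\<close> of the sets \<open>\<beta> a\<close>.\<close>
  have S2: "(\<Sum>v\<in>V. GX (\<beta> (own v))) \<le> (L + w * D) * (\<kappa> * G)"
  proof -
    have n_le: "real (n a) \<le> L + w * D" if "a \<in> I" for a
    proof -
      have "v \<in> \<beta> a \<union> (\<Union>t\<in>T. P a t)" if "v \<in> V" "own v = a" for v
        using own(2)[OF that(1)] that(2) by blast
      then have "{v \<in> V. own v = a} \<subseteq> \<beta> a \<union> (\<Union>t\<in>T. P a t)" by blast
      moreover have "finite (\<beta> a \<union> (\<Union>t\<in>T. P a t))" using that T \<beta>(2) P(2) by blast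
      ultimately have "n a \<le> card (\<beta> a \<union> (\<Union>t\<in>T. P a t))"
        unfolding n_def by (intro card_mono)
      also have "\<dots> \<le> card (\<beta> a) + (\<Sum>t\<in>T. card (P a t))"
        by (intro order.trans[OF card_Un_le] add_left_mono card_UN_le T(1))
      finally have "real (n a) \<le> real (card (\<beta> a)) + (\<Sum>t\<in>T. real (card (P a t)))"
        using of_nat_mono[where ?'a = real] by fastforce
      also have "\<dots> \<le> L + (\<Sum>t\<in>T. D)"
        using that \<beta>(3) P(3) by (intro add_mono sum_mono) auto
      finally show ?thesis by (simp add: w_def)
    qed
    have "(\<Sum>v\<in>V. GX (\<beta> (own v))) = (\<Sum>a\<in>I. n a * GX (\<beta> a))" by (rule sum_own)
    also have "\<dots> \<le> (\<Sum>a\<in>I. (L + w * D) * GX (\<beta> a))"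
      using n_le GX0 by (intro sum_mono mult_right_mono) auto
    also have "\<dots> = (L + w * D) * (\<Sum>a\<in>I. GX (\<beta> a))" by (simp add: sum_distrib_left)
    also have "\<dots> \<le> (L + w * D) * (\<kappa> * G)"
    proof (cases "I = {}")
      case False
      have "(\<Sum>a\<in>I. GX (\<beta> a)) \<le> \<kappa> * G"
        using sum_count_le[where E = E and I = "{()}" and T = I and h = g and n = "\<lambda>_. 1" and \<kappa> = \<kappa>
            and Q = "\<lambda>e _ a. e \<subseteq> \<beta> a"] finE I g0 \<kappa>(1) c\<beta>
        by (simp add: GX_def G_def)
      moreover have "0 \<le> L + w * D" using L0 D0 False w by simp
      ultimately show ?thesis by (intro mult_left_mono)
    next
      case True
      then have "V = {}" by (simp add: V)
      then have "E = {}" using edge_vertex by blast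
      then show ?thesis using True by (simp add: G_def)
    qed
    finally show ?thesis .
  qed
  \<comment> \<open>For a fixed index an edge lies in at most \<open>\<kappa>\<close> rays, whatever
    the size of \<open>T\<close>. Dividing by \<open>w\<close> afterwards is the gain from averaging
    over the roots.\<close>
  have S3: "(\<Sum>v\<in>V. \<Sum>t\<in>T. GX (P (own v) t)) \<le> \<kappa> * card V * G"
  proof -
    have "(\<Sum>v\<in>V. \<Sum>t\<in>T. GX (P (own v) t)) = (\<Sum>a\<in>I. n a * (\<Sum>t\<in>T. GX (P a t)))" by (rule sum_own)
    also have "\<dots> \<le> \<kappa> * (\<Sum>a\<in>I. real (n a)) * G"
      unfolding GX_def G_def using finE I T(1) g0 \<kappa>(1) cP by (intro sum_count_le) auto
    finally show ?thesis by (simp add: n_sum)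
  qed
  \<comment> \<open>At most \<open>D\<close> vertices are charged to one ray, which with the
    oscillation bound gives the power \<open>D powr p\<close>.\<close>
  have S1: "(\<Sum>v\<in>V. A1 v) \<le> (\<kappa> * D) powr (p - 1) * (D * (\<kappa> * card I * G))"
  proof (cases "I = {}")
    case False
    have "(\<Sum>v\<in>V. A1 v) \<le> (\<Sum>v\<in>{v \<in> V. v \<notin> \<beta> (own v)}. (\<kappa> * D) powr (p - 1) * GX (P (own v) (tow v)))"
      using finV by (simp add: A1_def sum.inter_filter if_distrib[where f = Not] cong: if_cong)
        (intro sum_mono, simp)
    also have "\<dots> = (\<Sum>x\<in>I \<times> T. \<Sum>v\<in>{v \<in> {v \<in> V. v \<notin> \<beta> (own v)}. (own v, tow v) = x}.
        (\<kappa> * D) powr (p - 1) * GX (P (own v) (tow v)))"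
      using finV I T own by (intro sum.group[symmetric]) auto
    also have "\<dots> \<le> (\<Sum>x\<in>I \<times> T. D * ((\<kappa> * D) powr (p - 1) * GX (P (fst x) (snd x))))"
    proof (intro sum_mono)
      fix x assume x: "x \<in> I \<times> T"
      let ?B = "{v \<in> {v \<in> V. v \<notin> \<beta> (own v)}. (own v, tow v) = x}"
      have "?B \<subseteq> P (fst x) (snd x)" using own(2) by fastforce
      then have "card ?B \<le> card (P (fst x) (snd x))" using x P(2) by (intro card_mono) auto
      then have "real (card ?B) \<le> D" using x P(3)[of "fst x" "snd x"] by (auto intro: order.trans)
      moreover have "(\<Sum>v\<in>?B. (\<kappa> * D) powr (p - 1) * GX (P (own v) (tow v)))
          = card ?B * ((\<kappa> * D) powr (p - 1) * GX (P (fst x) (snd x)))"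
        by (subst sum_constant[symmetric]) (rule sum.cong, auto)
      ultimately show "(\<Sum>v\<in>?B. (\<kappa> * D) powr (p - 1) * GX (P (own v) (tow v)))
          \<le> D * ((\<kappa> * D) powr (p - 1) * GX (P (fst x) (snd x)))"
        using GX0 by (simp add: mult_right_mono)
    qed
    also have "\<dots> = (\<kappa> * D) powr (p - 1) * (D * (\<Sum>a\<in>I. 1 * (\<Sum>t\<in>T. GX (P a t))))"
      by (simp add: sum.cartesian_product sum_distrib_left mult_ac split_def)
    also have "\<dots> \<le> (\<kappa> * D) powr (p - 1) * (D * (\<kappa> * (\<Sum>a\<in>I. 1) * G))"
      unfolding GX_def G_def using finE I T(1) g0 \<kappa>(1) cP D0[OF False]
      by (intro mult_left_mono sum_count_le) auto
    finally show ?thesis by simp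
  next
    case True
    then show ?thesis by (simp add: V)
  qed
  have split: "(\<kappa> * x) powr (p - 1) * \<kappa> = \<kappa> powr p * x powr (p - 1)" if "0 \<le> x" for x
    using that \<kappa>(1) by (simp add: powr_mult powr_diff)
  have Dp: "D powr (p - 1) * D = D powr p" if "0 \<le> D"
    using that by (cases "D = 0") (simp_all add: powr_diff)
  have "(\<Sum>v\<in>V. \<bar>f v - c\<bar> powr p) \<le> (\<Sum>v\<in>V. 3 powr (p - 1) * (A1 v
      + (\<kappa> * L) powr (p - 1) * GX (\<beta> (own v)) + (\<kappa> * D) powr (p - 1) * (\<Sum>t\<in>T. GX (P (own v) t)) / w))"
    by (intro sum_mono three)
  also have "\<dots> = 3 powr (p - 1) * ((\<Sum>v\<in>V. A1 v) + (\<kappa> * L) powr (p - 1) * (\<Sum>v\<in>V. GX (\<beta> (own v)))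
      + (\<kappa> * D) powr (p - 1) / w * (\<Sum>v\<in>V. \<Sum>t\<in>T. GX (P (own v) t)))"
    by (simp add: sum_distrib_left[symmetric] sum.distrib sum_divide_distrib[symmetric])
  also have "\<dots> \<le> 3 powr (p - 1) * ((\<kappa> * D) powr (p - 1) * (D * (\<kappa> * card I * G))
      + (\<kappa> * L) powr (p - 1) * ((L + w * D) * (\<kappa> * G)) + (\<kappa> * D) powr (p - 1) / w * (\<kappa> * card V * G))"
    using S1 S2 S3 w by (intro mult_left_mono add_mono) auto
  also have "\<dots> = 3 powr (p - 1) * (\<kappa> powr p *
    (L powr (p - 1) * (L + w * D) + D powr (p - 1) * card V / w + D powr p * card I) * G)"
  proof (cases "I = {}")
    case False
    have e1: "(\<kappa> * D) powr (p - 1) * (D * (\<kappa> * card I * G)) = \<kappa> powr p * (D powr p * card I) * G"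
      using split[OF D0[OF False]] Dp[OF D0[OF False]] by (metis (no_types, lifting) mult.assoc mult.left_commute)
    have e2: "(\<kappa> * L) powr (p - 1) * ((L + w * D) * (\<kappa> * G)) = \<kappa> powr p * (L powr (p - 1) * (L + w * D)) * G"
      using split[OF L0[OF False]] by (metis (no_types, lifting) mult.assoc mult.left_commute)
    have e3: "(\<kappa> * D) powr (p - 1) / w * (\<kappa> * card V * G) = \<kappa> powr p * (D powr (p - 1) * card V / w) * G"
      using split[OF D0[OF False]] by (simp add: mult_ac)
    show ?thesis unfolding e1 e2 e3 by (simp add: distrib_left distrib_right mult_ac add_ac)
  next
    case True
    then have "V = {}" by (simp add: V)
    then have "E = {}" using edge_vertex by blast
    then show ?thesis by (simp add: G_def)
  qed
  also have "\<dots> \<le> 3 powr p * (\<kappa> powr p *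
    (L powr (p - 1) * (L + w * D) + D powr (p - 1) * card V / w + D powr p * card I) * G)"
  proof (cases "I = {}")
    case False
    then show ?thesis
      using L0 D0 G0 w p by (intro mult_right_mono mult_nonneg_nonneg add_nonneg_nonneg powr_mono) auto
  next
    case True
    then have "V = {}" by (simp add: V)
    then have "E = {}" using edge_vertex by blast
    then show ?thesis by (simp add: G_def)
  qed
  finally have "(\<Sum>v\<in>V. \<bar>f v - c\<bar> powr p) \<le> 3 powr p * (\<kappa> powr p *
    (L powr (p - 1) * (L + w * D) + D powr (p - 1) * card V / w + D powr p * card I) * G)" .
  then have two: "2 powr p * (\<Sum>v\<in>V. \<bar>f v - c\<bar> powr p) \<le> 2 powr p * (3 powr p * (\<kappa> powr p *
    (L powr (p - 1) * (L + w * D) + D powr (p - 1) * card V / w + D powr p * card I) * G))"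
    by (intro mult_left_mono) auto
  \<comment> \<open>The factor 2 comes from recentring at the root average \<open>c\<close>, the
    factor 3 from splitting into three differences.\<close>
  have six: "(6 * \<kappa>) powr p = 2 powr p * (3 powr p * \<kappa> powr p)"
    using \<kappa>(1) powr_mult[of 2 3 p] by (simp add: powr_mult)
  show ?thesis
    using order.trans[OF centred_powr_le[OF finV p f0, of c] two]
    unfolding six G_def g_def w_def by (simp only: mult.assoc)
qed

section \<open>Poincare profiles and Cayley graphs\<close>

lemma poincare_const_ge:
  assumes "1 \<le> p" "finite (verts Y)" "simple_graph Y" "2 \<le> card (verts Y)" "0 < B"
    and "\<And>f. (\<Sum>v\<in>verts Y. f v) = 0 \<Longrightarrow>
      (\<Sum>v\<in>verts Y. \<bar>f v\<bar> powr p) \<le> B * (\<Sum>e\<in>edges Y. abs_gradient f e powr p)"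
  shows "(1 / B) powr (1 / p) \<le> poincare_const (ereal p) Y"
proof -
  have E: "card e = 2" if "e \<in> edges Y" for e
    using that assms(3) by (auto simp: simple_graph_def all_pairs_def)
  define R where "R = {lp_norm (ereal p) (edges Y) (abs_gradient f) / lp_norm (ereal p) (verts Y) f | f.
                 (\<Sum>v\<in>verts Y. f v) = 0 \<and> (\<exists>v\<in>verts Y. f v \<noteq> 0)}"
  have "(1 / B) powr (1 / p) \<le> x" if x: "x \<in> R" for x
  proof -
    obtain f where f: "(\<Sum>v\<in>verts Y. f v) = 0" "\<exists>v\<in>verts Y. f v \<noteq> 0"
      "x = lp_norm (ereal p) (edges Y) (abs_gradient f) / lp_norm (ereal p) (verts Y) f"
      using x by (auto simp: R_def)
    define F where "F = (\<Sum>v\<in>verts Y. \<bar>f v\<bar> powr p)"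
    define G where "G = (\<Sum>e\<in>edges Y. abs_gradient f e powr p)"
    have "0 < F"
      unfolding F_def using f(2) assms(2) by (auto intro!: sum_pos2)
    have "F \<le> B * G" unfolding F_def G_def by (rule assms(6)[OF f(1)])
    have "\<bar>abs_gradient f e\<bar> = abs_gradient f e" if "e \<in> edges Y" for e
      using abs_gradient_nonneg[OF E[OF that], of f] by simp
    then have "x = G powr (1 / p) / F powr (1 / p)"
      unfolding f(3) by (simp add: lp_norm_def F_def G_def)
    also have "\<dots> = (G / F) powr (1 / p)"
      using \<open>0 < F\<close> by (simp add: powr_divide G_def sum_nonneg)
    finally have x: "x = (G / F) powr (1 / p)" .
    have "1 / B \<le> G / F" using \<open>0 < F\<close> \<open>F \<le> B * G\<close> assms(5) by (simp add: field_simps)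
    then show ?thesis unfolding x using assms(1,5) by (intro powr_mono2) auto
  qed
  \<comment> \<open>\<open>cInf_greatest\<close> requires an admissible test function; the values 1
    and -1 at two vertices provide one.\<close>
  moreover have "R \<noteq> {}"
  proof -
    obtain u v where uv: "u \<in> verts Y" "v \<in> verts Y" "u \<noteq> v"
      using assms(4) by (metis card_2_iff' ex_card subsetD)
    define f where "f x = (if x = u then 1 else if x = v then -1 else 0 :: real)" for x
    have "(\<Sum>x\<in>verts Y. f x) = (\<Sum>x\<in>{u, v}. f x)"
      using uv assms(2) by (intro sum.mono_neutral_right) (auto simp: f_def)
    also have "\<dots> = 0" using uv by (simp add: f_def)
    finally have "(\<Sum>x\<in>verts Y. f x) = 0" .
    moreover have "f u \<noteq> 0" by (simp add: f_def)
    ultimately show ?thesis using uv(1) unfolding R_def by blast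
  qed
  ultimately have "(1 / B) powr (1 / p) \<le> Inf R" by (intro cInf_greatest)
  then show ?thesis using assms(4) by (simp add: poincare_const_def R_def)
qed

text \<open>A crude bound in terms of the number of vertices alone. It makes the supremum in
  \<open>poincare_profile\<close> bounded above, so that \<open>cSup_upper\<close> applies. The test
  function is 1 and -1 at two vertices.\<close>

lemma poincare_const_le:
  assumes "1 \<le> p" "finite (verts Y)" "simple_graph Y"
  shows "poincare_const (ereal p) Y \<le> 2 * 2 ^ (2 ^ card (verts Y))"
proof (cases "card (verts Y) \<le> 1")
  case False
  have EP: "edges Y \<subseteq> Pow (verts Y)"
    using assms(3) by (auto simp: simple_graph_def all_pairs_def)
  have finE: "finite (edges Y)" using EP assms(2) finite_subset by blast
  have E: "\<exists>a b. e = {a, b}" if "e \<in> edges Y" for e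
  proof -
    have "card e = 2" using that assms(3) by (auto simp: simple_graph_def all_pairs_def)
    then show ?thesis by (auto simp: card_2_iff)
  qed
  obtain u v where uv: "u \<in> verts Y" "v \<in> verts Y" "u \<noteq> v"
  proof -
    have "2 \<le> card (verts Y)" using False by simp
    then show thesis using that by (metis card_2_iff' ex_card subsetD)
  qed
  define f where "f x = (if x = u then 1 else if x = v then -1 else 0 :: real)" for x
  have s: "(\<Sum>x\<in>verts Y. f x) = 0"
  proof -
    have "(\<Sum>x\<in>verts Y. f x) = (\<Sum>x\<in>{u, v}. f x)"
      using uv assms(2) by (intro sum.mono_neutral_right) (auto simp: f_def)
    then show ?thesis using uv by (simp add: f_def)
  qed
  have "1 \<le> (\<Sum>x\<in>verts Y. \<bar>f x\<bar> powr p)"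
  proof -
    have "\<bar>f u\<bar> powr p \<le> (\<Sum>x\<in>verts Y. \<bar>f x\<bar> powr p)"
      using uv assms(2) by (intro member_le_sum) auto
    then show ?thesis by (simp add: f_def)
  qed
  then have den: "1 \<le> lp_norm (ereal p) (verts Y) f"
    using assms(1) by (simp add: lp_norm_def ge_one_powr_ge_zero)
  have "(\<Sum>e\<in>edges Y. \<bar>abs_gradient f e\<bar> powr p) \<le> (\<Sum>e\<in>edges Y. 2 powr p)"
  proof (intro sum_mono powr_mono2)
    fix e assume "e \<in> edges Y"
    then obtain a b where "e = {a, b}" using E by blast
    then show "\<bar>abs_gradient f e\<bar> \<le> 2" by (simp add: abs_gradient_pair f_def)
  qed (use assms in auto)
  also have "\<dots> = card (edges Y) * 2 powr p" by simp
  also have "\<dots> \<le> 2 ^ (2 ^ card (verts Y)) * 2 powr p"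
  proof -
    have "card (edges Y) \<le> 2 ^ card (verts Y)"
      using card_mono[OF _ EP] assms(2) by (simp add: card_Pow)
    also have "\<dots> \<le> 2 ^ (2 ^ card (verts Y))" by (simp add: less_imp_le)
    finally have "real (card (edges Y)) \<le> 2 ^ (2 ^ card (verts Y))"
      by (metis of_nat_le_iff of_nat_numeral of_nat_power)
    then show ?thesis by simp
  qed
  also have "\<dots> \<le> (2 ^ (2 ^ card (verts Y))) powr p * 2 powr p"
    using powr_mono[of 1 p "2 ^ (2 ^ card (verts Y)) :: real"] assms(1) by simp
  also have "\<dots> = (2 * 2 ^ (2 ^ card (verts Y))) powr p" by (simp add: powr_mult)
  finally have "lp_norm (ereal p) (edges Y) (abs_gradient f) \<le> ((2 * 2 ^ (2 ^ card (verts Y))) powr p) powr (1 / p)"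
    unfolding lp_norm_def using assms(1) by (auto intro!: powr_mono2 sum_nonneg)
  then have num: "lp_norm (ereal p) (edges Y) (abs_gradient f) \<le> 2 * 2 ^ (2 ^ card (verts Y))"
    using assms(1) by (simp add: powr_powr)
  have nn: "0 \<le> lp_norm (ereal p) A h" for A :: "'x set" and h by (simp add: lp_norm_def)
  have "poincare_const (ereal p) Y \<le> lp_norm (ereal p) (edges Y) (abs_gradient f) / lp_norm (ereal p) (verts Y) f"
    unfolding poincare_const_def using False s uv
    by (auto intro!: cInf_lower bdd_belowI[of _ 0] divide_nonneg_nonneg nn exI[of _ f] simp: f_def)
  also have "\<dots> \<le> 2 * 2 ^ (2 ^ card (verts Y))"
    using num den nn[of "edges Y" "abs_gradient f"] by (simp add: divide_le_eq mult_le_cancel_left1 order.trans)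
  finally show ?thesis .
qed (simp add: poincare_const_def)

lemma poincare_profile_ge:
  assumes "1 \<le> p" "subgraph_of Y X" "finite (verts Y)" "real (card (verts Y)) \<le> r"
  shows "real (card (verts Y)) * poincare_const (ereal p) Y \<le> poincare_profile (ereal p) X r"
  unfolding poincare_profile_def
proof (rule cSup_upper)
  show "bdd_above {real (card (verts Y)) * poincare_const (ereal p) Y | Y.
           subgraph_of Y X \<and> finite (verts Y) \<and> real (card (verts Y)) \<le> r}"
  proof (rule bdd_aboveI)
    fix x assume "x \<in> {real (card (verts Y)) * poincare_const (ereal p) Y | Y.
           subgraph_of Y X \<and> finite (verts Y) \<and> real (card (verts Y)) \<le> r}"
    then obtain Z where Z: "x = real (card (verts Z)) * poincare_const (ereal p) Z"
      "subgraph_of Z X" "finite (verts Z)" "real (card (verts Z)) \<le> r" by blast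
    have c: "card (verts Z) \<le> nat \<lfloor>r\<rfloor>" using Z(4) by (simp add: le_nat_floor)
    have "poincare_const (ereal p) Z \<le> 2 * 2 ^ (2 ^ card (verts Z))"
      using assms(1) Z by (intro poincare_const_le) (auto simp: subgraph_of_def)
    also have "\<dots> \<le> 2 * 2 ^ (2 ^ nat \<lfloor>r\<rfloor>)" using c by (simp add: power_increasing)
    finally have "x \<le> real (card (verts Z)) * (2 * 2 ^ (2 ^ nat \<lfloor>r\<rfloor>))"
      unfolding Z(1) by (intro mult_left_mono) auto
    also have "\<dots> \<le> r * (2 * 2 ^ (2 ^ nat \<lfloor>r\<rfloor>))" using Z(4) by (intro mult_right_mono) auto
    finally show "x \<le> r * (2 * 2 ^ (2 ^ nat \<lfloor>r\<rfloor>))" .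
  qed
qed (use assms in blast)

text \<open>With N vertices the Poincare constant is at least (\<epsilon> N)^(-1/p), so the profile
  at N is at least \<epsilon>^(-1/p) N^(1-1/p). Since \<epsilon> is arbitrary, no constant C can
  serve.\<close>

lemma not_coarse_le_if_expanding:
  assumes "1 \<le> p" and "\<And>\<epsilon>. 0 < \<epsilon> \<Longrightarrow> \<exists>Y B. subgraph_of Y X \<and> finite (verts Y) \<and> 2 \<le> card (verts Y) \<and>
      0 < B \<and> B \<le> \<epsilon> * real (card (verts Y)) \<and>
      (\<forall>f. (\<Sum>v\<in>verts Y. f v) = 0 \<longrightarrow>
        (\<Sum>v\<in>verts Y. \<bar>f v\<bar> powr p) \<le> B * (\<Sum>e\<in>edges Y. abs_gradient f e powr p))"
  shows "\<not> coarse_le (poincare_profile (ereal p) X) (\<lambda>r. r powr (1 - real_of_ereal (1 / ereal p)))"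
proof
  assume "coarse_le (poincare_profile (ereal p) X) (\<lambda>r. r powr (1 - real_of_ereal (1 / ereal p)))"
  moreover have "real_of_ereal (1 / ereal p) = 1 / p"
    using assms(1) by (simp add: one_ereal_def)
  ultimately obtain C where C: "0 < C"
    "\<And>r. 0 \<le> r \<Longrightarrow> poincare_profile (ereal p) X r \<le> C * (C * r + C) powr (1 - 1 / p) + C"
    by (auto simp: coarse_le_def)
  define s where "s = 1 - 1 / p"
  have s: "0 \<le> s" "1 - s = 1 / p" using assms(1) by (auto simp: s_def field_simps)
  define K where "K = C * (2 * C) powr s + C"
  have K: "0 < K" using C(1) by (simp add: K_def add_nonneg_pos)
  \<comment> \<open>Chosen so that \<epsilon>^(-1/p) is \<open>2 * K\<close>, twice the factor in
    the upper bound \<open>K * N powr s\<close>.\<close>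
  define \<epsilon> where "\<epsilon> = 1 / (2 * K) powr p"
  have "0 < \<epsilon>" using K by (simp add: \<epsilon>_def)
  then obtain Y B where Y: "subgraph_of Y X" "finite (verts Y)" "2 \<le> card (verts Y)"
    "0 < B" "B \<le> \<epsilon> * real (card (verts Y))"
    "\<And>f. (\<Sum>v\<in>verts Y. f v) = 0 \<Longrightarrow>
        (\<Sum>v\<in>verts Y. \<bar>f v\<bar> powr p) \<le> B * (\<Sum>e\<in>edges Y. abs_gradient f e powr p)"
    using assms(2) by blast
  define N where "N = real (card (verts Y))"
  have N: "2 \<le> N" using Y(3) by (simp add: N_def)
  have "(1 / (\<epsilon> * N)) powr (1 / p) \<le> (1 / B) powr (1 / p)"
    using Y(4,5) \<open>0 < \<epsilon>\<close> N assms(1) by (intro powr_mono2) (auto simp: N_def field_simps)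
  also have "\<dots> \<le> poincare_const (ereal p) Y"
    using Y assms(1) by (intro poincare_const_ge) (auto simp: subgraph_of_def)
  finally have "N * (1 / (\<epsilon> * N)) powr (1 / p) \<le> N * poincare_const (ereal p) Y"
    using N by (intro mult_left_mono) auto
  also have "\<dots> \<le> poincare_profile (ereal p) X N"
    unfolding N_def using Y assms(1) by (intro poincare_profile_ge) auto
  also have "\<dots> \<le> C * (C * N + C) powr s + C" using C(2)[of N] N by (simp add: s_def)
  also have "\<dots> \<le> C * ((2 * C) powr s * N powr s) + C * N powr s"
  proof -
    have "(C * N + C) powr s \<le> (2 * C * N) powr s" using C(1) N s by (intro powr_mono2) auto
    then have "(C * N + C) powr s \<le> (2 * C) powr s * N powr s" using C(1) N by (simp add: powr_mult)
    moreover have "1 \<le> N powr s" using N s by (intro ge_one_powr_ge_zero) auto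
    ultimately show ?thesis using C(1) by (intro add_mono mult_left_mono) auto
  qed
  also have "\<dots> = K * N powr s" by (simp add: K_def algebra_simps)
  finally have *: "N * (1 / (\<epsilon> * N)) powr (1 / p) \<le> K * N powr s" .
  have "(1 / (\<epsilon> * N)) powr (1 / p) = ((2 * K) powr p) powr (1 / p) / N powr (1 / p)"
    using K N by (simp add: \<epsilon>_def powr_divide)
  also have "\<dots> = 2 * K / N powr (1 / p)" using assms(1) K by (simp add: powr_powr)
  finally have "N * (1 / (\<epsilon> * N)) powr (1 / p) = 2 * K * (N powr 1 / N powr (1 / p))"
    using N by simp
  also have "N powr 1 / N powr (1 / p) = N powr s" by (simp add: s_def powr_diff)
  finally have "2 * K * N powr s \<le> K * N powr s" using * by simp
  then show False using K N by simp
qed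

lemma critical_exponent_ge:
  assumes "\<And>p. 1 \<le> p \<Longrightarrow> p < Q \<Longrightarrow>
    \<not> coarse_le (poincare_profile (ereal p) X) (\<lambda>r. r powr (1 - real_of_ereal (1 / ereal p)))"
  shows "ereal Q \<le> critical_exponent X"
  unfolding critical_exponent_def
proof (rule Inf_greatest)
  fix p assume p: "p \<in> {p. 1 \<le> p \<and> coarse_le (poincare_profile p X) (\<lambda>r. r powr (1 - real_of_ereal (1 / p)))}"
  show "ereal Q \<le> p"
  proof (cases p)
    case (real x)
    then show ?thesis using p assms[of x] by (auto simp: one_ereal_def) (meson not_less)
  qed (use p in auto)
qed

text \<open>Thickening by a finite connected set makes paths for one generating set connected for any
  other one.\<close>

definition thicken :: "('g, 'b) monoid_scheme \<Rightarrow> 'g set \<Rightarrow> 'g set \<Rightarrow> 'g set" where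
  "thicken G Q X = (\<Union>x\<in>X. (\<lambda>q. x \<otimes>\<^bsub>G\<^esub> q) ` Q)"

lemma connected_on_Un:
  assumes "connected_on E X" "connected_on E Y" "X \<inter> Y \<noteq> {}"
  shows "connected_on E (X \<union> Y)"
  unfolding connected_on_def
proof (intro ballI)
  fix u v assume uv: "u \<in> X \<union> Y" "v \<in> X \<union> Y"
  obtain z where z: "z \<in> X" "z \<in> Y" using assms(3) by blast
  have mono: "(joined E (X \<union> Y))\<^sup>*\<^sup>* a b" if "(joined E X)\<^sup>*\<^sup>* a b \<or> (joined E Y)\<^sup>*\<^sup>* a b" for a b
  proof -
    have "joined E X \<le> joined E (X \<union> Y)" "joined E Y \<le> joined E (X \<union> Y)"
      by (auto simp: joined_def)
    then show ?thesis using that rtranclp_mono by (metis predicate2D)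
  qed
  have "(joined E (X \<union> Y))\<^sup>*\<^sup>* u z" "(joined E (X \<union> Y))\<^sup>*\<^sup>* z v"
    using uv z assms(1,2) mono by (auto simp: connected_on_def)
  then show "(joined E (X \<union> Y))\<^sup>*\<^sup>* u v" by simp
qed

section \<open>Connected sets and thickenings in Cayley graphs\<close>

context group
begin

lemma cayley_edge_cases:
  assumes "e \<in> edges (cayley_graph G S)" "S \<subseteq> carrier G"
  obtains g s where "e = {g, g \<otimes> s}" "g \<in> carrier G" "s \<in> S" "g \<otimes> s \<noteq> g"
  using assms by (auto simp: cayley_graph_def)

lemma connected_on_translate:
  assumes "connected_on (edges (cayley_graph G S)) X" "S \<subseteq> carrier G" "X \<subseteq> carrier G" "x \<in> carrier G"
  shows "connected_on (edges (cayley_graph G S)) ((\<lambda>q. x \<otimes> q) ` X)"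
proof -
  let ?E = "edges (cayley_graph G S)"
  have step: "joined ?E ((\<lambda>q. x \<otimes> q) ` X) (x \<otimes> u) (x \<otimes> v)" if "joined ?E X u v" for u v
  proof -
    have uv: "u \<in> X" "v \<in> X" "{u, v} \<in> ?E" using that by (auto simp: joined_def)
    then obtain g s where gs: "{u, v} = {g, g \<otimes> s}" "g \<in> carrier G" "s \<in> S" "g \<otimes> s \<noteq> g"
      using assms(2) by (auto elim: cayley_edge_cases)
    have "{x \<otimes> u, x \<otimes> v} = (\<lambda>q. x \<otimes> q) ` {u, v}" by simp
    also have "\<dots> = {x \<otimes> g, (x \<otimes> g) \<otimes> s}" unfolding gs(1) using gs assms by (auto simp: m_assoc)
    finally have e: "{x \<otimes> u, x \<otimes> v} = {x \<otimes> g, (x \<otimes> g) \<otimes> s}" .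
    have "(x \<otimes> g) \<otimes> s \<noteq> x \<otimes> g"
    proof
      assume "(x \<otimes> g) \<otimes> s = x \<otimes> g"
      then have "x \<otimes> (g \<otimes> s) = x \<otimes> g" using gs assms by (simp add: m_assoc subsetD)
      then show False using gs assms by (auto simp: subsetD)
    qed
    then have "{x \<otimes> u, x \<otimes> v} \<in> ?E" unfolding e cayley_graph_def using gs assms by auto
    then show ?thesis using uv by (simp add: joined_def)
  qed
  have "(joined ?E ((\<lambda>q. x \<otimes> q) ` X))\<^sup>*\<^sup>* (x \<otimes> u) (x \<otimes> v)" if "(joined ?E X)\<^sup>*\<^sup>* u v" for u v
    using that
  proof (induction rule: rtranclp_induct)
    case (step y z)
    then show ?case using \<open>\<And>u v. joined ?E X u v \<Longrightarrow> _\<close> by (meson rtranclp.rtrancl_into_rtrancl)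
  qed simp
  then show ?thesis using assms(1) by (auto simp: connected_on_def)
qed

lemma connected_set_through:
  assumes "finite_generating_set G S" "g \<in> carrier G"
  shows "\<exists>Q. finite Q \<and> Q \<subseteq> carrier G \<and> \<one> \<in> Q \<and> g \<in> Q \<and> connected_on (edges (cayley_graph G S)) Q"
proof -
  let ?E = "edges (cayley_graph G S)"
  have S: "S \<subseteq> carrier G" using assms by (simp add: finite_generating_set_def)
  have pair: "connected_on ?E {a, a \<otimes> s}" if "a \<in> carrier G" "s \<in> S" for a s
  proof (cases "a \<otimes> s = a")
    case False
    then have e: "{a, a \<otimes> s} \<in> ?E" using that by (auto simp: cayley_graph_def)
    then have "joined ?E {a, a \<otimes> s} a (a \<otimes> s)" "joined ?E {a, a \<otimes> s} (a \<otimes> s) a"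
      by (auto simp: joined_def insert_commute)
    then show ?thesis by (auto simp: connected_on_def)
  qed (auto simp: connected_on_def)
  have "g \<in> generate G S" using assms by (simp add: finite_generating_set_def)
  then show ?thesis
  proof (induction rule: generate.induct)
    case one
    then show ?case by (intro exI[of _ "{\<one>}"]) (auto simp: connected_on_def)
  next
    case (incl h)
    then show ?case using S pair[of \<one> h] by (intro exI[of _ "{\<one>, h}"]) auto
  next
    case (inv h)
    then have "h \<in> carrier G" using S by blast
    then show ?case
      using S pair[of "inv h" h] inv by (intro exI[of _ "{inv h, \<one>}"]) auto
  next
    case (eng h1 h2)
    then obtain Q1 Q2 where Q: "finite Q1" "Q1 \<subseteq> carrier G" "\<one> \<in> Q1" "h1 \<in> Q1" "connected_on ?E Q1"
      "finite Q2" "Q2 \<subseteq> carrier G" "\<one> \<in> Q2" "h2 \<in> Q2" "connected_on ?E Q2" by blast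
    have h1: "h1 \<in> carrier G" using Q by blast
    have "connected_on ?E (Q1 \<union> (\<lambda>q. h1 \<otimes> q) ` Q2)"
    proof (rule connected_on_Un)
      show "connected_on ?E ((\<lambda>q. h1 \<otimes> q) ` Q2)" using Q S h1 by (intro connected_on_translate)
      have "h1 = h1 \<otimes> \<one>" using h1 by simp
      then show "Q1 \<inter> (\<lambda>q. h1 \<otimes> q) ` Q2 \<noteq> {}" using Q by blast
    qed (use Q in simp)
    then show ?case using Q h1 by (intro exI[of _ "Q1 \<union> (\<lambda>q. h1 \<otimes> q) ` Q2"]) auto
  qed
qed

lemma connected_set_through_all:
  assumes "finite_generating_set G S" "finite B" "B \<subseteq> carrier G"
  shows "\<exists>Q. finite Q \<and> Q \<subseteq> carrier G \<and> \<one> \<in> Q \<and> B \<subseteq> Q \<and> connected_on (edges (cayley_graph G S)) Q"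
  using assms(2,3)
proof (induction B rule: finite_induct)
  case empty
  show ?case using connected_set_through[OF assms(1), of \<one>] by auto
next
  case (insert g B)
  obtain Q where Q: "finite Q" "Q \<subseteq> carrier G" "\<one> \<in> Q" "B \<subseteq> Q" "connected_on (edges (cayley_graph G S)) Q"
    using insert by auto
  obtain Q' where Q': "finite Q'" "Q' \<subseteq> carrier G" "\<one> \<in> Q'" "g \<in> Q'" "connected_on (edges (cayley_graph G S)) Q'"
    using connected_set_through[OF assms(1), of g] insert by auto
  have "connected_on (edges (cayley_graph G S)) (Q \<union> Q')"
    using Q Q' by (intro connected_on_Un) auto
  then show ?case using Q Q' by (intro exI[of _ "Q \<union> Q'"]) auto
qed

text \<open>Consecutive translates of \<open>Q\<close> overlap: \<open>x (Suc n)\<close> lies in the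
  translate by \<open>x n\<close> by assumption and in its own because \<open>Q\<close> contains the
  identity.\<close>

lemma connected_on_thicken:
  assumes Q: "connected_on (edges (cayley_graph G S)) Q" "Q \<subseteq> carrier G" "\<one> \<in> Q" and S: "S \<subseteq> carrier G"
    and "\<And>k. k < n \<Longrightarrow> \<exists>q\<in>Q. x (Suc k) = x k \<otimes> q" "x 0 \<in> carrier G"
  shows "connected_on (edges (cayley_graph G S)) (thicken G Q (x ` {..n}))"
  using assms(5)
proof (induction n)
  case 0
  then show ?case using connected_on_translate[OF Q(1) S Q(2) assms(6)] by (simp add: thicken_def)
next
  case (Suc n)
  have carrier: "x k \<in> carrier G" if "k \<le> Suc n" for k
    using that
  proof (induction k)
    case (Suc k)
    then show ?case using Suc.prems \<open>\<And>k. k < Suc n \<Longrightarrow> _\<close>[of k] Q(2) by auto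
  qed (use assms(6) in simp)
  have eq: "thicken G Q (x ` {..Suc n}) = thicken G Q (x ` {..n}) \<union> (\<lambda>q. x (Suc n) \<otimes> q) ` Q"
    by (auto simp: thicken_def atMost_Suc)
  obtain q where "q \<in> Q" "x (Suc n) = x n \<otimes> q" using Suc.prems by blast
  then have "x (Suc n) \<in> thicken G Q (x ` {..n})" by (auto simp: thicken_def)
  moreover have "x (Suc n) = x (Suc n) \<otimes> \<one>" using carrier by simp
  then have "x (Suc n) \<in> (\<lambda>q. x (Suc n) \<otimes> q) ` Q" using Q(3) by blast
  ultimately show ?case
    unfolding eq using Suc connected_on_translate[OF Q(1) S Q(2) carrier[of "Suc n"]]
    by (intro connected_on_Un) auto
qed

lemma card_cayley_edges_le:
  assumes "finite S" "S \<subseteq> carrier G" "finite X"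
  shows "card {e \<in> edges (cayley_graph G S). e \<subseteq> X} \<le> card S * card X"
proof -
  have "{e \<in> edges (cayley_graph G S). e \<subseteq> X} \<subseteq> (\<lambda>(s, g). {g, g \<otimes> s}) ` (S \<times> X)"
    by (auto elim!: cayley_edge_cases[OF _ assms(2)])
  then have "card {e \<in> edges (cayley_graph G S). e \<subseteq> X} \<le> card ((\<lambda>(s, g). {g, g \<otimes> s}) ` (S \<times> X))"
    using assms by (intro card_mono) auto
  also have "\<dots> \<le> card (S \<times> X)" using assms by (intro card_image_le) auto
  finally show ?thesis by (simp add: card_cartesian_product)
qed

lemma card_thicken_le:
  assumes "finite Q" "finite X"
  shows "card (thicken G Q X) \<le> card Q * card X" "finite (thicken G Q X)"
proof -
  have eq: "thicken G Q X = (\<lambda>(q, x). x \<otimes> q) ` (Q \<times> X)" by (auto simp: thicken_def)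
  show "finite (thicken G Q X)" unfolding eq using assms by simp
  have "card (thicken G Q X) \<le> card (Q \<times> X)" unfolding eq using assms by (intro card_image_le) auto
  then show "card (thicken G Q X) \<le> card Q * card X" by (simp add: card_cartesian_product)
qed

text \<open>If \<open>v = x \<otimes> q\<close>, then \<open>q\<close> determines \<open>x\<close>,
  and \<open>x\<close> determines the index by disjointness. Different indices thus require
  different elements of \<open>Q\<close>.\<close>

lemma card_thicken_multiplicity:
  assumes "finite Q" "Q \<subseteq> carrier G" "\<And>a. a \<in> I \<Longrightarrow> X a \<subseteq> carrier G"
    and "\<And>a b. a \<in> I \<Longrightarrow> b \<in> I \<Longrightarrow> a \<noteq> b \<Longrightarrow> X a \<inter> X b = {}"
  shows "card {a \<in> I. v \<in> thicken G Q (X a)} \<le> card Q"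
proof -
  have "\<forall>a\<in>{a \<in> I. v \<in> thicken G Q (X a)}. \<exists>q. q \<in> Q \<and> (\<exists>x\<in>X a. v = x \<otimes> q)"
    by (auto simp: thicken_def)
  then obtain q where q: "\<And>a. a \<in> I \<Longrightarrow> v \<in> thicken G Q (X a) \<Longrightarrow> q a \<in> Q \<and> (\<exists>x\<in>X a. v = x \<otimes> q a)"
    by (metis (mono_tags, lifting) mem_Collect_eq)
  have "inj_on q {a \<in> I. v \<in> thicken G Q (X a)}"
  proof (rule inj_onI)
    fix a b assume ab: "a \<in> {a \<in> I. v \<in> thicken G Q (X a)}" "b \<in> {a \<in> I. v \<in> thicken G Q (X a)}" "q a = q b"
    then obtain x y where xy: "x \<in> X a" "y \<in> X b" "x \<otimes> q a = y \<otimes> q a" "q a \<in> Q"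
      using q[of a] q[of b] by auto
    moreover have "x \<in> carrier G" "y \<in> carrier G" "q a \<in> carrier G"
      using xy ab assms(2,3) by auto
    ultimately have "x = y" by simp
    then show "a = b" using xy ab assms(4)[of a b] by blast
  qed
  moreover have "q ` {a \<in> I. v \<in> thicken G Q (X a)} \<subseteq> Q" using q by auto
  ultimately show ?thesis using assms(1) card_inj_on_le by blast
qed

end

section \<open>Trees of paths in Coxeter groups\<close>

context coxeter_numbers
begin

text \<open>A triangle group with labels at least 3 is infinite, and periodic words in its three
  generators are reduced. The sign at the first letter is the form of this fact that the numbers
  game yields, by three inequalities that each letter reproduces in rotated form.\<close>

lemma cyclic_word_negative:
  assumes "\<And>k. c k \<in> A" "\<And>k. c (k + 3) = c k" "\<And>k. c k \<noteq> c (k + 1)" "\<And>k. c k \<noteq> c (k + 2)"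
    and "\<And>k. 0 < y (c k)" "i < j"
  shows "act (map c [i..<j]) y (c i) < 0"
proof -
  define u where "u k = act (map c [k..<j]) y" for k
  have step: "u k = flip (c k) (u (Suc k))" if "k < j" for k
    using that by (simp add: u_def upt_conv_Cons act_Cons)
  have ne: "c (k + 1) \<noteq> c k" "c (k + 2) \<noteq> c k" "c (k + 1) \<noteq> c (k + 2)" for k
    using assms(3)[of k] assms(4)[of k] assms(3)[of "k + 1"] by (auto simp: add.assoc)
  \<comment> \<open>\<open>c (k + 2)\<close> is the letter in front of \<open>k\<close>, the next one to be applied\<close>
  have inv: "0 < u k (c (k + 2)) \<and> 0 \<le> u k (c (k + 1)) \<and> 0 \<le> u k (c (k + 2)) + u k (c k)"
    if "k \<le> j" for k
    using that
  proof (induction rule: inc_induct)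
    case base
    show ?case using assms(5)[of j] assms(5)[of "j + 1"] assms(5)[of "j + 2"] by (simp add: u_def)
  next
    case (step k)
    have IH: "0 < u (Suc k) (c k)" "0 \<le> u (Suc k) (c (k + 2))" "0 \<le> u (Suc k) (c k) + u (Suc k) (c (k + 1))"
      using step.IH assms(2)[of k] by (simp_all add: numeral_3_eq_3)
    have g: "1 \<le> cc (c k) (c (k + 1))" "1 \<le> cc (c k) (c (k + 2))"
      using cc_ge_1 assms(1) ne by metis+
    have v: "u k (c (k + 1)) = u (Suc k) (c (k + 1)) + cc (c k) (c (k + 1)) * u (Suc k) (c k)"
      "u k (c (k + 2)) = u (Suc k) (c (k + 2)) + cc (c k) (c (k + 2)) * u (Suc k) (c k)"
      "u k (c k) = - u (Suc k) (c k)"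
      using \<open>\<And>k. k < j \<Longrightarrow> u k = _\<close>[of k] step.hyps ne assms(1) by (simp_all add: flip_other)
    have "u (Suc k) (c k) \<le> cc (c k) (c (k + 1)) * u (Suc k) (c k)"
      "u (Suc k) (c k) \<le> cc (c k) (c (k + 2)) * u (Suc k) (c k)"
      using g IH(1) by simp_all
    then show ?case using v IH by linarith
  qed
  have "0 < u (Suc i) (c i)" using inv[of "Suc i"] assms(2)[of i] assms(6) by (simp add: numeral_3_eq_3)
  then show ?thesis using step[OF assms(6)] by (simp add: u_def)
qed

end

lemma (in coxeter_words) chain_fst: "chain vs es i r k \<Longrightarrow> i \<le> length es"
  using keys_fst by (cases vs) auto

section \<open>The tree over a cyclic root path\<close>

locale coxeter_tree = coxeter_words A mm V eqv + group G
  for A :: "'a set" and mm V eqv and G :: "('g, 'b) monoid_scheme" (structure) +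
  fixes el :: "'a list \<Rightarrow> 'g" and a :: "'a list" and b :: 'a
  assumes el_closed: "set u \<subseteq> A \<Longrightarrow> el u \<in> carrier G"
    and el_append: "set u \<subseteq> A \<Longrightarrow> set v \<subseteq> A \<Longrightarrow> el (u @ v) = el u \<otimes> el v"
    and el_eq: "set u \<subseteq> A \<Longrightarrow> set v \<subseteq> A \<Longrightarrow> el u = el v \<longleftrightarrow> eqv u v"
    and ab: "length a = 3" "distinct (b # a)" "set (b # a) \<subseteq> A"
    and V_pos: "0 < V"
begin

definition cyc :: "nat \<Rightarrow> 'a" where
  "cyc k = a ! (k mod 3)"

definition even_letters :: "'a list" where
  "even_letters = fresh (set (b # a))"

definition odd_letters :: "'a list" where
  "odd_letters = fresh (set (b # a) \<union> set even_letters)"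

text \<open>There is no earlier path below the root path, so \<open>b\<close> stands in for the down
  generator; it differs from all labels and list letters. Two disjoint lists in alternation suffice
  because only edges meeting at a vertex are compared.\<close>

definition root_path :: "nat \<Rightarrow> 'a edge list" where
  "root_path w = map (\<lambda>k. (cyc k, b, if even k then even_letters else odd_letters)) [0..<w]"

definition line :: "nat \<Rightarrow> 'a list" where
  "line i = map cyc [0..<i]"

lemma length_root_path [simp]: "length (root_path w) = w"
  by (simp add: root_path_def)

lemma take_root_path: "i \<le> w \<Longrightarrow> map fst (take i (root_path w)) = line i"
  by (simp add: root_path_def line_def take_map comp_def)

lemma cyc:
  shows "cyc k \<in> set a" "cyc k \<in> A" "cyc k \<noteq> b" "cyc (k + 3) = cyc k"
    "cyc k \<noteq> cyc (k + 1)" "cyc k \<noteq> cyc (k + 2)"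
proof -
  show m: "cyc k \<in> set a" using ab(1) by (simp add: cyc_def)
  then show "cyc k \<in> A" "cyc k \<noteq> b" using ab by auto
  show "cyc (k + 3) = cyc k" by (simp add: cyc_def)
  have "k mod 3 \<noteq> (k + 1) mod 3" "k mod 3 \<noteq> (k + 2) mod 3" by presburger+
  then show "cyc k \<noteq> cyc (k + 1)" "cyc k \<noteq> cyc (k + 2)"
    using ab(1,2) by (auto simp: cyc_def nth_eq_iff_index_eq)
qed

lemma set_line: "set (line i) \<subseteq> A"
  using cyc(2) by (auto simp: line_def)

lemma root_letters:
  shows "length even_letters = V" "distinct even_letters" "set even_letters \<subseteq> A"
    "set even_letters \<inter> set (b # a) = {}"
    "length odd_letters = V" "distinct odd_letters" "set odd_letters \<subseteq> A"
    "set odd_letters \<inter> (set (b # a) \<union> set even_letters) = {}"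
proof -
  have c4: "card (set (b # a)) = 4" using distinct_card[OF ab(2)] ab(1) by simp
  have c: "card (set (b # a)) + V \<le> card A" using card_A c4 by linarith
  note e = fresh[OF finite_set c, folded even_letters_def]
  show "length even_letters = V" "distinct even_letters" "set even_letters \<subseteq> A"
    "set even_letters \<inter> set (b # a) = {}" using e by auto
  have "card (set (b # a) \<union> set even_letters) \<le> 4 + V"
    using card_Un_le[of "set (b # a)" "set even_letters"] c4 card_length[of even_letters] e(2) by linarith
  then have c': "card (set (b # a) \<union> set even_letters) + V \<le> card A" using card_A by linarith
  note o = fresh[OF _ c', folded odd_letters_def]
  show "length odd_letters = V" "distinct odd_letters" "set odd_letters \<subseteq> A"
    "set odd_letters \<inter> (set (b # a) \<union> set even_letters) = {}" using o by auto
qed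

lemma root_path_good: "good (root_path w)"
proof -
  have nth: "root_path w ! k = (cyc k, b, if even k then even_letters else odd_letters)" if "k < w" for k
    using that by (simp add: root_path_def)
  have av: "cyc k \<notin> set even_letters" "cyc k \<notin> set odd_letters" "b \<notin> set even_letters" "b \<notin> set odd_letters"
    "set even_letters \<inter> set odd_letters = {}" for k
    using cyc(1)[of k] root_letters by auto
  have "successively adj (root_path w)"
    unfolding successively_conv_nth
  proof (intro allI impI)
    fix k assume k: "Suc k < length (root_path w)"
    have "cyc (Suc k) \<noteq> cyc k" using cyc(5)[of k] by simp
    then show "adj (root_path w ! k) (root_path w ! Suc k)"
      using k av nth[of k] nth[of "Suc k"] by (auto simp: adj_def)
  qed
  moreover have "wf_edge e \<and> compatible e e" if "e \<in> set (root_path w)" for e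
  proof -
    obtain k where "e = (cyc k, b, if even k then even_letters else odd_letters)"
      using \<open>e \<in> _\<close> by (auto simp: root_path_def)
    then show ?thesis
      using av(1,2)[of k] av(3-5) root_letters(1-3,5-7) cyc(2,3)[of k] ab(3)
      by (cases "even k") (simp_all add: wf_edge_def compatible_def)
  qed
  ultimately show ?thesis by (simp add: good_def)
qed

lemma root_path_Nil: "0 < w \<Longrightarrow> root_path w \<noteq> []"
  using length_root_path[of w] by fastforce

text \<open>Tameness allows nonpositive values only at list letters, and the lists on the root path
  avoid its labels.\<close>

lemma chain_positive:
  assumes "chain vs (root_path w) i r k" "0 < w" "set vs \<subseteq> {..<V}"
  shows "0 < act r (\<lambda>_. 1) (cyc j)"
proof -
  let ?C = "config_at (root_path w) i"
  have v: "hd (vs @ [0]) < V" using assms(3) V_pos by (cases vs) auto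
  have "tame (hd (vs @ [0])) ?C (act r (\<lambda>_. 1))"
    using chain_tame[OF root_path_good root_path_Nil assms(3,1)] assms(2) V_pos by simp
  moreover have "cyc j \<notin> letters (hd (vs @ [0])) ?C"
  proof
    assume "cyc j \<in> letters (hd (vs @ [0])) ?C"
    then obtain l q L where L: "(l, q, L) \<in> sides ?C" "L ! hd (vs @ [0]) = cyc j" by (rule lettersE)
    have "i \<le> w" using chain_fst[OF assms(1)] by simp
    have "root_path w ! (i - 1) = (l, q, L) \<and> i \<noteq> 0 \<or> root_path w ! i = (l, q, L) \<and> i < w"
      using L(1) by (auto simp: sides_def config_at_def split: if_splits)
    then have "\<exists>k<w. root_path w ! k = (l, q, L)"
    proof
      assume "root_path w ! (i - 1) = (l, q, L) \<and> i \<noteq> 0"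
      then show ?thesis using \<open>i \<le> w\<close> by (intro exI[of _ "i - 1"]) auto
    qed blast
    then have "(l, q, L) \<in> set (root_path w)"
      using nth_mem[of _ "root_path w"] by (metis length_root_path)
    then have "L = even_letters \<or> L = odd_letters" by (auto simp: root_path_def)
    then have "cyc j \<in> set even_letters \<union> set odd_letters"
    proof -
      have "length L = V" "set L \<subseteq> set even_letters \<union> set odd_letters"
        using \<open>L = even_letters \<or> L = odd_letters\<close> root_letters(1,5) by auto
      then show ?thesis using L(2) v nth_mem[of "hd (vs @ [0])" L] by auto
    qed
    then show False using cyc(1)[of j] root_letters(4,8) by auto
  qed
  ultimately show ?thesis using cyc(2) by (simp add: tame_def)
qed

text \<open>If \<open>i < j\<close>, cancelling \<open>line i\<close> puts the cyclic word from
  \<open>i\<close> to \<open>j\<close> in front of \<open>r'\<close>. That makes the coordinate at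
  \<open>cyc i\<close> negative, whereas \<open>chain_positive\<close> makes it positive for
  \<open>r\<close>.\<close>

lemma root_determined:
  assumes "chain vs (root_path w) i r k" "chain vs' (root_path w) j r' k'" "0 < w"
    and "set vs \<subseteq> {..<V}" "set vs' \<subseteq> {..<V}" "el (line i @ r) = el (line j @ r')"
  shows "i = j" "act r (\<lambda>_. 1) = act r' (\<lambda>_. 1)"
proof -
  have rA': "set r \<subseteq> A" "set r' \<subseteq> A"
    using chain_word(1)[OF root_path_good root_path_Nil[OF assms(3)] assms(4) _ assms(1), of "[]"]
      chain_word(1)[OF root_path_good root_path_Nil[OF assms(3)] assms(5) _ assms(2), of "[]"] by simp_all
  have less: False if "i < j" "chain vs (root_path w) i r k" "chain vs' (root_path w) j r' k'"
    "set vs \<subseteq> {..<V}" "set vs' \<subseteq> {..<V}" "set r \<subseteq> A" "set r' \<subseteq> A"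
    "eqv (line i @ r) (line j @ r')" for i j r r' k k' vs vs'
  proof -
    have "line j = line i @ map cyc [i..<j]"
      using that(1) upt_add_eq_append[of 0 i "j - i"] by (simp add: line_def flip: map_append)
    then have "eqv r (map cyc [i..<j] @ r')"
      using eqv_cancel[of "line i" r "map cyc [i..<j] @ r'"] that(8) set_line by simp
    then have "act r (\<lambda>_. 1) = act (map cyc [i..<j]) (act r' (\<lambda>_. 1))"
      using eqv_act[of r "map cyc [i..<j] @ r'" "\<lambda>_. 1"] by (simp add: act_append)
    moreover have "act (map cyc [i..<j]) (act r' (\<lambda>_. 1)) (cyc i) < 0"
      using cyc chain_positive[OF that(3) assms(3) that(5)] that(1) by (intro cyclic_word_negative)
    ultimately show False using chain_positive[OF that(2) assms(3) that(4), of i] by simp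
  qed
  have e: "eqv (line i @ r) (line j @ r')" using assms(6) el_eq set_line rA' by simp
  show "i = j"
    using less[OF _ assms(1,2,4,5) rA' e] less[OF _ assms(2,1,5,4) rA'(2,1) eqv_sym[OF e]]
    by (meson nat_neq_iff)
  then have "eqv r r'" using eqv_cancel[of "line i" r r'] e set_line by simp
  then show "act r (\<lambda>_. 1) = act r' (\<lambda>_. 1)" by (rule eqv_act)
qed

definition tree_word :: "nat \<Rightarrow> nat list \<Rightarrow> nat \<Rightarrow> 'a list" where
  "tree_word w vs k = start_after vs [] (root_path w) @ map fst (take k (path_after vs (root_path w)))"

definition leaf_path :: "nat \<Rightarrow> nat list \<Rightarrow> 'g set" where
  "leaf_path w vs = (\<lambda>k. el (tree_word w vs k)) ` {..length (path_after vs (root_path w))}"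

definition ray :: "nat \<Rightarrow> nat list \<Rightarrow> nat \<Rightarrow> 'a list" where
  "ray w vs i = (SOME r. (\<exists>k. chain vs (root_path w) i r k) \<and> length r = length vs \<and>
    (\<forall>j\<le>length vs. \<exists>k'. chain (take j vs) (root_path w) i (take j r) k'))"

definition ray_path :: "nat \<Rightarrow> nat list \<Rightarrow> nat \<Rightarrow> 'g set" where
  "ray_path w vs i = (\<lambda>j. el (line i @ take j (ray w vs i))) ` {..length vs}"

lemma ray:
  assumes "0 < w" "set vs \<subseteq> {..<V}" "i \<le> w"
  shows "\<exists>k. chain vs (root_path w) i (ray w vs i) k" "length (ray w vs i) = length vs"
    "j \<le> length vs \<Longrightarrow> \<exists>k'. chain (take j vs) (root_path w) i (take j (ray w vs i)) k'"
    "set (ray w vs i) \<subseteq> A"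
proof -
  have "\<exists>r. (\<exists>k. chain vs (root_path w) i r k) \<and> length r = length vs \<and>
    (\<forall>j\<le>length vs. \<exists>k'. chain (take j vs) (root_path w) i (take j r) k')"
    using straight_chain[OF root_path_good root_path_Nil[OF assms(1)] assms(2), of i] assms(3) by auto
  from someI_ex[OF this]
  show r: "\<exists>k. chain vs (root_path w) i (ray w vs i) k" "length (ray w vs i) = length vs"
    "j \<le> length vs \<Longrightarrow> \<exists>k'. chain (take j vs) (root_path w) i (take j (ray w vs i)) k'" for j
    unfolding ray_def by blast+
  then obtain k where "chain vs (root_path w) i (ray w vs i) k" by blast
  then show "set (ray w vs i) \<subseteq> A"
    using chain_word(1)[OF root_path_good root_path_Nil[OF assms(1)] assms(2), of "[]"] by simp
qed

lemma chain_el: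
  assumes "0 < w" "set vs \<subseteq> {..<V}" "chain vs (root_path w) i r k"
  shows "set (tree_word w vs k) \<subseteq> A" "el (tree_word w vs k) = el (line i @ r)" "set r \<subseteq> A"
proof -
  note g = root_path_good root_path_Nil[OF assms(1)]
  show r: "set r \<subseteq> A" using chain_word(1)[OF g assms(2) _ assms(3), of "[]"] by simp
  have e: "eqv (tree_word w vs k) (line i @ r)"
    using chain_word(2)[OF g assms(2) _ assms(3), of "[]"] chain_fst[OF assms(3)]
    by (simp add: tree_word_def take_root_path)
  have "set (start_after vs x es) \<subseteq> A" if "set x \<subseteq> A" "good es" "es \<noteq> []" "set vs \<subseteq> {..<V}" for vs x es
    using that
  proof (induction vs arbitrary: x es)
    case (Cons v vs)
    obtain l q L es' where es: "es = (l, q, L) # es'" using Cons.prems(3) by (metis neq_Nil_conv prod_cases3)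
    have "L ! v \<in> A" using good_ConsD(10)[of l q L es' v] Cons.prems es by simp
    then show ?case using Cons next_path_valid[of es v] by (simp add: es)
  qed simp
  then have "set (start_after vs [] (root_path w)) \<subseteq> A" using g assms(2) by simp
  moreover have "fst e \<in> A" if "e \<in> set (path_after vs (root_path w))" for e
    using path_after_valid(1)[OF g assms(2)] that by (cases e) (auto simp: good_def wf_edge_def)
  ultimately show tA: "set (tree_word w vs k) \<subseteq> A"
    unfolding tree_word_def by (auto dest!: in_set_takeD)
  show "el (tree_word w vs k) = el (line i @ r)" using el_eq[OF tA, of "line i @ r"] e r set_line by simp
qed

lemma leaf_path_cases:
  assumes "0 < w" "set vs \<subseteq> {..<V}" "x \<in> leaf_path w vs"
  obtains i r k where "i \<le> w" "chain vs (root_path w) i r k" "x = el (line i @ r)"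
proof -
  obtain k where k: "k \<le> length (path_after vs (root_path w))" "x = el (tree_word w vs k)"
    using assms(3) by (auto simp: leaf_path_def)
  obtain i r where c: "chain vs (root_path w) i r k"
    using chain_exists[OF root_path_good root_path_Nil[OF assms(1)] assms(2) k(1)] by blast
  show thesis
    by (rule that[OF _ c]) (use chain_el(2)[OF assms(1,2) c] chain_fst[OF c] k(2) in simp_all)
qed

lemma chain_leaf:
  assumes "0 < w" "set vs \<subseteq> {..<V}" "chain vs (root_path w) i r k"
  shows "el (line i @ r) \<in> leaf_path w vs"
proof -
  have "k \<le> length (path_after vs es)" if "chain vs es i r k" for vs es i r
    using that
  proof (induction vs arbitrary: es i r)
    case (Cons v vs)
    then show ?case unfolding chain.simps path_after.simps by blast
  qed simp
  then have "k \<le> length (path_after vs (root_path w))" using assms(3) by blast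
  then have "el (tree_word w vs k) \<in> leaf_path w vs" unfolding leaf_path_def by blast
  then show ?thesis by (simp only: chain_el(2)[OF assms])
qed

lemma leaf_paths_disjoint:
  assumes "0 < w" "set vs \<subseteq> {..<V}" "set vs' \<subseteq> {..<V}" "length vs = length vs'" "vs \<noteq> vs'"
  shows "leaf_path w vs \<inter> leaf_path w vs' = {}"
proof (rule ccontr)
  assume "leaf_path w vs \<inter> leaf_path w vs' \<noteq> {}"
  then obtain x where x: "x \<in> leaf_path w vs" "x \<in> leaf_path w vs'" by blast
  obtain i r k where c: "chain vs (root_path w) i r k" "x = el (line i @ r)"
    using leaf_path_cases[OF assms(1,2) x(1)] by metis
  obtain i' r' k' where c': "chain vs' (root_path w) i' r' k'" "x = el (line i' @ r')"
    using leaf_path_cases[OF assms(1,3) x(2)] by metis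
  note d = root_determined[OF c(1) c'(1) assms(1-3)]
  have "i = i'" "act r (\<lambda>_. 1) = act r' (\<lambda>_. 1)" using d c(2) c'(2) by auto
  then have "vs = vs'"
    using chain_determines_branch[OF root_path_good root_path_Nil[OF assms(1)] assms(2-4) V_pos c(1)] c'(1) by blast
  then show False using assms(5) by simp
qed

lemma ray_paths_disjoint:
  assumes "0 < w" "set vs \<subseteq> {..<V}" "set vs' \<subseteq> {..<V}" "i \<le> w" "i' \<le> w" "i \<noteq> i'"
  shows "ray_path w vs i \<inter> ray_path w vs' i' = {}"
proof (rule ccontr)
  assume "ray_path w vs i \<inter> ray_path w vs' i' \<noteq> {}"
  then obtain j j' where j: "j \<le> length vs" "j' \<le> length vs'"
    "el (line i @ take j (ray w vs i)) = el (line i' @ take j' (ray w vs' i'))"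
    by (auto simp: ray_path_def)
  obtain k where k: "chain (take j vs) (root_path w) i (take j (ray w vs i)) k"
    using ray(3)[OF assms(1,2,4) j(1)] by blast
  obtain k' where k': "chain (take j' vs') (root_path w) i' (take j' (ray w vs' i')) k'"
    using ray(3)[OF assms(1,3,5) j(2)] by blast
  have "set (take j vs) \<subseteq> {..<V}" "set (take j' vs') \<subseteq> {..<V}"
    using assms(2,3) set_take_subset by (meson order.trans)+
  then show False using root_determined(1)[OF k k' assms(1) _ _ j(3)] assms(6) by blast
qed

lemma ray_meets_leaf:
  assumes "0 < w" "set vs \<subseteq> {..<V}" "i \<le> w"
  shows "el (line i @ ray w vs i) \<in> ray_path w vs i \<inter> leaf_path w vs" "el (line i) \<in> ray_path w vs i"
proof -
  have "el (line i @ take (length vs) (ray w vs i)) \<in> ray_path w vs i"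
    "el (line i @ take 0 (ray w vs i)) \<in> ray_path w vs i"
    unfolding ray_path_def by (intro imageI; simp)+
  then show "el (line i @ ray w vs i) \<in> ray_path w vs i \<inter> leaf_path w vs" "el (line i) \<in> ray_path w vs i"
    using ray(1,2)[OF assms] chain_leaf[OF assms(1,2)] by auto
qed

text \<open>The rays from the \<open>w + 1\<close> root vertices end on the leaf path at different
  points, since each endpoint determines its root.\<close>

lemma card_leaf_path_ge:
  assumes "0 < w" "set vs \<subseteq> {..<V}"
  shows "w + 1 \<le> card (leaf_path w vs)"
proof -
  have "inj_on (\<lambda>i. el (line i @ ray w vs i)) {..w}"
  proof (rule inj_onI)
    fix i j assume ij: "i \<in> {..w}" "j \<in> {..w}" "el (line i @ ray w vs i) = el (line j @ ray w vs j)"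
    then show "i = j"
      using ray(1)[OF assms, of i] ray(1)[OF assms, of j] root_determined(1)[OF _ _ assms(1,2,2)] by auto
  qed
  moreover have "(\<lambda>i. el (line i @ ray w vs i)) ` {..w} \<subseteq> leaf_path w vs"
    using ray_meets_leaf(1)[OF assms] by blast
  moreover have "finite (leaf_path w vs)" by (simp add: leaf_path_def)
  ultimately have "card {..w} \<le> card (leaf_path w vs)" by (rule card_inj_on_le)
  then show ?thesis by simp
qed

lemma card_leaf_path_le:
  assumes "0 < w" "set vs \<subseteq> {..<V}" "\<And>s t. s \<in> A \<Longrightarrow> t \<in> A \<Longrightarrow> s \<noteq> t \<Longrightarrow> mm s t \<le> M" "1 \<le> M"
  shows "card (leaf_path w vs) \<le> 3 * w * (2 * M - 1) ^ length vs"
proof -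
  have "card (leaf_path w vs) \<le> card {..length (path_after vs (root_path w))}"
    unfolding leaf_path_def by (rule card_image_le) simp
  also have "\<dots> \<le> (2 * M - 1) ^ length vs * (2 * w) + 1"
    using path_after_length[OF root_path_good root_path_Nil[OF assms(1)] assms(2,3)] by simp
  \<comment> \<open>There is one more vertex than edges; absorbing it raises the constant from 2 to
    3.\<close>
  also have "\<dots> \<le> (2 * M - 1) ^ length vs * (2 * w) + (2 * M - 1) ^ length vs * w"
    using assms(1,4) by (intro add_left_mono) simp
  finally show ?thesis by (simp add: algebra_simps)
qed

lemma leaf_path_carrier:
  assumes "0 < w" "set vs \<subseteq> {..<V}"
  shows "leaf_path w vs \<subseteq> carrier G"
proof
  fix x assume "x \<in> leaf_path w vs"
  then obtain i r k where "chain vs (root_path w) i r k" "x = el (line i @ r)"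
    using leaf_path_cases[OF assms] by metis
  then show "x \<in> carrier G" using chain_el(3)[OF assms] set_line[of i] el_closed by simp
qed

lemma ray_path_carrier:
  assumes "0 < w" "set vs \<subseteq> {..<V}" "i \<le> w"
  shows "ray_path w vs i \<subseteq> carrier G"
proof -
  have "set (line i @ take j (ray w vs i)) \<subseteq> A" for j
    using ray(4)[OF assms] set_line set_take_subset[of j "ray w vs i"] by auto
  then show ?thesis using el_closed by (auto simp: ray_path_def)
qed

lemma connected_leaf_path:
  assumes "connected_on (edges (cayley_graph G S)) Q" "Q \<subseteq> carrier G" "\<one> \<in> Q" "S \<subseteq> carrier G"
    and "\<And>s. s \<in> A \<Longrightarrow> el [s] \<in> Q" "0 < w" "set vs \<subseteq> {..<V}"
  shows "connected_on (edges (cayley_graph G S)) (thicken G Q (leaf_path w vs))"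
  unfolding leaf_path_def
proof (rule connected_on_thicken[OF assms(1-4)])
  have A: "set (tree_word w vs k) \<subseteq> A" if "k \<le> length (path_after vs (root_path w))" for k
    using chain_exists[OF root_path_good root_path_Nil[OF assms(6)] assms(7) that] chain_el(1)[OF assms(6,7)] by blast
  then show "el (tree_word w vs 0) \<in> carrier G" using el_closed by simp
  fix k assume k: "k < length (path_after vs (root_path w))"
  have t: "tree_word w vs (Suc k) = tree_word w vs k @ [fst (path_after vs (root_path w) ! k)]"
    using k by (simp add: tree_word_def take_Suc_conv_app_nth)
  then have "fst (path_after vs (root_path w) ! k) \<in> A" using A[of "Suc k"] k by simp
  then show "\<exists>q\<in>Q. el (tree_word w vs (Suc k)) = el (tree_word w vs k) \<otimes> q"
    using t A[of k] k el_append[of "tree_word w vs k"] assms(5) by fastforce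
qed

lemma connected_ray_path:
  assumes "connected_on (edges (cayley_graph G S)) Q" "Q \<subseteq> carrier G" "\<one> \<in> Q" "S \<subseteq> carrier G"
    and "\<And>s. s \<in> A \<Longrightarrow> el [s] \<in> Q" "0 < w" "set vs \<subseteq> {..<V}" "i \<le> w"
  shows "connected_on (edges (cayley_graph G S)) (thicken G Q (ray_path w vs i))"
  unfolding ray_path_def
proof (rule connected_on_thicken[OF assms(1-4)])
  note r = ray(2,4)[OF assms(6-8)]
  have A: "set (line i @ take j (ray w vs i)) \<subseteq> A" for j
    using r(2) set_line set_take_subset[of j "ray w vs i"] by auto
  then show "el (line i @ take 0 (ray w vs i)) \<in> carrier G" using el_closed by blast
  fix k assume k: "k < length vs"
  have t: "line i @ take (Suc k) (ray w vs i) = (line i @ take k (ray w vs i)) @ [ray w vs i ! k]"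
    using k r(1) by (simp add: take_Suc_conv_app_nth)
  then have "ray w vs i ! k \<in> A" using A[of "Suc k"] by simp
  then show "\<exists>q\<in>Q. el (line i @ take (Suc k) (ray w vs i)) = el (line i @ take k (ray w vs i)) \<otimes> q"
    using t A[of k] el_append[of "line i @ take k (ray w vs i)"] assms(5) by fastforce
qed

end

section \<open>Expanding subgraphs\<close>

text \<open>The powers of \<open>n + 1\<close> in the first summand combine to the exponent
  \<open>2 + j * (p - 1)\<close> and are beaten by the geometric sequence of ratio
  \<open>h powr (p - 1) / V\<close>. The second summand is of order 1 / (n + 1) because
  \<open>p + 1 \<le> j\<close>.\<close>

lemma exponential_gap:
  fixes \<kappa> \<epsilon> p h V :: real and j :: nat
  assumes "1 \<le> p" "1 \<le> h" "h powr (p - 1) < V" "0 < \<epsilon>" "1 \<le> \<kappa>" "p + 1 \<le> real j"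
  shows "\<exists>n::nat. (6 * \<kappa>) powr p * (2 * (real n + 1) * (2 * \<kappa>) powr p * (3 * (real n + 1) ^ j * h ^ n) powr (p - 1)
      * ((j + h + 3) * (real n + 1)) / V ^ n + 3 * (\<kappa> * (real n + 1)) powr p / (real n + 1) ^ j) \<le> \<epsilon>"
proof -
  define \<theta> where "\<theta> = h powr (p - 1) / V"
  have hp: "0 < h powr (p - 1)" using assms(2) by simp
  then have V: "0 < V" using assms(3) by linarith
  have \<theta>: "0 < \<theta>" "\<theta> < 1" using hp V assms(3) by (simp_all add: \<theta>_def)
  define c1 where "c1 = (6 * \<kappa>) powr p * (2 * (2 * \<kappa>) powr p * 3 powr (p - 1) * (j + h + 3))"
  define c2 where "c2 = (6 * \<kappa>) powr p * (3 * \<kappa> powr p)"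
  define s where "s = 2 + j * (p - 1)"
  have "(\<lambda>n::nat. (real n + 1) powr s * \<theta> ^ n) \<longlonglongrightarrow> 0"
    using \<theta> by real_asymp
  moreover have "(\<lambda>n::nat. 1 / (real n + 1)) \<longlonglongrightarrow> 0" by real_asymp
  ultimately have "(\<lambda>n::nat. c1 * ((real n + 1) powr s * \<theta> ^ n) + c2 * (1 / (real n + 1))) \<longlonglongrightarrow> c1 * 0 + c2 * 0"
    by (intro tendsto_intros)
  then have "\<forall>\<^sub>F n in sequentially. c1 * ((real n + 1) powr s * \<theta> ^ n) + c2 * (1 / (real n + 1)) < \<epsilon>"
    using assms(4) by (intro order_tendstoD(2)) auto
  then obtain n :: nat where n: "c1 * ((real n + 1) powr s * \<theta> ^ n) + c2 * (1 / (real n + 1)) < \<epsilon>"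
    by (auto simp: eventually_sequentially)
  define N where "N = real n + 1"
  have N: "1 \<le> N" by (simp add: N_def)
  have "(3 * N ^ j * h ^ n) powr (p - 1) = 3 powr (p - 1) * N powr (j * (p - 1)) * (h powr (p - 1)) ^ n"
  proof -
    have "(N ^ j) powr (p - 1) = N powr (j * (p - 1))"
      using N by (simp add: powr_powr flip: powr_realpow)
    moreover have "(h ^ n) powr (p - 1) = (h powr (p - 1)) ^ n"
      using assms(2) by (simp add: powr_powr mult.commute flip: powr_realpow)
    ultimately show ?thesis using N assms(2) by (simp add: powr_mult)
  qed
  moreover have "N * N * N powr (j * (p - 1)) = N powr s"
    using N by (simp add: s_def powr_add power2_eq_square)
  moreover have "\<theta> ^ n = (h powr (p - 1)) ^ n / V ^ n" by (simp add: \<theta>_def power_divide)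
  ultimately have 1: "(6 * \<kappa>) powr p * (2 * N * (2 * \<kappa>) powr p * (3 * N ^ j * h ^ n) powr (p - 1)
      * ((j + h + 3) * N) / V ^ n) = c1 * (N powr s * \<theta> ^ n)"
    by (simp add: c1_def mult_ac)
  have "N powr p / N ^ j \<le> 1 / N"
  proof -
    have "N powr (p + 1) \<le> N powr (real j)" using N assms(6) by (intro powr_mono) auto
    then show ?thesis using N by (simp add: powr_add powr_realpow field_simps)
  qed
  then have le: "c2 * (N powr p / N ^ j) \<le> c2 * (1 / N)"
    by (intro mult_left_mono) (simp_all add: c2_def)
  have eq: "(6 * \<kappa>) powr p * (3 * (\<kappa> * N) powr p / N ^ j) = c2 * (N powr p / N ^ j)"
    using N assms(5) by (simp add: c2_def powr_mult)
  have 2: "(6 * \<kappa>) powr p * (3 * (\<kappa> * N) powr p / N ^ j) \<le> c2 * (1 / N)"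
    unfolding eq by (rule le)
  show ?thesis
    using n 1 2 unfolding N_def[symmetric]
    by (intro exI[of _ n]) (simp add: N_def[symmetric] distrib_left)
qed

lemma fibre_ge_average:
  assumes "finite I" "\<And>a. a \<in> I \<Longrightarrow> f a < J" "I \<noteq> {}"
  shows "\<exists>s<J. card I \<le> J * card {a \<in> I. f a = s}"
proof (rule ccontr)
  assume "\<not> (\<exists>s<J. card I \<le> J * card {a \<in> I. f a = s})"
  then have *: "J * card {a \<in> I. f a = s} < card I" if "s < J" for s using that by auto
  have J: "{..<J} \<noteq> {}" using assms(2,3) by fastforce
  have "card I = (\<Sum>s<J. card {a \<in> I. f a = s})"
  proof -
    have "(\<Sum>s<J. \<Sum>a\<in>{a \<in> I. f a = s}. 1) = (\<Sum>a\<in>I. 1 :: nat)"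
      using assms(1,2) by (intro sum.group) auto
    then show ?thesis by simp
  qed
  then have "J * card I = (\<Sum>s<J. J * card {a \<in> I. f a = s})" by (simp add: sum_distrib_left)
  also have "\<dots> < (\<Sum>s<J. card I)" using * J by (intro sum_strict_mono) auto
  finally show False by simp
qed

text \<open>Pigeonhole over the \<open>J\<close> dyadic intervals that cover the values from 1 up to
  \<open>2 ^ J\<close>.\<close>

lemma dyadic_class:
  fixes c :: "'i \<Rightarrow> nat"
  assumes "finite I" "I \<noteq> {}" "\<And>a. a \<in> I \<Longrightarrow> 1 \<le> c a" "\<And>a. a \<in> I \<Longrightarrow> c a < 2 ^ J"
  shows "\<exists>s I'. I' \<subseteq> I \<and> card I \<le> J * card I' \<and> (\<forall>a\<in>I'. 2 ^ s \<le> c a \<and> c a < 2 ^ (s + 1))"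
proof -
  have "\<exists>s. 2 ^ s \<le> c a \<and> c a < 2 ^ (s + 1)" if "a \<in> I" for a
    using ex_power_ivl1[of 2 "c a"] assms(3)[OF that] by simp
  then obtain f where f: "\<And>a. a \<in> I \<Longrightarrow> 2 ^ f a \<le> c a \<and> c a < 2 ^ (f a + 1)" by metis
  have "f a < J" if "a \<in> I" for a
  proof -
    have "(2::nat) ^ f a < 2 ^ J" using f[OF that] assms(4)[OF that] by linarith
    then show ?thesis by simp
  qed
  then obtain s where "card I \<le> J * card {a \<in> I. f a = s}"
    using fibre_ge_average[OF assms(1) _ assms(2), of f J] by blast
  then show ?thesis using f by (intro exI[of _ s] exI[of _ "{a \<in> I. f a = s}"]) auto
qed

lemma connected_on_restrict:
  assumes "connected_on E X" "X \<subseteq> V"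
  shows "connected_on {e \<in> E. e \<subseteq> V} X"
proof -
  have "joined {e \<in> E. e \<subseteq> V} X = joined E X" using assms(2) by (auto simp: joined_def fun_eq_iff)
  then show ?thesis using assms(1) by (simp add: connected_on_def)
qed

context coxeter_tree
begin

text \<open>The vertex set is the union of the thickened leaf paths, over a set of branches on which
  their lengths agree up to a factor 2, and of the rays from the root path to them.\<close>

lemma expanding_subgraph:
  assumes S: "finite_generating_set G S" and p: "1 \<le> p"
    and M: "\<And>s t. s \<in> A \<Longrightarrow> t \<in> A \<Longrightarrow> s \<noteq> t \<Longrightarrow> mm s t \<le> M" "1 \<le> M"
    and gap: "real (2 * M - 1) powr (p - 1) < real V" and \<epsilon>: "0 < \<epsilon>"
  shows "\<exists>Y B. subgraph_of Y (cayley_graph G S) \<and> finite (verts Y) \<and> 2 \<le> card (verts Y) \<and>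
      0 < B \<and> B \<le> \<epsilon> * real (card (verts Y)) \<and>
      (\<forall>f. (\<Sum>v\<in>verts Y. f v) = 0 \<longrightarrow>
        (\<Sum>v\<in>verts Y. \<bar>f v\<bar> powr p) \<le> B * (\<Sum>e\<in>edges Y. abs_gradient f e powr p))"
proof -
  let ?E = "edges (cayley_graph G S)"
  have SG: "S \<subseteq> carrier G" "finite S" using S by (auto simp: finite_generating_set_def)
  have elA: "finite ((\<lambda>s. el [s]) ` A)" "(\<lambda>s. el [s]) ` A \<subseteq> carrier G"
    using finite_A el_closed by auto
  obtain Q where Q: "finite Q" "Q \<subseteq> carrier G" "\<one> \<in> Q" "\<And>s. s \<in> A \<Longrightarrow> el [s] \<in> Q" "connected_on ?E Q"
    using connected_set_through_all[OF S elA] by blast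
  \<comment> \<open>One constant for all multiplicities: \<open>card Q\<close> bounds the overlap of
    thickened disjoint sets, and \<open>card S\<close> the number of edges per vertex.\<close>
  define \<kappa> where "\<kappa> = real (card Q + card S)"
  have "card Q \<noteq> 0" using Q by auto
  then have \<kappa>: "1 \<le> \<kappa>" "real (card Q) \<le> \<kappa>" "real (card S) \<le> \<kappa>" by (auto simp: \<kappa>_def)
  define h where "h = 2 * M - 1"
  have h: "1 \<le> h" using M(2) by (simp add: h_def)
  obtain j :: nat where j: "p + 1 \<le> real j" using real_arch_simple by blast
  obtain n where n: "(6 * \<kappa>) powr p * (2 * (real n + 1) * (2 * \<kappa>) powr p * (3 * (real n + 1) ^ j * real h ^ n) powr (p - 1)
      * ((j + real h + 3) * (real n + 1)) / real V ^ n + 3 * (\<kappa> * (real n + 1)) powr p / (real n + 1) ^ j) \<le> \<epsilon>"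
    using exponential_gap[OF p _ _ \<epsilon> \<kappa>(1) j, of "real h" "real V"] gap h by (auto simp: h_def)
  define w where "w = (n + 1) ^ j"
  have w: "0 < w" by (simp add: w_def)
  define I0 where "I0 = {vs. set vs \<subseteq> {..<V} \<and> length vs = n}"
  have I0: "finite I0" "card I0 = V ^ n"
    unfolding I0_def using card_lists_length_eq[of "{..<V}" n] by (simp_all add: finite_lists_length_eq)
  have "I0 \<noteq> {}" using I0(2) V_pos by auto
  \<comment> \<open>Large enough for \<open>\<Lambda> < 2 ^ J\<close>: the factors 3,
    \<open>w\<close> and \<open>h ^ n\<close> are at most \<open>2 ^ 2\<close>,
    \<open>2 ^ (j * n)\<close> and \<open>2 ^ (h * n)\<close>. It grows only linearly in
    \<open>n\<close>.\<close>
  define J where "J = (j + h + 3) * (n + 1)"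
  define \<Lambda> where "\<Lambda> = 3 * w * h ^ n"
  have leaf: "w + 1 \<le> card (leaf_path w a)" "card (leaf_path w a) \<le> \<Lambda>" if "a \<in> I0" for a
    using that card_leaf_path_ge[OF w, of a] card_leaf_path_le[OF w _ M, of a]
    by (auto simp: I0_def \<Lambda>_def h_def)
  have "\<Lambda> < 2 ^ J"
  proof -
    have "w \<le> 2 ^ (j * n)"
    proof -
      have "n + 1 \<le> 2 ^ n" by (induction n) auto
      then have "w \<le> (2 ^ n) ^ j" unfolding w_def by (rule power_mono) simp
      then show ?thesis by (simp add: power_mult[symmetric] mult.commute)
    qed
    moreover have "h ^ n \<le> 2 ^ (h * n)"
    proof -
      have "h \<le> 2 ^ h" by (simp add: less_imp_le)
      then have "h ^ n \<le> (2 ^ h) ^ n" by (rule power_mono) simp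
      then show ?thesis by (simp add: power_mult)
    qed
    ultimately have "\<Lambda> \<le> 3 * 2 ^ (j * n) * 2 ^ (h * n)" unfolding \<Lambda>_def by (intro mult_mono) auto
    also have "\<dots> < 2 ^ 2 * 2 ^ (j * n) * 2 ^ (h * n)" by simp
    also have "\<dots> = 2 ^ (2 + j * n + h * n)" by (simp add: power_add)
    also have "\<dots> \<le> 2 ^ J" by (intro power_increasing) (auto simp: J_def algebra_simps)
    finally show ?thesis .
  qed
  then have "\<exists>s I. I \<subseteq> I0 \<and> card I0 \<le> J * card I \<and>
      (\<forall>a\<in>I. 2 ^ s \<le> card (leaf_path w a) \<and> card (leaf_path w a) < 2 ^ (s + 1))"
    using leaf I0 \<open>I0 \<noteq> {}\<close> by (intro dyadic_class) fastforce+
  then obtain s I where I: "I \<subseteq> I0" "V ^ n \<le> J * card I"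
    "\<And>a. a \<in> I \<Longrightarrow> 2 ^ s \<le> card (leaf_path w a)" "\<And>a. a \<in> I \<Longrightarrow> card (leaf_path w a) < 2 ^ (s + 1)"
    using I0(2) by auto
  have finI: "finite I" using I(1) I0(1) finite_subset by blast
  have "I \<noteq> {}" using I(2) V_pos by auto
  then obtain a0 where a0: "a0 \<in> I" by blast
  have Iv: "set a \<subseteq> {..<V}" "length a = n" if "a \<in> I" for a using I(1) that by (auto simp: I0_def)
  \<comment> \<open>The leaf paths of the chosen class have at least \<open>\<mu>\<close> and fewer
    than \<open>2 * \<mu>\<close> vertices; \<open>L\<close> and \<open>D\<close> add the factor for
    thickening.\<close>
  define \<mu> where "\<mu> = (2::real) ^ s"
  define L where "L = 2 * \<kappa> * \<mu>"
  define D where "D = \<kappa> * (real n + 1)"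
  define \<beta> where "\<beta> a = thicken G Q (leaf_path w a)" for a
  define P where "P a i = thicken G Q (ray_path w a i)" for a i
  define T where "T = {..w}"
  define V' where "V' = (\<Union>a\<in>I. \<beta> a) \<union> (\<Union>a\<in>I. \<Union>i\<in>T. P a i)"
  define Y where "Y = \<lparr>verts = V', edges = {e \<in> ?E. e \<subseteq> V'}\<rparr>"
  have fin: "finite (leaf_path w a)" "finite (ray_path w a i)" for a i
    by (simp_all add: leaf_path_def ray_path_def)
  have sub: "X \<subseteq> thicken G Q X" if "X \<subseteq> carrier G" for X
  proof
    fix x assume "x \<in> X"
    moreover from this have "x \<in> carrier G" using that by (rule subsetD[rotated])
    then have "x = x \<otimes> \<one>" by simp
    ultimately show "x \<in> thicken G Q X"
      using Q(3) unfolding thicken_def by (intro UN_I[of x] image_eqI[of _ _ \<one>])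
  qed
  have lc: "leaf_path w a \<subseteq> carrier G" if "a \<in> I" for a using leaf_path_carrier[OF w] Iv[OF that] by blast
  have rc: "ray_path w a i \<subseteq> carrier G" if "a \<in> I" "i \<in> T" for a i
    using ray_path_carrier[OF w] Iv[OF that(1)] that(2) by (auto simp: T_def)
  have tc: "thicken G Q X \<subseteq> carrier G" if "X \<subseteq> carrier G" for X
    using that Q(2) by (auto simp: thicken_def)
  have finV: "finite V'"
    unfolding V'_def \<beta>_def P_def T_def using finI fin card_thicken_le(2)[OF Q(1)] by auto
  have VG: "V' \<subseteq> carrier G"
    unfolding V'_def \<beta>_def P_def by (intro Un_least UN_least tc lc rc)
  have disj: "leaf_path w a \<inter> leaf_path w a' = {}" if "a \<in> I" "a' \<in> I" "a \<noteq> a'" for a a'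
    using leaf_paths_disjoint[OF w Iv(1)[OF that(1)] Iv(1)[OF that(2)] _ that(3)] Iv(2) that by simp
  define N where "N = real (card V')"
  have N_ge: "real (card I) * \<mu> \<le> N"
  proof -
    have "card I * 2 ^ s = (\<Sum>a\<in>I. 2 ^ s)" by simp
    also have "\<dots> \<le> (\<Sum>a\<in>I. card (leaf_path w a))" using I(3) by (intro sum_mono)
    also have "\<dots> = card (\<Union>a\<in>I. leaf_path w a)"
      using finI fin disj by (subst card_UN_disjoint) auto
    also have "\<dots> \<le> card V'"
    proof (rule card_mono[OF finV])
      have "leaf_path w a \<subseteq> \<beta> a" if "a \<in> I" for a unfolding \<beta>_def by (rule sub[OF lc[OF that]])
      then show "(\<Union>a\<in>I. leaf_path w a) \<subseteq> V'" unfolding V'_def by blast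
    qed
    finally have "real (card I * 2 ^ s) \<le> N" unfolding N_def by (rule of_nat_mono)
    then show ?thesis by (simp add: \<mu>_def)
  qed
  \<comment> \<open>The root path is no longer than a leaf path, so all rays of one branch together
    exceed the bound \<open>L\<close> at most by the factor \<open>n + 1\<close>.\<close>
  have wl: "real w + 1 \<le> 2 * \<mu>"
  proof -
    have "w + 1 \<le> 2 ^ (s + 1)" using leaf(1)[of a0] I(1,4) a0 by fastforce
    then have "real (w + 1) \<le> real (2 ^ (s + 1))" by (rule of_nat_mono)
    then show ?thesis by (simp add: \<mu>_def)
  qed
  have l\<Lambda>: "\<mu> \<le> real \<Lambda>"
  proof -
    have "2 ^ s \<le> \<Lambda>" using leaf(2)[of a0] I(1,3) a0 by fastforce
    then have "real (2 ^ s) \<le> real \<Lambda>" by (rule of_nat_mono)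
    then show ?thesis by (simp add: \<mu>_def)
  qed
  have cI: "1 \<le> real (card I)" using \<open>I \<noteq> {}\<close> finI by (simp add: Suc_leI card_gt_0_iff)
  have l1: "1 \<le> \<mu>" by (simp add: \<mu>_def)
  have N2: "2 \<le> card V'"
  proof -
    have "2 \<le> w + 1" using w by simp
    also have "\<dots> \<le> card (leaf_path w a0)" using leaf(1) I(1) a0 by blast
    also have "\<dots> \<le> card V'"
      using a0 sub[OF lc[OF a0]] by (intro card_mono[OF finV]) (auto simp: V'_def \<beta>_def)
    finally show ?thesis .
  qed
  define B where "B = (6 * \<kappa>) powr p *
    (L powr (p - 1) * (L + card T * D) + D powr (p - 1) * card V' / card T + D powr p * card I)"
  have cT: "real (card T) = real w + 1" by (simp add: T_def)
  have D1: "1 \<le> D" unfolding D_def using \<kappa>(1) by (simp add: mult_ge1_I)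
  have L0: "0 < L" using \<kappa> l1 by (simp add: L_def)
  have "0 < B"
  proof -
    have "0 < D powr (p - 1) * card V' / card T" using D1 N2 cT by simp
    moreover have "0 \<le> L powr (p - 1) * (L + card T * D)" "0 \<le> D powr p * card I" using L0 D1 by simp_all
    ultimately have "0 < L powr (p - 1) * (L + card T * D) + D powr (p - 1) * card V' / card T + D powr p * card I"
      by linarith
    then show ?thesis unfolding B_def using \<kappa>(1) by (intro mult_pos_pos) simp_all
  qed
  have "B \<le> \<epsilon> * N"
  proof -
    define \<phi> where "\<phi> = 2 * (real n + 1) * (2 * \<kappa>) powr p * real \<Lambda> powr (p - 1) * real J / real V ^ n"
    have V0: "0 < real V ^ n" using V_pos by simp
    have N0: "0 \<le> N" by (simp add: N_def)
    \<comment> \<open>The class contains at least \<open>V ^ n / J\<close> branches, and their leaf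
      paths contribute at least \<open>\<mu>\<close> vertices each.\<close>
    have lN: "\<mu> * real V ^ n \<le> real J * N"
    proof -
      have "real (V ^ n) \<le> real (J * card I)" using I(2) by (rule of_nat_mono)
      then have "\<mu> * real V ^ n \<le> \<mu> * (real J * real (card I))" using l1 by simp
      also have "\<dots> = real J * (real (card I) * \<mu>)" by simp
      also have "\<dots> \<le> real J * N" using N_ge by (intro mult_left_mono) auto
      finally show ?thesis .
    qed
    have t1: "L powr (p - 1) * (L + card T * D) \<le> \<phi> * N"
    proof -
      have "L + card T * D \<le> L + 2 * \<mu> * D" using wl cT D1 by simp
      also have "\<dots> = L * (1 + (real n + 1))" by (simp add: L_def D_def algebra_simps)
      also have "\<dots> \<le> L * (2 * (real n + 1))" using L0 by (intro mult_left_mono) auto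
      finally have "L powr (p - 1) * (L + card T * D) \<le> L powr (p - 1) * (L * (2 * (real n + 1)))"
        by (intro mult_left_mono) auto
      also have "\<dots> = 2 * (real n + 1) * L powr p" using L0 by (simp add: powr_diff)
      also have "L powr p = (2 * \<kappa>) powr p * (\<mu> powr (p - 1) * \<mu>)"
        using \<kappa>(1) l1 by (simp add: L_def powr_mult powr_diff)
      also have "2 * (real n + 1) * ((2 * \<kappa>) powr p * (\<mu> powr (p - 1) * \<mu>))
          \<le> 2 * (real n + 1) * ((2 * \<kappa>) powr p * (real \<Lambda> powr (p - 1) * (real J * N / real V ^ n)))"
        using l1 l\<Lambda> lN V0 p by (intro mult_left_mono mult_mono powr_mono2) (auto simp: field_simps)
      also have "\<dots> = \<phi> * N" by (simp add: \<phi>_def)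
      finally show ?thesis .
    qed
    have DD: "D powr (p - 1) \<le> D powr p" using D1 by (intro powr_mono) auto
    have t2: "D powr (p - 1) * card V' / card T \<le> D powr p / w * N"
    proof -
      have "D powr (p - 1) * N / card T \<le> D powr p * N / w"
        using DD N0 w cT by (intro frac_le mult_right_mono) auto
      then show ?thesis by (simp add: N_def)
    qed
    \<comment> \<open>Each leaf path has at least \<open>w / 2\<close> vertices, so the number of
      branches is at most \<open>2 * N / w\<close>; the length of the root path thereby pays for the
      rays.\<close>
    have t3: "D powr p * card I \<le> 2 * (D powr p / w) * N"
    proof -
      have "real w * card I \<le> 2 * \<mu> * card I" using wl cI by (intro mult_right_mono) auto
      also have "\<dots> \<le> 2 * N" using N_ge by (simp add: mult_ac)
      finally have "D powr p * (real w * card I) \<le> D powr p * (2 * N)" by (intro mult_left_mono) auto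
      then show ?thesis using w by (simp add: field_simps)
    qed
    have "B \<le> (6 * \<kappa>) powr p * (\<phi> * N + D powr p / w * N + 2 * (D powr p / w) * N)"
      unfolding B_def using t1 t2 t3 by (intro mult_left_mono add_mono) auto
    also have "\<dots> = (6 * \<kappa>) powr p * (\<phi> + 3 * D powr p / w) * N" by (simp add: algebra_simps)
    also have "\<dots> \<le> \<epsilon> * N"
    proof (rule mult_right_mono[OF _ N0])
      have eqs: "real \<Lambda> = 3 * (real n + 1) ^ j * real h ^ n" "real J = (j + real h + 3) * (real n + 1)"
        "real w = (real n + 1) ^ j"
        by (simp_all add: \<Lambda>_def J_def w_def algebra_simps)
      show "(6 * \<kappa>) powr p * (\<phi> + 3 * D powr p / w) \<le> \<epsilon>"
        unfolding \<phi>_def D_def eqs by (rule n)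
    qed
    finally show ?thesis .
  qed
  have inV: "\<beta> a \<subseteq> V'" "i \<in> T \<Longrightarrow> P a i \<subseteq> V'" if "a \<in> I" for a i
    using that unfolding V'_def by blast+
  have "(\<Sum>v\<in>V'. \<bar>f v\<bar> powr p) \<le> B * (\<Sum>e\<in>{e \<in> ?E. e \<subseteq> V'}. abs_gradient f e powr p)"
    if f: "(\<Sum>v\<in>V'. f v) = 0" for f
    unfolding B_def
  proof (rule tree_of_paths_poincare[where \<beta> = \<beta> and P = P and r = "\<lambda>i. el (line i)"
        and I = I and T = T and V = V' and E = "{e \<in> ?E. e \<subseteq> V'}" and f = f and \<kappa> = \<kappa> and L = L and D = D and p = p])
    show "finite {e \<in> ?E. e \<subseteq> V'}" by (rule finite_subset[of _ "Pow V'"]) (use finV in auto)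
    show "card e = 2" if "e \<in> {e \<in> ?E. e \<subseteq> V'}" for e
      using that SG(1) by (auto elim!: cayley_edge_cases)
    show "V' = (\<Union>a\<in>I. \<beta> a) \<union> (\<Union>a\<in>I. \<Union>i\<in>T. P a i)" by (rule V'_def)
    fix a assume a: "a \<in> I"
    show "connected_on {e \<in> ?E. e \<subseteq> V'} (\<beta> a)"
      unfolding \<beta>_def using Q SG w Iv(1)[OF a] inV(1)[OF a]
      by (intro connected_on_restrict connected_leaf_path) (auto simp: \<beta>_def)
    show "finite (\<beta> a)" unfolding \<beta>_def using Q fin by (intro card_thicken_le(2))
    have "card (\<beta> a) \<le> card Q * card (leaf_path w a)"
      unfolding \<beta>_def using Q fin by (intro card_thicken_le(1))
    also have "\<dots> \<le> card Q * 2 ^ (s + 1)" using I(4)[OF a] by simp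
    finally have "real (card (\<beta> a)) \<le> real (card Q * 2 ^ (s + 1))" by (rule of_nat_mono)
    also have "\<dots> = real (card Q) * (2 * \<mu>)" by (simp add: \<mu>_def)
    also have "\<dots> \<le> \<kappa> * (2 * \<mu>)" using \<kappa>(2) l1 by (intro mult_right_mono) auto
    finally show "real (card (\<beta> a)) \<le> L" by (simp add: L_def)
    fix i assume i: "i \<in> T"
    then have iw: "i \<le> w" by (simp add: T_def)
    show "connected_on {e \<in> ?E. e \<subseteq> V'} (P a i)"
      unfolding P_def using Q SG w Iv(1)[OF a] inV(2)[OF a i] iw
      by (intro connected_on_restrict connected_ray_path) (auto simp: P_def)
    show "finite (P a i)" unfolding P_def using Q fin by (intro card_thicken_le(2))
    have "card (ray_path w a i) \<le> card {..length a}" unfolding ray_path_def by (rule card_image_le) simp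
    then have "card Q * card (ray_path w a i) \<le> card Q * (n + 1)"
      using Iv(2)[OF a] by (intro mult_le_mono2) simp
    moreover have "card (P a i) \<le> card Q * card (ray_path w a i)"
      unfolding P_def using Q fin by (intro card_thicken_le(1))
    ultimately have "real (card (P a i)) \<le> real (card Q * (n + 1))" by (intro of_nat_mono) linarith
    also have "\<dots> = real (card Q) * (real n + 1)" by (simp add: distrib_left)
    also have "\<dots> \<le> \<kappa> * (real n + 1)" using \<kappa>(2) by (intro mult_right_mono) auto
    finally show "real (card (P a i)) \<le> D" by (simp add: D_def)
    note m = ray_meets_leaf[OF w Iv(1)[OF a] iw]
    show "el (line i) \<in> P a i" using m(2) sub[OF rc[OF a i]] by (auto simp: P_def)
    show "P a i \<inter> \<beta> a \<noteq> {}" using m(1) sub[OF rc[OF a i]] sub[OF lc[OF a]] by (auto simp: P_def \<beta>_def)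
  next
    fix X assume X: "X \<subseteq> V'"
    have fX: "finite X" using X finV finite_subset by blast
    have "card {e \<in> {e \<in> ?E. e \<subseteq> V'}. e \<subseteq> X} \<le> card {e \<in> ?E. e \<subseteq> X}"
      by (intro card_mono, rule finite_subset[of _ "Pow X"]) (use fX in auto)
    also have "\<dots> \<le> card S * card X" using SG fX by (intro card_cayley_edges_le)
    finally have "real (card {e \<in> {e \<in> ?E. e \<subseteq> V'}. e \<subseteq> X}) \<le> real (card S * card X)" by (rule of_nat_mono)
    also have "\<dots> \<le> \<kappa> * real (card X)" using \<kappa>(3) by (simp add: mult_right_mono)
    finally show "real (card {e \<in> {e \<in> ?E. e \<subseteq> V'}. e \<subseteq> X}) \<le> \<kappa> * real (card X)" .
  next
    fix v
    have "card {a \<in> I. v \<in> \<beta> a} \<le> card Q"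
      unfolding \<beta>_def using Q lc disj by (intro card_thicken_multiplicity) auto
    then show "real (card {a \<in> I. v \<in> \<beta> a}) \<le> \<kappa>" using \<kappa>(2) by linarith
    have eq: "{i \<in> T. \<exists>a\<in>I. v \<in> P a i} = {i \<in> T. v \<in> thicken G Q (\<Union>a\<in>I. ray_path w a i)}"
      by (auto simp: P_def thicken_def)
    have "card {i \<in> T. v \<in> thicken G Q (\<Union>a\<in>I. ray_path w a i)} \<le> card Q"
    proof (rule card_thicken_multiplicity[OF Q(1,2)])
      fix i assume i: "i \<in> T"
      then show "(\<Union>a\<in>I. ray_path w a i) \<subseteq> carrier G" using rc by blast
      fix i' assume i': "i' \<in> T" "i \<noteq> i'"
      have "ray_path w a i \<inter> ray_path w a' i' = {}" if "a \<in> I" "a' \<in> I" for a a'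
        using i i' Iv(1) that by (intro ray_paths_disjoint[OF w]) (auto simp: T_def)
      then show "(\<Union>a\<in>I. ray_path w a i) \<inter> (\<Union>a\<in>I. ray_path w a i') = {}" by blast
    qed
    then show "real (card {i \<in> T. \<exists>a\<in>I. v \<in> P a i}) \<le> \<kappa>" unfolding eq using \<kappa>(2) by linarith
  qed (use p finI \<kappa>(1) f in \<open>auto simp: T_def\<close>)
  moreover have "subgraph_of Y (cayley_graph G S)"
    using VG SG(1)
    by (auto simp: subgraph_of_def Y_def simple_graph_def all_pairs_def cayley_graph_def)
  ultimately show ?thesis
    using finV N2 \<open>0 < B\<close> \<open>B \<le> \<epsilon> * N\<close> by (intro exI[of _ Y] exI[of _ B]) (auto simp: Y_def N_def)
qed

end

section \<open>From the Coxeter presentation to the abstract setting\<close>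

lemma (in coxeter_numbers) act_word_cong:
  assumes "(u, v) \<in> word_cong A R" "\<And>r x. r \<in> R \<Longrightarrow> r \<in> words A \<Longrightarrow> act (map fst r) x = x"
  shows "act (map fst u) x = act (map fst v) x"
  using assms(1)
  by (induction arbitrary: x rule: word_cong.induct) (auto simp: act_append act_Cons assms(2))

lemma word_cong_cancel_left:
  assumes "(u @ v, u @ w) \<in> word_cong A R" "u \<in> words A"
  shows "(v, w) \<in> word_cong A R"
proof -
  let ?i = "rev (map (\<lambda>(x, b). (x, \<not> b)) u)"
  have i: "(?i @ u, []) \<in> word_cong A R" "?i \<in> words A" using inverse_word_cong[OF assms(2)] by auto
  have vw: "v \<in> words A" "w \<in> words A" using word_cong_words[OF assms(1)] by auto
  have "(?i @ u @ z, z) \<in> word_cong A R" if "z \<in> words A" for z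
    using word_cong_append[OF i(1) word_cong.refl[OF that]] by simp
  moreover have "(?i @ u @ v, ?i @ u @ w) \<in> word_cong A R"
    using word_cong_append[OF word_cong.refl[OF i(2)] assms(1)] by simp
  ultimately show ?thesis using vw by (meson word_cong.sym word_cong.trans)
qed

text \<open>Generators are involutions, so elements are represented by words in positive letters,
  embedded by \<open>pos\<close>. Completeness gives every pair of generators a finite label and
  hence a polygon; the relators act trivially by \<open>act_alt_full\<close>.\<close>

lemma coxeter_tree_of_complete_graph:
  fixes \<Gamma> :: "'a ugraph" and l :: "'a set \<Rightarrow> nat"
  defines "A \<equiv> verts \<Gamma>" and "R \<equiv> coxeter_relators \<Gamma> l" and "pos \<equiv> map (\<lambda>s::'a. (s, True))"
  assumes "finite A" "complete_graph \<Gamma>" "\<forall>e\<in>edges \<Gamma>. 3 \<le> l e" "2 * V + 5 \<le> card A" "0 < V"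
    and "length a = 3" "distinct (b # a)" "set (b # a) \<subseteq> A"
  shows "coxeter_tree A (\<lambda>s t. l {s, t}) V (\<lambda>u v. (pos u, pos v) \<in> word_cong A R)
    (coxeter_group \<Gamma> l) (\<lambda>u. word_cong A R `` {pos u}) a b"
proof -
  let ?mm = "\<lambda>s t. l {s, t}" and ?eqv = "\<lambda>u v. (pos u, pos v) \<in> word_cong A R"
  have edge: "{s, t} \<in> edges \<Gamma> \<longleftrightarrow> s \<in> A \<and> t \<in> A \<and> s \<noteq> t" for s t
    using assms(5) by (auto simp: complete_graph_def all_pairs_def A_def card_2_iff doubleton_eq_iff)
  interpret coxeter_numbers A ?mm
    by unfold_locales (use assms(4,6) edge in \<open>auto simp: insert_commute\<close>)
  have pos: "pos u \<in> words A \<longleftrightarrow> set u \<subseteq> A" for u by (auto simp: pos_def words_def)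
  have pos_append: "pos (u @ v) = pos u @ pos v" for u v by (simp add: pos_def)
  have fst_pos: "map fst (pos u) = u" for u by (simp add: pos_def comp_def)
  have pos_alt: "pos (alt s t (2 * n)) = concat (replicate n [(s, True), (t, True)])" for s t n
    by (induction n) (auto simp: pos_def)
  have relator: "(pos r, []) \<in> word_cong A R" if "pos r \<in> R" "set r \<subseteq> A" for r
    using word_cong.relator[of "[]" A "[]" "pos r" R] that pos by simp
  have act_relator: "act (map fst r) x = x" if "r \<in> R" "r \<in> words A" for r x
  proof -
    have "(\<exists>s. r = [(s, True), (s, True)])
      \<or> (\<exists>s t. r = pos (alt s t (2 * l {s, t})) \<and> {s, t} \<in> edges \<Gamma>)"
      using that(1) unfolding R_def coxeter_relators_def pos_alt by blast
    then consider s where "r = [(s, True), (s, True)]"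
      | s t where "r = pos (alt s t (2 * l {s, t}))" "{s, t} \<in> edges \<Gamma>" by blast
    then show ?thesis
    proof cases
      case 1
      then show ?thesis by (simp add: act_Cons)
    next
      case 2
      then show ?thesis using act_alt_full[of s t] edge by (simp add: fst_pos)
    qed
  qed
  interpret W: group "coxeter_group \<Gamma> l"
    unfolding coxeter_group_def by (rule group_presented_group)
  show ?thesis
  proof unfold_locales
    show "?eqv u u" if "set u \<subseteq> A" for u using that pos by (auto intro: word_cong.refl)
    show "?eqv v u" if "?eqv u v" for u v using that by (rule word_cong.sym)
    show "?eqv u w" if "?eqv u v" "?eqv v w" for u v w using that by (rule word_cong.trans)
    show "?eqv (u @ u') (v @ v')" if "?eqv u v" "?eqv u' v'" for u v u' v'
      unfolding pos_append using that by (rule word_cong_append)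
    show "?eqv [s, s] []" if "s \<in> A" for s
    proof -
      have "pos [s, s] \<in> R" using that by (auto simp: R_def coxeter_relators_def A_def pos_def)
      then show ?thesis using relator[of "[s, s]"] that by (simp add: pos_def)
    qed
    show "?eqv (alt s t (2 * l {s, t})) []" if "s \<in> A" "t \<in> A" "s \<noteq> t" for s t
    proof -
      have "pos (alt s t (2 * l {s, t})) \<in> R"
        unfolding R_def coxeter_relators_def pos_alt using edge[of s t] that by blast
      then show ?thesis
        using relator[of "alt s t (2 * l {s, t})"] that set_alt[of s t] by (fastforce simp: pos_def)
    qed
    show "act u x = act v x" if "?eqv u v" for u v x
      using act_word_cong[OF that act_relator] by (simp add: fst_pos)
    show "?eqv v w" if "?eqv (u @ v) (u @ w)" "set u \<subseteq> A" for u v w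
      using word_cong_cancel_left[of "pos u"] that pos by (simp add: pos_append)
    show "word_cong A R `` {pos u} \<in> carrier (coxeter_group \<Gamma> l)" if "set u \<subseteq> A" for u
      using that pos
      by (auto simp: coxeter_group_def presented_group_def A_def[symmetric] R_def[symmetric] intro: quotientI)
    show "word_cong A R `` {pos (u @ v)}
        = word_cong A R `` {pos u} \<otimes>\<^bsub>coxeter_group \<Gamma> l\<^esub> word_cong A R `` {pos v}"
      if "set u \<subseteq> A" "set v \<subseteq> A" for u v
      using mult_presented_group[of "pos u" A "pos v" R] that pos
      by (simp add: coxeter_group_def A_def[symmetric] R_def[symmetric] pos_append)
    show "word_cong A R `` {pos u} = word_cong A R `` {pos v} \<longleftrightarrow> ?eqv u v"
      if "set u \<subseteq> A" "set v \<subseteq> A" for u v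
      using eq_equiv_class_iff[OF equiv_word_cong] that pos by metis
  qed (use assms in auto)
qed

theorem corollary5p8:
  fixes M m :: nat
    and \<Gamma> :: "'a ugraph"
    and l :: "'a set \<Rightarrow> nat"
    and S :: "'a word set set"
  assumes "M \<ge> 3" and "m \<ge> 11"
    and "finite (verts \<Gamma>)" and "card (verts \<Gamma>) = m" and "complete_graph \<Gamma>"
    and "\<forall>e\<in>edges \<Gamma>. 3 \<le> l e \<and> l e \<le> M"
    and "finite_generating_set (coxeter_group \<Gamma> l) S"
  shows "critical_exponent (cayley_graph (coxeter_group \<Gamma> l) S)
    \<ge> ereal (1 + ln (real_of_int \<lfloor>(real m - 5) / 3\<rfloor>) / ln (2 * real M - 1))"
proof (rule critical_exponent_ge)
  fix p :: real
  assume p: "1 \<le> p" "p < 1 + ln (real_of_int \<lfloor>(real m - 5) / 3\<rfloor>) / ln (2 * real M - 1)"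
  define V where "V = (m - 5) div 3"
  have "(real m - 5) / 3 = real (m - 5) / real 3" using assms(2) by simp
  then have floor: "real_of_int \<lfloor>(real m - 5) / 3\<rfloor> = real V"
    unfolding V_def by (simp only: floor_divide_of_nat_eq of_int_of_nat_eq)
  have V: "2 \<le> V" "2 * V + 5 \<le> card (verts \<Gamma>)" using assms(2,4) by (auto simp: V_def)
  have h: "real (2 * M - 1) = 2 * real M - 1" using assms(1) by simp
  have "(p - 1) * ln (2 * real M - 1) < ln (real V)"
    using p(2) assms(1) unfolding floor by (simp add: field_simps)
  then have gap: "real (2 * M - 1) powr (p - 1) < real V"
    unfolding h using assms(1) V(1) ln_ge_iff[of "real V"] by (subst ln_less_cancel_iff[symmetric]) (auto simp: ln_powr)
  obtain xs where xs: "set xs = verts \<Gamma>" "distinct xs" using finite_distinct_list[OF assms(3)] by blast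
  \<comment> \<open>Four generators are reserved for the root path: \<open>b\<close> and the three
    labels in \<open>a\<close>.\<close>
  define ab where "ab = take 4 xs"
  have "4 \<le> length xs" using xs distinct_card[of xs] assms(2,4) by simp
  then have ab: "length ab = 4" "distinct ab" "set ab \<subseteq> verts \<Gamma>"
    using xs set_take_subset[of 4 xs] by (auto simp: ab_def)
  then obtain b a where ba: "ab = b # a" by (cases ab) auto
  interpret coxeter_tree "verts \<Gamma>" "\<lambda>s t. l {s, t}" V
    "\<lambda>u v. (map (\<lambda>s. (s, True)) u, map (\<lambda>s. (s, True)) v) \<in> word_cong (verts \<Gamma>) (coxeter_relators \<Gamma> l)"
    "coxeter_group \<Gamma> l" "\<lambda>u. word_cong (verts \<Gamma>) (coxeter_relators \<Gamma> l) `` {map (\<lambda>s. (s, True)) u}" a b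
    using assms(3,5,6) V ab unfolding ba by (intro coxeter_tree_of_complete_graph) auto
  have "l {s, t} \<le> M" if "s \<in> verts \<Gamma>" "t \<in> verts \<Gamma>" "s \<noteq> t" for s t
    using assms(5,6) that by (auto simp: complete_graph_def all_pairs_def)
  then show "\<not> coarse_le (poincare_profile (ereal p) (cayley_graph (coxeter_group \<Gamma> l) S))
      (\<lambda>r. r powr (1 - real_of_ereal (1 / ereal p)))"
    using assms(1,7) p(1) gap by (intro not_coarse_le_if_expanding expanding_subgraph[where M = M]) auto
qed

end
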